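(* Let $1<p<\infty$ and $r>0$. Let $w,\sigma$ be a pair of weights on $\mathbb R^n$ and let $\mathcal S$ be a sparse collection of dyadic cubes. Define $$\mathcal T=\sup_{R\in\mathcal S}\sigma(R)^{-\frac rp}\Big\|\sum_{\substack{Q\in\mathcal S\\ Q\subset R}}\langle\sigma\rangle_Q^r\,\mathbf 1_Q\Big\|_{L^{\frac pr}(w)}$$ and, when $p>r$, with $(\frac pr)'=\frac{p}{p-r}$, $$\mathcal T^*=\sup_{R\in\mathcal S}w(R)^{-\frac1{(p/r)'}}\Big\|\sum_{\substack{Q\in\mathcal S\\ Q\subset R}}\langle\sigma\rangle_Q^{r-1}\langle w\rangle_Q\,\mathbf 1_Q\Big\|_{L^{(p/r)'}(\sigma)}.$$ Then $$\|A_{\mathcal S}^r(\cdot\,\sigma)\|_{L^p(\sigma)\to L^p(w)}^r\simeq\begin{cases}\mathcal T+\mathcal T^*, & p>r,\\ \mathcal T, & 1<p\le r,\end{cases}$$ and $$\|A_{\mathcal S}^r(\cdot\,\sigma)\|_{L^p(\sigma)\to L^{p,\infty}(w)}^r\simeq\mathcal T^*,\qquad p>r.$$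
   Context: Work in $\mathbb R^n$ with a fixed system $\mathcal D$ of dyadic cubes. A weight is a locally integrable, a.e. positive function; $w(E)=\int_E w\,dx$, and $L^q(w)$, $L^{q,\infty}(w)$ are taken with respect to the measure $w\,dx$; $\|g\|_{L^q(w)}=(\int|g|^q w\,dx)^{1/q}$ (also for $0<q<1$) and $\|g\|_{L^{q,\infty}(w)}=\sup_{t>0}t\,w(\{|g|>t\})^{1/q}$. For a cube $Q$, $\langle f\rangle_Q:=\frac1{|Q|}\int_Q f\,dx$. A collection $\mathcal S\subset\mathcal D$ is sparse if there are pairwise disjoint subsets $E(S)\subset S$, $S\in\mathcal S$, with $|E(S)|\ge\frac12|S|$. For $r>0$ and $f\ge0$, $$A_{\mathcal S}^r(f):=\Big(\sum_{Q\in\mathcal S}\langle f\rangle_Q^r\,\mathbf 1_Q\Big)^{1/r}.$$ For $Y=L^p(w)$ or $Y=L^{p,\infty}(w)$, $\|A_{\mathcal S}^r(\cdot\,\sigma)\|_{L^p(\sigma)\to Y}$ is the least constant $N\in[0,\infty]$ such that $\|A_{\mathcal S}^r(f\sigma)\|_{Y}\le N\|f\|_{L^p(\sigma)}$ for all nonnegative $f\in L^p(\sigma)$. $X\simeq Y$ means $c\,Y\le X\le C\,Y$ with constants $0<c\le C<\infty$ independent of $w,\sigma,\mathcal S$ (as elements of $[0,\infty]$). *)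

theory Defs
  imports "HOL-Analysis.Analysis"
begin

text \<open>Real powers on \<open>[0,\<infinity>]\<close>, with \<open>0\<close> and \<open>\<infinity>\<close> interchanged by negative exponents.
  (Note that \<open>0 powr a = 0\<close> for every real \<open>a\<close>.)\<close>

definition epowr :: "ennreal \<Rightarrow> real \<Rightarrow> ennreal" where
  "epowr x a =
     (if a = 0 then 1
      else if x = 0 then (if a > 0 then 0 else \<infinity>)
      else if x = \<infinity> then (if a > 0 then \<infinity> else 0)
      else ennreal (enn2real x powr a))"

text \<open>Cubes are half-open, so that the cubes of one generation tile the space exactly.\<close>

definition cube :: "real ^ 'n \<Rightarrow> real \<Rightarrow> (real ^ 'n) set" where
  "cube a l = {x. \<forall>i. a $ i \<le> x $ i \<and> x $ i < a $ i + l}"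

text \<open>Neither the origin nor the relative shifts of the generations are prescribed: the standard
  grid and all its shifted variants are dyadic systems.\<close>

definition dyadic_system :: "(real ^ 'n) set set \<Rightarrow> bool" where
  "dyadic_system D \<longleftrightarrow>
     (\<forall>Q\<in>D. \<exists>a. \<exists>k::int. Q = cube a (2 powi k)) \<and>
     (\<forall>k::int. \<forall>x. \<exists>!Q. Q \<in> D \<and> (\<exists>a. Q = cube a (2 powi k)) \<and> x \<in> Q) \<and>
     (\<forall>Q\<in>D. \<forall>R\<in>D. Q \<inter> R = {} \<or> Q \<subseteq> R \<or> R \<subseteq> Q)"

definition sparse_collection :: "(real ^ 'n) set set \<Rightarrow> bool" where
  "sparse_collection S \<longleftrightarrow>
     (\<exists>E. disjoint_family_on E S \<and>
        (\<forall>Q\<in>S. E Q \<in> sets lebesgue \<and> E Q \<subseteq> Q \<and>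
           emeasure lebesgue (E Q) \<ge> ennreal (1/2) * emeasure lebesgue Q))"

definition weight :: "(real ^ 'n \<Rightarrow> real) \<Rightarrow> bool" where
  "weight w \<longleftrightarrow>
     w \<in> borel_measurable lebesgue \<and>
     (\<forall>K. compact K \<longrightarrow> set_integrable lebesgue K w) \<and>
     (AE x in lebesgue. 0 < w x)"

text \<open>The measure \<open>w dx\<close>. The coercion \<open>ennreal\<close> truncates negative values to \<open>0\<close>; for a weight
  this concerns a null set only.\<close>

definition wmeasure :: "(real ^ 'n \<Rightarrow> real) \<Rightarrow> (real ^ 'n) measure" where
  "wmeasure w = density lebesgue (\<lambda>x. ennreal (w x))"

definition Lq_norm :: "real \<Rightarrow> (real ^ 'n \<Rightarrow> real) \<Rightarrow> (real ^ 'n \<Rightarrow> ennreal) \<Rightarrow> ennreal" where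
  "Lq_norm q w g = epowr (\<integral>\<^sup>+x. epowr (g x) q \<partial>wmeasure w) (1/q)"

definition weak_Lq_norm :: "real \<Rightarrow> (real ^ 'n \<Rightarrow> real) \<Rightarrow> (real ^ 'n \<Rightarrow> ennreal) \<Rightarrow> ennreal" where
  "weak_Lq_norm q w g =
     (SUP t\<in>{0::real<..}. ennreal t * epowr (emeasure (wmeasure w) {x. g x > ennreal t}) (1/q))"

text \<open>Averages of a.e. nonnegative functions, with values in \<open>[0,\<infinity>]\<close>.\<close>

definition avg :: "(real ^ 'n) set \<Rightarrow> (real ^ 'n \<Rightarrow> real) \<Rightarrow> ennreal" where
  "avg Q f = (\<integral>\<^sup>+x\<in>Q. ennreal (f x) \<partial>lebesgue) / emeasure lebesgue Q"

definition sparse_op ::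
    "(real ^ 'n) set set \<Rightarrow> real \<Rightarrow> (real ^ 'n \<Rightarrow> real) \<Rightarrow> real ^ 'n \<Rightarrow> ennreal" where
  "sparse_op S r f x = epowr (\<Sum>\<^sub>\<infinity>Q\<in>S. epowr (avg Q f) r * indicator Q x) (1/r)"

text \<open>The norm of \<open>f \<mapsto> A (f \<sigma>)\<close> from \<open>L\<^sup>p(\<sigma>)\<close> to the space with norm \<open>Y\<close>. The infimum is over
  \<open>[0,\<infinity>]\<close>, so it is \<open>\<infinity>\<close> if no finite constant is admissible.\<close>

definition op_norm ::
    "real \<Rightarrow> (real ^ 'n \<Rightarrow> real) \<Rightarrow> ((real ^ 'n \<Rightarrow> ennreal) \<Rightarrow> ennreal) \<Rightarrow>
     ((real ^ 'n \<Rightarrow> real) \<Rightarrow> real ^ 'n \<Rightarrow> ennreal) \<Rightarrow> ennreal" where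
  "op_norm p \<sigma> Y A =
     Inf {N :: ennreal. \<forall>f. f \<in> borel_measurable lebesgue \<longrightarrow> (\<forall>x. 0 \<le> f x) \<longrightarrow>
            Lq_norm p \<sigma> (\<lambda>x. ennreal (f x)) < \<infinity> \<longrightarrow>
            Y (A (\<lambda>x. f x * \<sigma> x)) \<le> N * Lq_norm p \<sigma> (\<lambda>x. ennreal (f x))}"

definition testing ::
    "real \<Rightarrow> real \<Rightarrow> (real ^ 'n \<Rightarrow> real) \<Rightarrow> (real ^ 'n \<Rightarrow> real) \<Rightarrow> (real ^ 'n) set set \<Rightarrow> ennreal" where
  "testing p r w \<sigma> S =
     (SUP R\<in>S. epowr (emeasure (wmeasure \<sigma>) R) (- r/p) *
        Lq_norm (p/r) w (\<lambda>x. \<Sum>\<^sub>\<infinity>Q\<in>{Q\<in>S. Q \<subseteq> R}. epowr (avg Q \<sigma>) r * indicator Q x))"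

definition dual_testing ::
    "real \<Rightarrow> real \<Rightarrow> (real ^ 'n \<Rightarrow> real) \<Rightarrow> (real ^ 'n \<Rightarrow> real) \<Rightarrow> (real ^ 'n) set set \<Rightarrow> ennreal" where
  "dual_testing p r w \<sigma> S =
     (let q' = p / (p - r) in
      SUP R\<in>S. epowr (emeasure (wmeasure w) R) (- 1/q') *
        Lq_norm q' \<sigma> (\<lambda>x. \<Sum>\<^sub>\<infinity>Q\<in>{Q\<in>S. Q \<subseteq> R}.
          epowr (avg Q \<sigma>) (r - 1) * avg Q w * indicator Q x))"

definition comparable :: "real \<Rightarrow> real \<Rightarrow> ennreal \<Rightarrow> ennreal \<Rightarrow> bool" where
  "comparable c C X Y \<longleftrightarrow> ennreal c * Y \<le> X \<and> X \<le> ennreal C * Y"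

end

theory Submission
  imports Defs
begin

text \<open>Write \<open>\<mu> = \<sigma> dx\<close>, \<open>\<nu> = w dx\<close>, \<open>s = p / r\<close>, \<open>\<lambda>\<^sub>Q = \<langle>\<sigma>\<rangle>\<^sub>Q\<^sup>r\<close>, and let \<open>m\<^sub>Q f\<close> be the mean of \<open>f\<close> over \<open>Q\<close> with
  respect to \<open>\<mu>\<close>. Since \<open>\<langle>f \<sigma>\<rangle>\<^sub>Q\<close> is the product of \<open>m\<^sub>Q f\<close> and \<open>\<langle>\<sigma>\<rangle>\<^sub>Q\<close>, the \<open>r\<close>-th power of the
  sparse operator is \<open>\<Sum> \<lambda>\<^sub>Q (m\<^sub>Q f)\<^sup>r 1\<^sub>Q\<close>, and its \<open>L\<^sup>p\<close> norm is an \<open>L\<^sup>s\<close> norm of this sum. The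
  weights of the dual testing sum are \<open>\<lambda>\<^sub>Q \<nu>(Q) / \<mu>(Q)\<close>. So everything is a statement about two
  measures, nonnegative numbers \<open>\<lambda>\<^sub>Q\<close>, and a family of sets any two of which are nested or disjoint;
  as all constants depend on the exponents only, monotone convergence reduces it to finite families.

  The common tool is a choice of stopping cubes: those cubes at which the dyadic level of the mean
  exceeds its level at all larger cubes. Every cube \<open>Q\<close> with positive mean lies in a least stopping
  cube \<open>stop Q\<close>, whose mean controls that of \<open>Q\<close> up to a factor 2, and since levels increase along chains the means of
  the stopping cubes containing a point add up like a geometric series. This gives the Carleson
  embedding (\<open>carleson_embedding\<close>) and from it a dyadic maximal theorem (\<open>exists_majorant\<close>).

  For \<open>p \<le> r\<close> the power \<open>s \<le> 1\<close> is subadditive, so the sum can be split according to \<open>stop Q\<close>; the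
  testing condition bounds each piece and the Carleson embedding adds the pieces up.

  For \<open>p > r\<close> the maximal theorem replaces \<open>(m\<^sub>Q f)\<^sup>r\<close> by \<open>m\<^sub>Q h\<close> with
  \<open>\<parallel>h\<parallel>\<^sub>s \<lesssim> \<parallel>f\<parallel>\<^sub>p\<^sup>r\<close>, and conversely, so the question is about the linear positive operator
  \<open>T h = \<Sum> \<lambda>\<^sub>Q m\<^sub>Q h 1\<^sub>Q\<close> from \<open>L\<^sup>s(\<mu>)\<close> to \<open>L\<^sup>s(\<nu>)\<close>; the two testing conditions are those of \<open>T\<close> and of
  its adjoint. Strong bound: in the bilinear form \<open>\<integral> T h g d\<nu>\<close> the stopping cubes of \<open>h\<close> and of \<open>g\<close>
  containing a given \<open>Q\<close> are nested, and each of the two orders is controlled by one of the testing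
  conditions (\<open>bilinear_bound\<close>); then take \<open>g\<close> a small multiple of \<open>(T h)\<^sup>s\<^sup>-\<^sup>1\<close> and absorb. Weak bound:
  \<open>T h\<close> exceeds \<open>t\<close> on a union of cubes, and dual testing on the maximal ones gives a good-lambda
  inequality (\<open>good_lambda_inequality\<close>). Necessity of testing follows by inserting \<open>1\<^sub>R\<close>. For the
  necessity of dual testing, \<open>G\<close> being the dual testing sum for \<open>R\<close>, one inserts \<open>h = G\<^sup>q\<^sup>-\<^sup>1\<close>, with \<open>q\<close>
  conjugate to \<open>s\<close>, and integrates the weak-type estimate over \<open>R\<close>
  (\<open>dual_testing_of_weak_bound\<close>).

  Instead of Hoelder's inequality the proofs use Young's inequality pointwise and absorb a finite
  term; on a finite family all relevant quantities are finite.\<close>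

lemma powr_diff_one_mult:
  fixes x :: real
  assumes "0 \<le> x"
  shows "x powr (s - 1) * x = x powr s"
  using powr_mult_base[OF assms, of "s - 1"] by (simp add: mult.commute)

section \<open>Dyadic levels and geometric sums\<close>

definition lev :: "real \<Rightarrow> int" where
  "lev t = \<lceil>log 2 t\<rceil>"

lemma le_powr_lev:
  assumes "0 < t"
  shows "t \<le> 2 powr real_of_int (lev t)"
proof -
  have "log 2 t \<le> real_of_int (lev t)"
    unfolding lev_def by linarith
  then show ?thesis
    using assms by (simp add: log_le_iff)
qed

lemma powr_lev_less:
  assumes "0 < t"
  shows "2 powr real_of_int (lev t) < 2 * t"
proof -
  have "real_of_int (lev t) < log 2 t + 1"
    unfolding lev_def by linarith
  also have "\<dots> = log 2 (2 * t)"
    using assms by (simp add: log_mult)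
  finally show ?thesis
    using assms by (simp add: less_log_iff)
qed

lemma lev_mono: "0 < t \<Longrightarrow> t \<le> u \<Longrightarrow> lev t \<le> lev u"
  unfolding lev_def by (intro ceiling_mono) simp

lemma le_double_of_lev_le:
  assumes "0 < t" "0 < u" "lev t \<le> lev u"
  shows "t \<le> 2 * u"
proof -
  have "t \<le> 2 powr real_of_int (lev t)"
    using assms by (simp add: le_powr_lev)
  also have "\<dots> \<le> 2 powr real_of_int (lev u)"
    using assms by simp
  also have "\<dots> < 2 * u"
    using assms by (simp add: powr_lev_less)
  finally show ?thesis by simp
qed

lemma sum_powr_int_le:
  fixes J :: "int set" and \<alpha> :: real
  assumes "finite J" "\<And>j. j \<in> J \<Longrightarrow> j \<le> m" "0 < \<alpha>"
  shows "(\<Sum>j\<in>J. 2 powr (real_of_int j * \<alpha>)) \<le> 2 powr (real_of_int m * \<alpha>) / (1 - 2 powr (-\<alpha>))"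
proof -
  define x :: real where "x = 2 powr (-\<alpha>)"
  have x: "0 < x" "x < 1"
    using assms(3) by (auto simp: x_def powr_less_one)
  have inj: "inj_on (\<lambda>j. nat (m - j)) J"
  proof (rule inj_onI)
    fix i j assume "i \<in> J" "j \<in> J" "nat (m - i) = nat (m - j)"
    then show "i = j"
      using assms(2)[of i] assms(2)[of j] by linarith
  qed
  have summand: "2 powr (real_of_int j * \<alpha>) = 2 powr (real_of_int m * \<alpha>) * x ^ nat (m - j)"
    if "j \<in> J" for j
  proof -
    have "x ^ nat (m - j) = 2 powr (- \<alpha> * real (nat (m - j)))"
      unfolding x_def by (simp add: powr_powr flip: powr_realpow)
    also have "real (nat (m - j)) = real_of_int m - real_of_int j"
      using assms(2)[OF that] by simp
    finally show ?thesis
      by (simp flip: powr_add) (simp add: algebra_simps)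
  qed
  have "(\<Sum>j\<in>J. 2 powr (real_of_int j * \<alpha>))
      = 2 powr (real_of_int m * \<alpha>) * (\<Sum>j\<in>J. x ^ nat (m - j))"
    unfolding sum_distrib_left by (intro sum.cong refl summand)
  also have "(\<Sum>j\<in>J. x ^ nat (m - j)) = (\<Sum>i\<in>(\<lambda>j. nat (m - j)) ` J. x ^ i)"
    using inj by (simp add: sum.reindex)
  also have "\<dots> \<le> (\<Sum>i. x ^ i)"
    using assms(1) x by (intro sum_le_suminf summable_geometric) auto
  also have "\<dots> = 1 / (1 - x)"
    using x by (intro suminf_geometric) simp
  finally show ?thesis
    by (simp add: x_def)
qed

text \<open>Numbers with distinct dyadic levels are comparable to distinct powers of 2, so the sum of their
  \<open>\<alpha>\<close>-th powers is dominated by the geometric series ending at the level of \<open>b\<close>.\<close>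

lemma sum_powr_distinct_levels_le:
  fixes a :: "'b \<Rightarrow> real"
  assumes "finite C" "inj_on (\<lambda>F. lev (a F)) C" "\<And>F. F \<in> C \<Longrightarrow> 0 < a F \<and> a F \<le> b" "0 < \<alpha>"
    "0 \<le> b"
  shows "(\<Sum>F\<in>C. a F powr \<alpha>) \<le> (2 * b) powr \<alpha> / (1 - 2 powr (-\<alpha>))"
proof (cases "C = {}")
  case True
  have "2 powr (-\<alpha>) < (1::real)"
    using assms(4) by (simp add: powr_less_one)
  then show ?thesis
    using True by simp
next
  case False
  then have b: "0 < b"
    using assms(3) by fastforce
  have q: "2 powr (-\<alpha>) < (1::real)"
    using assms(4) by (simp add: powr_less_one)
  have "(\<Sum>F\<in>C. a F powr \<alpha>) \<le> (\<Sum>F\<in>C. 2 powr (real_of_int (lev (a F)) * \<alpha>))"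
  proof (rule sum_mono)
    fix F assume "F \<in> C"
    then have "a F powr \<alpha> \<le> (2 powr real_of_int (lev (a F))) powr \<alpha>"
      using assms(3,4) by (intro powr_mono2 le_powr_lev) (auto intro: less_imp_le)
    then show "a F powr \<alpha> \<le> 2 powr (real_of_int (lev (a F)) * \<alpha>)"
      by (simp add: powr_powr)
  qed
  also have "\<dots> = (\<Sum>j\<in>(\<lambda>F. lev (a F)) ` C. 2 powr (real_of_int j * \<alpha>))"
    using assms(2) by (simp add: sum.reindex)
  also have "\<dots> \<le> 2 powr (real_of_int (lev b) * \<alpha>) / (1 - 2 powr (-\<alpha>))"
    using assms by (intro sum_powr_int_le) (auto intro!: lev_mono)
  also have "2 powr (real_of_int (lev b) * \<alpha>) = (2 powr real_of_int (lev b)) powr \<alpha>"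
    by (simp add: powr_powr)
  also have "\<dots> / (1 - 2 powr (-\<alpha>)) \<le> (2 * b) powr \<alpha> / (1 - 2 powr (-\<alpha>))"
    using q b assms(4) powr_lev_less[OF b] by (intro divide_right_mono powr_mono2) auto
  finally show ?thesis .
qed

section \<open>Stopping cubes in a finite laminar family\<close>

locale laminar_family =
  fixes S :: "'a set set"
  assumes finite_family: "finite S"
    and nonempty: "Q \<in> S \<Longrightarrow> Q \<noteq> {}"
    and laminar: "Q \<in> S \<Longrightarrow> R \<in> S \<Longrightarrow> Q \<inter> R = {} \<or> Q \<subseteq> R \<or> R \<subseteq> Q"
begin

lemma nested:
  assumes "Q \<in> S" "R \<in> S" "x \<in> Q" "x \<in> R"
  shows "Q \<subseteq> R \<or> R \<subseteq> Q"
  using laminar[OF assms(1,2)] assms(3,4) by blast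

lemma nested_above:
  assumes "Q \<in> S" "R \<in> S" "P \<in> S" "P \<subseteq> Q" "P \<subseteq> R"
  shows "Q \<subseteq> R \<or> R \<subseteq> Q"
  using nonempty[OF assms(3)] nested[OF assms(1,2)] assms(4,5) by blast

lemma exists_least:
  assumes "A \<subseteq> S" "A \<noteq> {}" "\<And>Q. Q \<in> A \<Longrightarrow> x \<in> Q"
  obtains P where "P \<in> A" "\<And>Q. Q \<in> A \<Longrightarrow> P \<subseteq> Q"
proof -
  have "finite A"
    using assms(1) finite_family finite_subset by blast
  then obtain P where P: "P \<in> A" "\<And>Q. Q \<in> A \<Longrightarrow> Q \<subseteq> P \<Longrightarrow> P = Q"
    using finite_has_minimal[of A] assms(2) by blast
  have "P \<subseteq> Q" if "Q \<in> A" for Q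
    using nested[of P Q x] P that assms by blast
  with P that show thesis by blast
qed

text \<open>Discretizing \<open>a\<close> by its dyadic level turns the usual recursive selection of stopping cubes (pass
  to the maximal subcubes on which the mean has doubled) into an explicit condition.\<close>

definition records :: "('a set \<Rightarrow> real) \<Rightarrow> 'a set set" where
  "records a = {Q \<in> S. 0 < a Q \<and> (\<forall>R\<in>S. Q \<subset> R \<longrightarrow> 0 < a R \<longrightarrow> lev (a R) < lev (a Q))}"

text \<open>The stopping cubes containing \<open>Q\<close> form a finite chain, so the intersection is the least of them
  if there are any.\<close>

definition stop :: "('a set \<Rightarrow> real) \<Rightarrow> 'a set \<Rightarrow> 'a set" where
  "stop a Q = \<Inter>{F \<in> records a. Q \<subseteq> F}"

lemma records_subset: "records a \<subseteq> S"
  by (auto simp: records_def)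

lemma finite_records: "finite (records a)"
  using records_subset finite_family by (rule finite_subset)

lemma records_pos: "F \<in> records a \<Longrightarrow> 0 < a F"
  by (auto simp: records_def)

lemma inj_on_lev_records:
  assumes "C \<subseteq> records a" "\<And>F. F \<in> C \<Longrightarrow> x \<in> F"
  shows "inj_on (\<lambda>F. lev (a F)) C"
proof (rule inj_onI)
  fix F G assume FG: "F \<in> C" "G \<in> C" "lev (a F) = lev (a G)"
  then have "F \<subseteq> G \<or> G \<subseteq> F"
    using nested[of F G x] assms records_subset by blast
  moreover have "F \<in> records a" "G \<in> records a"
    using FG assms(1) by auto
  then have "\<not> F \<subset> G" "\<not> G \<subset> F"
    using FG(3) by (auto simp: records_def)
  ultimately show "F = G"
    by blast
qed

text \<open>Among the cubes above \<open>Q\<close> whose level is at least that of \<open>Q\<close>, a maximal one is a record. The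
  least record above \<open>Q\<close> lies inside it and thus has at least the same level.\<close>

lemma stop_props:
  assumes "Q \<in> S" "0 < a Q"
  shows stop_in_records: "stop a Q \<in> records a"
    and subset_stop: "Q \<subseteq> stop a Q"
    and le_stop: "a Q \<le> 2 * a (stop a Q)"
proof -
  define A where "A = {R \<in> S. Q \<subseteq> R \<and> 0 < a R \<and> lev (a Q) \<le> lev (a R)}"
  have "finite A" "A \<noteq> {}"
    using assms finite_family by (auto simp: A_def)
  then obtain R where R: "R \<in> A" "\<And>R'. R' \<in> A \<Longrightarrow> R \<subseteq> R' \<Longrightarrow> R = R'"
    using finite_has_maximal[of A] by blast
  have rec: "R \<in> records a"
    unfolding records_def
  proof (intro CollectI conjI ballI impI)
    fix R' assume R': "R' \<in> S" "R \<subset> R'" "0 < a R'"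
    then have "R' \<notin> A"
      using R by blast
    then show "lev (a R') < lev (a R)"
      using R' R(1) by (auto simp: A_def)
  qed (use R in \<open>auto simp: A_def\<close>)
  have QR: "Q \<subseteq> R"
    using R(1) by (simp add: A_def)
  obtain x where x: "x \<in> Q"
    using nonempty[OF assms(1)] by blast
  let ?B = "{F \<in> records a. Q \<subseteq> F}"
  obtain P where P: "P \<in> ?B" "\<And>F. F \<in> ?B \<Longrightarrow> P \<subseteq> F"
    using exists_least[of ?B x] rec QR x records_subset by blast
  then have stop: "stop a Q = P"
    unfolding stop_def by blast
  show "stop a Q \<in> records a" "Q \<subseteq> stop a Q"
    using P(1) stop by auto
  have "P \<subseteq> R"
    using P(2) rec QR by blast
  moreover have "lev (a R) < lev (a P)" if "P \<subset> R"
    using P(1) R(1) that by (auto simp: records_def A_def)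
  ultimately have "lev (a R) \<le> lev (a P)"
    by (cases "P = R") (simp_all add: psubset_eq)
  then show "a Q \<le> 2 * a (stop a Q)"
    using R(1) P(1) records_pos assms(2) unfolding stop A_def
    by (intro le_double_of_lev_le) auto
qed

text \<open>Any set between \<open>Q\<close> and \<open>stop Q\<close> determines \<open>stop Q\<close>. In the two-weight estimate, a stopping cube
  of the second function that lies inside stopping cubes of the first one is thereby counted once.\<close>

lemma stop_eq_between:
  assumes "Q \<subseteq> G" "G \<subseteq> stop a Q"
  shows "stop a G = stop a Q"
  using assms unfolding stop_def by blast

end

section \<open>The Carleson embedding for stopping cubes\<close>

definition mean :: "'a measure \<Rightarrow> ('a \<Rightarrow> real) \<Rightarrow> 'a set \<Rightarrow> real" where
  "mean M f Q = enn2real (\<integral>\<^sup>+x\<in>Q. ennreal (f x) \<partial>M) / measure M Q"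

lemma mean_nonneg [simp]: "0 \<le> mean M f Q"
  by (simp add: mean_def)

locale laminar_measure = laminar_family S for S :: "'a set set" +
  fixes M :: "'a measure"
  assumes sets_family[intro, simp]: "Q \<in> S \<Longrightarrow> Q \<in> sets M"
    and emeasure_pos: "Q \<in> S \<Longrightarrow> 0 < emeasure M Q"
    and emeasure_finite: "Q \<in> S \<Longrightarrow> emeasure M Q < \<infinity>"
begin

lemma emeasure_eq: "Q \<in> S \<Longrightarrow> emeasure M Q = ennreal (measure M Q)"
  using emeasure_finite[of Q] by (intro emeasure_eq_ennreal_measure) auto

lemma measure_pos: "Q \<in> S \<Longrightarrow> 0 < measure M Q"
  using emeasure_pos[of Q] emeasure_finite[of Q] by (simp add: emeasure_eq)

text \<open>If the integral is infinite then \<open>mean\<close> takes the default value 0; so only the inequality holds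
  in general.\<close>

lemma mean_le:
  assumes "Q \<in> S"
  shows "ennreal (mean M f Q) * emeasure M Q \<le> (\<integral>\<^sup>+x\<in>Q. ennreal (f x) \<partial>M)"
proof -
  have "ennreal (mean M f Q) * emeasure M Q = ennreal (enn2real (\<integral>\<^sup>+x\<in>Q. ennreal (f x) \<partial>M))"
    using measure_pos[OF assms] by (simp add: emeasure_eq[OF assms] mean_def flip: ennreal_mult)
  also have "\<dots> \<le> (\<integral>\<^sup>+x\<in>Q. ennreal (f x) \<partial>M)"
    by (simp add: ennreal_enn2real_if)
  finally show ?thesis .
qed

lemma mean_eq:
  assumes "Q \<in> S" "(\<integral>\<^sup>+x\<in>Q. ennreal (f x) \<partial>M) < \<infinity>"
  shows "ennreal (mean M f Q) * emeasure M Q = (\<integral>\<^sup>+x\<in>Q. ennreal (f x) \<partial>M)"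
  using assms measure_pos[OF assms(1)]
  by (simp add: emeasure_eq mean_def flip: ennreal_mult)

end

abbreviation power_integral :: "'a measure \<Rightarrow> real \<Rightarrow> ('a \<Rightarrow> real) \<Rightarrow> ennreal" where
  "power_integral M s f \<equiv> (\<integral>\<^sup>+x. ennreal (f x powr s) \<partial>M)"

definition carleson_const :: "real \<Rightarrow> real" where
  "carleson_const s = 2 * 4 powr (s - 1) / (1 - 2 powr (1 - s))"

lemma carleson_const_pos: "1 < s \<Longrightarrow> 0 < carleson_const s"
  by (simp add: carleson_const_def powr_less_one)

lemma carleson_const_nonneg: "1 < s \<Longrightarrow> 0 \<le> carleson_const s"
  by (simp add: carleson_const_def powr_less_one less_imp_le)

context laminar_measure
begin

text \<open>On a stopping cube \<open>F\<close> the part of \<open>f\<close> below half of its mean \<open>a\<^sub>F\<close> contributes at most half of the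
  integral, so \<open>a\<^sub>F M(F) \<le> 2 \<integral>\<^sub>F f 1{a\<^sub>F < 2 f}\<close>. Multiply by \<open>a\<^sub>F\<^sup>s\<^sup>-\<^sup>1\<close> and sum inside the integral: at a point
  \<open>x\<close> the occurring means are at most \<open>2 f(x)\<close> and have distinct levels, so the sum of their powers
  is at most a multiple of \<open>f(x)\<^sup>s\<^sup>-\<^sup>1\<close>.\<close>

lemma carleson_embedding:
  assumes f: "f \<in> borel_measurable M" "\<And>x. 0 \<le> f x" and s: "1 < s"
  shows "(\<Sum>F\<in>records (mean M f). ennreal (mean M f F powr s) * emeasure M F)
    \<le> ennreal (carleson_const s) * power_integral M s f"
proof -
  let ?a = "mean M f"
  let ?R = "records ?a"
  define f' where "f' F x = f x * indicator {x. ?a F < 2 * f x} x" for F x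
  have R: "F \<in> S" if "F \<in> ?R" for F
    using records_subset that by blast
  have [measurable]: "f \<in> borel_measurable M" by (rule f)
  have f'_meas [measurable]: "f' F \<in> borel_measurable M" for F
    unfolding f'_def by measurable
  have half: "ennreal (?a F) * emeasure M F \<le> 2 * (\<integral>\<^sup>+x\<in>F. ennreal (f' F x) \<partial>M)"
    if F: "F \<in> ?R" for F
  proof -
    have FS [measurable]: "F \<in> sets M"
      using R[OF F] by simp
    have "ennreal (?a F) * emeasure M F \<le> (\<integral>\<^sup>+x\<in>F. ennreal (f x) \<partial>M)"
      using R[OF F] by (rule mean_le)
    also have "\<dots> \<le> (\<integral>\<^sup>+x. (ennreal (f' F x) + ennreal (?a F / 2)) * indicator F x \<partial>M)"
      using f(2) by (intro nn_integral_mono)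
        (auto simp: f'_def indicator_def simp flip: ennreal_plus intro!: ennreal_leI)
    also have "\<dots> = (\<integral>\<^sup>+x\<in>F. ennreal (f' F x) \<partial>M) + ennreal (?a F / 2) * emeasure M F"
      by (simp add: distrib_right nn_integral_add nn_integral_cmult_indicator)
    finally have *: "ennreal (?a F) * emeasure M F
        \<le> (\<integral>\<^sup>+x\<in>F. ennreal (f' F x) \<partial>M) + ennreal (?a F / 2) * emeasure M F" .
    show ?thesis
    proof (cases "(\<integral>\<^sup>+x\<in>F. ennreal (f' F x) \<partial>M)")
      case (real v)
      then show ?thesis
        using * by (simp add: emeasure_eq[OF R[OF F]] flip: ennreal_mult ennreal_plus ennreal_numeral)
    next
      case top
      then show ?thesis
        by (simp add: ennreal_mult_top)
    qed
  qed
  have "(\<Sum>F\<in>?R. ennreal (?a F powr s) * emeasure M F)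
      = (\<Sum>F\<in>?R. ennreal (?a F powr (s - 1)) * (ennreal (?a F) * emeasure M F))"
    by (intro sum.cong refl)
      (simp add: powr_diff_one_mult mult.assoc[symmetric] flip: ennreal_mult)
  also have "\<dots> \<le> (\<Sum>F\<in>?R. ennreal (?a F powr (s - 1)) * (2 * (\<integral>\<^sup>+x\<in>F. ennreal (f' F x) \<partial>M)))"
    by (intro sum_mono mult_left_mono half) auto
  also have "\<dots> = (\<integral>\<^sup>+x. (\<Sum>F\<in>?R. ennreal (?a F powr (s - 1)) * (2 * (ennreal (f' F x) * indicator F x))) \<partial>M)"
  proof -
    have [measurable]: "F \<in> sets M" if "F \<in> ?R" for F
      using R[OF that] by simp
    have "(\<integral>\<^sup>+x. (\<Sum>F\<in>?R. ennreal (?a F powr (s - 1)) * (2 * (ennreal (f' F x) * indicator F x))) \<partial>M)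
        = (\<Sum>F\<in>?R. \<integral>\<^sup>+x. ennreal (?a F powr (s - 1)) * (2 * (ennreal (f' F x) * indicator F x)) \<partial>M)"
      by (rule nn_integral_sum) measurable
    also have "\<dots> = (\<Sum>F\<in>?R. ennreal (?a F powr (s - 1)) * (2 * (\<integral>\<^sup>+x\<in>F. ennreal (f' F x) \<partial>M)))"
    proof (rule sum.cong[OF refl])
      fix F assume [simp]: "F \<in> ?R"
      have "(\<integral>\<^sup>+x. ennreal (?a F powr (s - 1)) * (2 * (ennreal (f' F x) * indicator F x)) \<partial>M)
          = ennreal (?a F powr (s - 1)) * (\<integral>\<^sup>+x. 2 * (ennreal (f' F x) * indicator F x) \<partial>M)"
        by (rule nn_integral_cmult) measurable
      also have "(\<integral>\<^sup>+x. 2 * (ennreal (f' F x) * indicator F x) \<partial>M) = 2 * (\<integral>\<^sup>+x\<in>F. ennreal (f' F x) \<partial>M)"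
        by (rule nn_integral_cmult) measurable
      finally show "(\<integral>\<^sup>+x. ennreal (?a F powr (s - 1)) * (2 * (ennreal (f' F x) * indicator F x)) \<partial>M)
          = ennreal (?a F powr (s - 1)) * (2 * (\<integral>\<^sup>+x\<in>F. ennreal (f' F x) \<partial>M))" .
    qed
    finally show ?thesis by simp
  qed
  also have "\<dots> \<le> (\<integral>\<^sup>+x. ennreal (carleson_const s) * ennreal (f x powr s) \<partial>M)"
  proof (rule nn_integral_mono)
    fix x
    let ?C = "{F \<in> ?R. x \<in> F \<and> ?a F < 2 * f x}"
    have "(\<Sum>F\<in>?R. if x \<in> F \<and> ?a F < 2 * f x then 2 * f x * ?a F powr (s - 1) else 0)
        = (\<Sum>F\<in>?C. 2 * f x * ?a F powr (s - 1))"
      by (rule sum.inter_filter[symmetric]) (rule finite_records)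
    also have "\<dots> = 2 * f x * (\<Sum>F\<in>?C. ?a F powr (s - 1))"
      by (simp add: sum_distrib_left)
    also have "\<dots> \<le> 2 * f x * ((2 * (2 * f x)) powr (s - 1) / (1 - 2 powr (-(s - 1))))"
    proof (intro mult_left_mono sum_powr_distinct_levels_le)
      show "finite ?C"
        using finite_records by simp
      show "inj_on (\<lambda>F. lev (?a F)) ?C"
        by (rule inj_on_lev_records[of _ _ x]) auto
    qed (use f(2) s records_pos in auto)
    also have "\<dots> = carleson_const s * f x powr s"
      using f(2)[of x] powr_mult_base[of "f x" "s - 1"]
      by (simp add: carleson_const_def powr_mult)
    finally have bound: "(\<Sum>F\<in>?R. if x \<in> F \<and> ?a F < 2 * f x then 2 * f x * ?a F powr (s - 1) else 0)
        \<le> carleson_const s * f x powr s" .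
    have "(\<Sum>F\<in>?R. ennreal (?a F powr (s - 1)) * (2 * (ennreal (f' F x) * indicator F x)))
        = (\<Sum>F\<in>?R. ennreal (if x \<in> F \<and> ?a F < 2 * f x then 2 * f x * ?a F powr (s - 1) else 0))"
    proof (intro sum.cong refl)
      fix F
      show "ennreal (?a F powr (s - 1)) * (2 * (ennreal (f' F x) * indicator F x))
          = ennreal (if x \<in> F \<and> ?a F < 2 * f x then 2 * f x * ?a F powr (s - 1) else 0)"
        using f(2)[of x]
        by (cases "x \<in> F \<and> ?a F < 2 * f x") (auto simp: f'_def ennreal_mult ac_simps)
    qed
    also have "\<dots> = ennreal (\<Sum>F\<in>?R. if x \<in> F \<and> ?a F < 2 * f x then 2 * f x * ?a F powr (s - 1) else 0)"
      using f(2) by (intro sum_ennreal) auto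
    finally show "(\<Sum>F\<in>?R. ennreal (?a F powr (s - 1)) * (2 * (ennreal (f' F x) * indicator F x)))
        \<le> ennreal (carleson_const s) * ennreal (f x powr s)"
      using bound carleson_const_nonneg[OF s] by (simp add: ennreal_leI flip: ennreal_mult)
  qed
  also have "\<dots> = ennreal (carleson_const s) * power_integral M s f"
    by (rule nn_integral_cmult) measurable
  finally show ?thesis .
qed

end

context laminar_measure
begin

lemma nn_integral_sum_indicator:
  assumes "C \<subseteq> S" "\<And>Q. Q \<in> C \<Longrightarrow> 0 \<le> c Q"
  shows "(\<integral>\<^sup>+x. ennreal (\<Sum>Q\<in>C. c Q * indicator Q x) \<partial>M) = (\<Sum>Q\<in>C. ennreal (c Q) * emeasure M Q)"
proof -
  have C: "Q \<in> sets M" if "Q \<in> C" for Q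
    using assms(1) that by auto
  have "(\<integral>\<^sup>+x. ennreal (\<Sum>Q\<in>C. c Q * indicator Q x) \<partial>M)
      = (\<integral>\<^sup>+x. (\<Sum>Q\<in>C. ennreal (c Q) * indicator Q x) \<partial>M)"
    using assms(2) by (simp add: ennreal_mult ennreal_indicator flip: sum_ennreal)
  also have "\<dots> = (\<Sum>Q\<in>C. \<integral>\<^sup>+x. ennreal (c Q) * indicator Q x \<partial>M)"
    using C by (intro nn_integral_sum) simp
  also have "\<dots> = (\<Sum>Q\<in>C. ennreal (c Q) * emeasure M Q)"
    using C by (intro sum.cong refl nn_integral_cmult_indicator)
  finally show ?thesis .
qed

lemma sum_indicator_measurable [measurable]:
  fixes c :: "'a set \<Rightarrow> real"
  assumes "C \<subseteq> S"
  shows "(\<lambda>x. \<Sum>Q\<in>C. c Q * indicator Q x) \<in> borel_measurable M"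
proof (rule borel_measurable_sum)
  fix Q assume "Q \<in> C"
  then have [measurable]: "Q \<in> sets M"
    using assms by auto
  show "(\<lambda>x. c Q * indicator Q x) \<in> borel_measurable M"
    by measurable
qed

text \<open>A dyadic maximal theorem. The \<open>\<ell>\<^sup>s\<close> sum of \<open>2 a\<^sub>F 1\<^sub>F\<close> over the stopping cubes dominates every mean
  over a cube containing the point, and its norm is computed by the Carleson embedding.\<close>

lemma exists_majorant:
  assumes f: "f \<in> borel_measurable M" "\<And>x. 0 \<le> f x" and s: "1 < s"
  obtains m where "m \<in> borel_measurable M" "\<And>x. 0 \<le> m x"
    "\<And>Q x. Q \<in> S \<Longrightarrow> x \<in> Q \<Longrightarrow> mean M f Q \<le> m x"
    "power_integral M s m
      \<le> ennreal (2 powr s * carleson_const s) * power_integral M s f"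
proof
  let ?a = "mean M f"
  let ?R = "records ?a"
  define v where "v x = (\<Sum>F\<in>?R. (2 * ?a F) powr s * indicator F x)" for x
  define m where "m x = v x powr (1 / s)" for x
  have v_nonneg: "0 \<le> v x" for x
    unfolding v_def by (intro sum_nonneg) simp
  have [measurable]: "v \<in> borel_measurable M"
    unfolding v_def by (rule sum_indicator_measurable) (rule records_subset)
  show "m \<in> borel_measurable M"
    unfolding m_def by measurable
  show "0 \<le> m x" for x
    by (simp add: m_def)
  show "?a Q \<le> m x" if Q: "Q \<in> S" "x \<in> Q" for Q x
  proof (cases "?a Q = 0")
    case False
    then have pos: "0 < ?a Q"
      by (auto simp: less_le)
    let ?F = "stop ?a Q"
    have F: "?F \<in> ?R" "x \<in> ?F" "?a Q \<le> 2 * ?a ?F"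
      using stop_props[of Q ?a, OF Q(1) pos] Q(2) by auto
    have "(2 * ?a ?F) powr s * indicator ?F x \<le> v x"
      unfolding v_def using F(1) finite_records by (intro member_le_sum) auto
    then have "?a Q powr s \<le> v x"
      using F(2,3) s pos powr_mono2[of s "?a Q" "2 * ?a ?F"] by simp
    then have "(?a Q powr s) powr (1 / s) \<le> m x"
      unfolding m_def using s by (intro powr_mono2) auto
    then show ?thesis
      using s by (simp add: powr_powr)
  qed (simp add: m_def)
  have "power_integral M s m = (\<integral>\<^sup>+x. ennreal (v x) \<partial>M)"
    using s v_nonneg by (simp add: m_def powr_powr)
  also have "\<dots> = (\<Sum>F\<in>?R. ennreal ((2 * ?a F) powr s) * emeasure M F)"
    unfolding v_def by (rule nn_integral_sum_indicator) (auto simp: records_def)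
  also have "\<dots> = ennreal (2 powr s) * (\<Sum>F\<in>?R. ennreal (?a F powr s) * emeasure M F)"
    by (simp add: sum_distrib_left powr_mult ennreal_mult mult.assoc)
  also have "\<dots> \<le> ennreal (2 powr s) * (ennreal (carleson_const s) * power_integral M s f)"
    by (intro mult_left_mono carleson_embedding f s) simp
  finally show "power_integral M s m
      \<le> ennreal (2 powr s * carleson_const s) * power_integral M s f"
    using carleson_const_nonneg[OF s] by (simp add: ennreal_mult mult.assoc)
qed

lemma le_mean:
  assumes "Q \<in> S" "(\<integral>\<^sup>+x\<in>Q. ennreal (f x) \<partial>M) < \<infinity>" "\<And>x. x \<in> Q \<Longrightarrow> c \<le> f x"
  shows "c \<le> mean M f Q"
proof (cases "0 \<le> c")
  case True
  have "ennreal c * emeasure M Q = (\<integral>\<^sup>+x. ennreal c * indicator Q x \<partial>M)"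
    using assms(1) by (simp add: nn_integral_cmult_indicator)
  also have "\<dots> \<le> (\<integral>\<^sup>+x\<in>Q. ennreal (f x) \<partial>M)"
    using assms(3) by (intro nn_integral_mono) (auto simp: indicator_def ennreal_leI)
  also have "\<dots> = ennreal (mean M f Q) * emeasure M Q"
    using assms(1,2) by (simp add: mean_eq)
  finally have "c * measure M Q \<le> mean M f Q * measure M Q"
    using True by (simp add: emeasure_eq[OF assms(1)] flip: ennreal_mult)
  then show ?thesis
    using measure_pos[OF assms(1)] by simp
next
  case False
  then show ?thesis
    using mean_nonneg[of M f Q] by linarith
qed

lemma finite_integral_on_cube:
  assumes "Q \<in> S" "f \<in> borel_measurable M" "\<And>x. 0 \<le> f x" "1 \<le> s"
    and "power_integral M s f < \<infinity>"
  shows "(\<integral>\<^sup>+x\<in>Q. ennreal (f x) \<partial>M) < \<infinity>"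
proof -
  have le: "f x \<le> 1 + f x powr s" for x
  proof (cases "f x \<le> 1")
    case False
    then show ?thesis
      using powr_mono[of 1 s "f x"] assms(4) by simp
  qed (use powr_ge_zero[of "f x" s] in linarith)
  have [measurable]: "f \<in> borel_measurable M" "Q \<in> sets M"
    using assms by auto
  have "(\<integral>\<^sup>+x\<in>Q. ennreal (f x) \<partial>M) \<le> (\<integral>\<^sup>+x. indicator Q x + ennreal (f x powr s) \<partial>M)"
  proof (rule nn_integral_mono)
    fix x
    show "ennreal (f x) * indicator Q x \<le> indicator Q x + ennreal (f x powr s)"
      using ennreal_leI[OF le[of x]] by (auto simp: indicator_def)
  qed
  also have "\<dots> = emeasure M Q + power_integral M s f"
    by (simp add: nn_integral_add)
  also have "\<dots> < \<infinity>"
    using emeasure_finite[OF assms(1)] assms(5) by simp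
  finally show ?thesis .
qed

end

section \<open>Strong two-weight bounds\<close>

text \<open>The testing inequality of a positive operator from \<open>L\<^sup>s(M)\<close> to \<open>L\<^sup>s(N)\<close>. The dual one is the
  instance with the measures exchanged, the conjugate exponent and the coefficients of the adjoint
  operator, so that one lemma can serve for both.\<close>

abbreviation testing_at ::
    "'a set set \<Rightarrow> 'a measure \<Rightarrow> 'a measure \<Rightarrow> ('a set \<Rightarrow> real) \<Rightarrow> real \<Rightarrow> real \<Rightarrow> 'a set \<Rightarrow> bool"
  where "testing_at S M N lam s T R \<equiv>
    power_integral N s (\<lambda>x. \<Sum>Q\<in>{Q\<in>S. Q \<subseteq> R}. lam Q * indicator Q x)
      \<le> ennreal (T powr s) * emeasure M R"

abbreviation adjoint_coeff ::
    "'a measure \<Rightarrow> 'a measure \<Rightarrow> ('a set \<Rightarrow> real) \<Rightarrow> 'a set \<Rightarrow> real" where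
  "adjoint_coeff M N lam Q \<equiv> lam Q * measure N Q / measure M Q"

lemma conjugate_exponents:
  fixes s q :: real
  assumes "1 < s" "1 < q" "1 / s + 1 / q = 1"
  shows "(s - 1) * (q - 1) = 1" "(s - 1) * q = s" "(q - 1) * s = q"
proof -
  have "q + s = s * q"
    using assms by (simp add: divide_simps)
  then show "(s - 1) * (q - 1) = 1" "(s - 1) * q = s" "(q - 1) * s = q"
    by (simp_all add: algebra_simps)
qed

text \<open>The free parameter \<open>c\<close> makes it possible to balance the two terms against each other, which
  is how Hoelder's inequality is replaced throughout.\<close>

lemma young_scaled:
  fixes s q x y c :: real
  assumes "1 < s" "1 < q" "1 / s + 1 / q = 1" "0 < c" "0 \<le> x" "0 \<le> y"
  shows "x * y \<le> c * ((x / c) powr s + y powr q)"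
proof -
  have "(x / c) * y \<le> (x / c) powr s / s + y powr q / q"
    using assms by (intro Youngs_inequality) auto
  also have "\<dots> \<le> (x / c) powr s + y powr q"
    using assms by (intro add_mono) (auto simp: divide_le_eq mult_right_le_one_le mult_le_cancel_left1)
  finally have "(x / c) * y \<le> (x / c) powr s + y powr q" .
  then have "c * ((x / c) * y) \<le> c * ((x / c) powr s + y powr q)"
    using assms(4) by (intro mult_left_mono) auto
  moreover have "c * ((x / c) * y) = x * y"
    using assms(4) by simp
  ultimately show ?thesis
    by (simp only:)
qed

text \<open>Collect the cubes \<open>Q\<close> with \<open>stop\<^sub>f Q = F\<close>. Their mean of \<open>f\<close> is at most \<open>2 a\<^sub>F\<close>. Their mean of \<open>g\<close> is
  at most \<open>2 b\<^sub>G\<close> for the stopping cube \<open>G\<close> of \<open>g\<close>, and \<open>b\<^sub>G\<close> is dominated on \<open>G\<close> by the \<open>\<ell>\<^sup>q\<close> sum \<open>\<gamma>\<^sub>F\<close> over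
  all such \<open>G\<close>. The rest is the testing sum \<open>H\<^sub>F\<close>, so Young's inequality for \<open>a\<^sub>F H\<^sub>F \<gamma>\<^sub>F\<close> leaves
  \<open>a\<^sub>F\<^sup>s M(F)\<close>, by testing, and \<open>\<Sum>\<^sub>G b\<^sub>G\<^sup>q N(G)\<close>. As \<open>G \<subseteq> F\<close>, each \<open>G\<close> occurs for one \<open>F\<close> only, and both
  sums over \<open>F\<close> are bounded by the Carleson embedding.\<close>

lemma bilinear_half_bound:
  fixes S :: "'a set set"
  assumes "laminar_measure S M" "laminar_measure S N"
    and f: "f \<in> borel_measurable M" "\<And>x. 0 \<le> f x"
    and g: "g \<in> borel_measurable N" "\<And>x. 0 \<le> g x"
    and sq: "1 < s" "1 < q" "1 / s + 1 / q = 1"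
    and lam: "\<And>Q. 0 \<le> lam Q" and T: "0 < T"
    and test: "\<And>R. R \<in> S \<Longrightarrow> testing_at S M N lam s T R"
  defines "st \<equiv> laminar_family.stop S"
  defines "Z \<equiv> {Q\<in>S. 0 < mean M f Q \<and> 0 < mean N g Q \<and> st (mean N g) Q \<subseteq> st (mean M f) Q}"
  shows "(\<Sum>Q\<in>Z. ennreal (lam Q * mean M f Q * mean N g Q) * emeasure N Q)
    \<le> ennreal (4 * T) * (ennreal (carleson_const s) * power_integral M s f
        + ennreal (carleson_const q) * power_integral N q g)"
proof -
  interpret A: laminar_measure S M by fact
  interpret B: laminar_measure S N by fact
  let ?a = "mean M f" and ?b = "mean N g"
  let ?RA = "A.records ?a" and ?RB = "A.records ?b"
  define ZF where "ZF F = {Q\<in>Z. st ?a Q = F}" for F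
  define GF where "GF F = st ?b ` ZF F" for F
  define H where "H F x = (\<Sum>Q\<in>{Q\<in>S. Q \<subseteq> F}. lam Q * indicator Q x)" for F and x :: 'a
  define \<gamma> where "\<gamma> F x = (\<Sum>G\<in>GF F. ?b G powr q * indicator G x) powr (1 / q)" for F and x :: 'a
  have finZ: "finite Z"
    using A.finite_family by (simp add: Z_def)
  have finZF: "finite (ZF F)" for F
    using finZ by (simp add: ZF_def)
  have finGF: "finite (GF F)" for F
    using finZF by (simp add: GF_def)
  have ZS: "Q \<in> S" if "Q \<in> Z" for Q
    using that by (simp add: Z_def)
  have stA: "st ?a Q \<in> ?RA" "Q \<subseteq> st ?a Q" "?a Q \<le> 2 * ?a (st ?a Q)"
    and stB: "st ?b Q \<in> ?RB" "Q \<subseteq> st ?b Q" "?b Q \<le> 2 * ?b (st ?b Q)" if "Q \<in> Z" for Q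
    using that A.stop_props[of Q ?a] A.stop_props[of Q ?b] unfolding Z_def st_def by auto
  have GF_RB: "GF F \<subseteq> ?RB" for F
    unfolding GF_def ZF_def using stB by blast
  then have GF_S: "GF F \<subseteq> S" for F
    using A.records_subset by blast
  have GF_stop: "st ?a G = F" if "G \<in> GF F" for F G
  proof -
    obtain Q where Q: "Q \<in> Z" "st ?a Q = F" "G = st ?b Q"
      using \<open>G \<in> GF F\<close> by (auto simp: GF_def ZF_def)
    then have "G \<subseteq> st ?a Q"
      by (simp add: Z_def)
    then show ?thesis
      using A.stop_eq_between[of Q G ?a] stB(2)[OF Q(1)] Q unfolding st_def by simp
  qed
  have H_nonneg: "0 \<le> H F x" for F x
    unfolding H_def using lam by (intro sum_nonneg) auto
  have \<gamma>_nonneg: "0 \<le> \<gamma> F x" for F x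
    by (simp add: \<gamma>_def)
  have [measurable]: "H F \<in> borel_measurable N" for F
    unfolding H_def by (rule B.sum_indicator_measurable) auto
  have [measurable]: "\<gamma> F \<in> borel_measurable N" for F
    unfolding \<gamma>_def using B.sum_indicator_measurable[OF GF_S] by measurable
  have \<gamma>_int: "(\<integral>\<^sup>+x. ennreal (\<gamma> F x powr q) \<partial>N) = (\<Sum>G\<in>GF F. ennreal (?b G powr q) * emeasure N G)" for F
  proof -
    have "\<gamma> F x powr q = (\<Sum>G\<in>GF F. ?b G powr q * indicator G x)" for x
      unfolding \<gamma>_def using sq(2) by (simp add: powr_powr sum_nonneg)
    then show ?thesis
      by (simp add: B.nn_integral_sum_indicator[OF GF_S])
  qed
  have perF: "(\<Sum>Q\<in>ZF F. ennreal (lam Q * ?a Q * ?b Q) * emeasure N Q)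
      \<le> ennreal (4 * T) * (ennreal (?a F powr s) * emeasure M F
          + (\<Sum>G\<in>GF F. ennreal (?b G powr q) * emeasure N G))" if F: "F \<in> ?RA" for F
  proof -
    have FS: "F \<in> S"
      using F A.records_subset by blast
    have ZFS: "ZF F \<subseteq> S"
      using ZS by (auto simp: ZF_def)
    have point: "(\<Sum>Q\<in>ZF F. (lam Q * ?a Q * ?b Q) * indicator Q x)
        \<le> 4 * T * ((?a F / T) powr s * H F x powr s + \<gamma> F x powr q)" for x
    proof -
      have each: "(lam Q * ?a Q * ?b Q) * indicator Q x
          \<le> (lam Q * indicator Q x) * (4 * ?a F * \<gamma> F x)" if "Q \<in> ZF F" for Q
      proof (cases "x \<in> Q")
        case True
        have Q: "Q \<in> Z" "st ?a Q = F"
          using that by (auto simp: ZF_def)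
        have "st ?b Q \<in> GF F"
          using that by (auto simp: GF_def)
        then have "?b (st ?b Q) powr q * indicator (st ?b Q) x
            \<le> (\<Sum>G\<in>GF F. ?b G powr q * indicator G x)"
          using finGF by (intro member_le_sum) auto
        moreover have "x \<in> st ?b Q"
          using stB(2)[OF Q(1)] True by blast
        ultimately have "(?b (st ?b Q) powr q) powr (1 / q) \<le> \<gamma> F x"
          unfolding \<gamma>_def using sq(2) by (intro powr_mono2) auto
        then have "?b (st ?b Q) \<le> \<gamma> F x"
          using sq(2) by (simp add: powr_powr)
        then have "?b Q \<le> 2 * \<gamma> F x"
          using stB(3)[OF Q(1)] by simp
        moreover have "?a Q \<le> 2 * ?a F"
          using stA(3)[OF Q(1)] Q(2) by simp
        ultimately have "?a Q * ?b Q \<le> (2 * ?a F) * (2 * \<gamma> F x)"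
          by (intro mult_mono) auto
        then have "lam Q * (?a Q * ?b Q) \<le> lam Q * ((2 * ?a F) * (2 * \<gamma> F x))"
          by (rule mult_left_mono) (rule lam)
        then show ?thesis
          using True by (simp add: mult.assoc)
      qed simp
      have "(\<Sum>Q\<in>ZF F. (lam Q * ?a Q * ?b Q) * indicator Q x)
          \<le> (\<Sum>Q\<in>ZF F. lam Q * indicator Q x) * (4 * ?a F * \<gamma> F x)"
        unfolding sum_distrib_right by (rule sum_mono) (rule each)
      also have "\<dots> \<le> H F x * (4 * ?a F * \<gamma> F x)"
      proof (rule mult_right_mono)
        have "ZF F \<subseteq> {Q\<in>S. Q \<subseteq> F}"
          using ZFS stA(2) by (auto simp: ZF_def)
        then show "(\<Sum>Q\<in>ZF F. lam Q * indicator Q x) \<le> H F x"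
          unfolding H_def using A.finite_family lam by (intro sum_mono2) auto
      qed (simp add: \<gamma>_nonneg)
      also have "\<dots> = 4 * ((?a F * H F x) * \<gamma> F x)"
        by simp
      also have "\<dots> \<le> 4 * (T * (((?a F * H F x) / T) powr s + \<gamma> F x powr q))"
        using sq T H_nonneg \<gamma>_nonneg by (intro mult_left_mono young_scaled) auto
      also have "\<dots> = 4 * T * ((?a F / T) powr s * H F x powr s + \<gamma> F x powr q)"
        using T H_nonneg by (simp add: powr_mult powr_divide)
      finally show ?thesis .
    qed
    have "(\<Sum>Q\<in>ZF F. ennreal (lam Q * ?a Q * ?b Q) * emeasure N Q)
        = (\<integral>\<^sup>+x. ennreal (\<Sum>Q\<in>ZF F. (lam Q * ?a Q * ?b Q) * indicator Q x) \<partial>N)"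
      using lam by (intro B.nn_integral_sum_indicator[symmetric] ZFS) simp
    also have "\<dots> \<le> (\<integral>\<^sup>+x. ennreal (4 * T) * (ennreal ((?a F / T) powr s) * ennreal (H F x powr s)
        + ennreal (\<gamma> F x powr q)) \<partial>N)"
      using T point by (intro nn_integral_mono) (simp add: ennreal_leI flip: ennreal_mult ennreal_plus)
    also have "\<dots> = ennreal (4 * T) * (ennreal ((?a F / T) powr s) * (\<integral>\<^sup>+x. ennreal (H F x powr s) \<partial>N)
        + (\<integral>\<^sup>+x. ennreal (\<gamma> F x powr q) \<partial>N))"
      by (simp add: nn_integral_cmult nn_integral_add)
    also have "\<dots> \<le> ennreal (4 * T) * (ennreal ((?a F / T) powr s) * (ennreal (T powr s) * emeasure M F)
        + (\<Sum>G\<in>GF F. ennreal (?b G powr q) * emeasure N G))"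
      unfolding \<gamma>_int using test[OF FS] by (intro mult_left_mono add_mono) (auto simp: H_def)
    also have "ennreal ((?a F / T) powr s) * (ennreal (T powr s) * emeasure M F)
        = ennreal (?a F powr s) * emeasure M F"
      using T by (simp add: powr_divide mult.assoc[symmetric] flip: ennreal_mult)
    finally show ?thesis .
  qed
  have "(\<Sum>Q\<in>Z. ennreal (lam Q * ?a Q * ?b Q) * emeasure N Q)
      = (\<Sum>F\<in>?RA. \<Sum>Q\<in>ZF F. ennreal (lam Q * ?a Q * ?b Q) * emeasure N Q)"
    unfolding ZF_def using stA(1) by (intro sum.group[symmetric] finZ A.finite_records) blast
  also have "\<dots> \<le> (\<Sum>F\<in>?RA. ennreal (4 * T) * (ennreal (?a F powr s) * emeasure M F
      + (\<Sum>G\<in>GF F. ennreal (?b G powr q) * emeasure N G)))"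
    by (rule sum_mono) (rule perF)
  also have "\<dots> = ennreal (4 * T) * ((\<Sum>F\<in>?RA. ennreal (?a F powr s) * emeasure M F)
      + (\<Sum>F\<in>?RA. \<Sum>G\<in>GF F. ennreal (?b G powr q) * emeasure N G))"
    by (simp only: sum.distrib flip: sum_distrib_left)
  also have "\<dots> \<le> ennreal (4 * T) * (ennreal (carleson_const s) * power_integral M s f
        + ennreal (carleson_const q) * power_integral N q g)"
  proof (intro mult_left_mono add_mono)
    show "(\<Sum>F\<in>?RA. ennreal (?a F powr s) * emeasure M F)
        \<le> ennreal (carleson_const s) * power_integral M s f"
      by (intro A.carleson_embedding f sq)
    have "(\<Sum>F\<in>?RA. \<Sum>G\<in>GF F. ennreal (?b G powr q) * emeasure N G)
        = (\<Sum>G\<in>(\<Union>F\<in>?RA. GF F). ennreal (?b G powr q) * emeasure N G)"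
      using finGF GF_stop by (intro sum.UNION_disjoint[symmetric] A.finite_records) blast+
    also have "\<dots> \<le> (\<Sum>G\<in>?RB. ennreal (?b G powr q) * emeasure N G)"
      using GF_RB by (intro sum_mono2 A.finite_records) auto
    also have "\<dots> \<le> ennreal (carleson_const q) * power_integral N q g"
      by (intro B.carleson_embedding g sq)
    finally show "(\<Sum>F\<in>?RA. \<Sum>G\<in>GF F. ennreal (?b G powr q) * emeasure N G)
        \<le> ennreal (carleson_const q) * power_integral N q g" .
  qed simp_all
  finally show ?thesis .
qed

text \<open>The two stopping cubes of \<open>Q\<close> both contain \<open>Q\<close> and hence are nested. The second order is the
  first one with the roles of the two measures exchanged, which turns \<open>\<lambda>\<^sub>Q\<close> into \<open>\<lambda>\<^sub>Q N(Q) / M(Q)\<close>.\<close>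

lemma bilinear_bound:
  fixes S :: "'a set set"
  assumes M: "laminar_measure S M" and N: "laminar_measure S N"
    and f: "f \<in> borel_measurable M" "\<And>x. 0 \<le> f x"
    and g: "g \<in> borel_measurable N" "\<And>x. 0 \<le> g x"
    and sq: "1 < s" "1 < q" "1 / s + 1 / q = 1"
    and lam: "\<And>Q. 0 \<le> lam Q" and T: "0 < T"
    and test: "\<And>R. R \<in> S \<Longrightarrow> testing_at S M N lam s T R"
    and dual_test: "\<And>R. R \<in> S \<Longrightarrow> testing_at S N M (adjoint_coeff M N lam) q T R"
  shows "(\<Sum>Q\<in>S. ennreal (lam Q * mean M f Q * mean N g Q) * emeasure N Q)
    \<le> ennreal (8 * T) * (ennreal (carleson_const s) * power_integral M s f
        + ennreal (carleson_const q) * power_integral N q g)"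
proof -
  interpret A: laminar_measure S M by fact
  interpret B: laminar_measure S N by fact
  let ?a = "mean M f" and ?b = "mean N g"
  let ?I = "ennreal (carleson_const s) * power_integral M s f"
  let ?J = "ennreal (carleson_const q) * power_integral N q g"
  let ?t = "\<lambda>Q. ennreal (lam Q * ?a Q * ?b Q) * emeasure N Q"
  define Z1 where "Z1 = {Q\<in>S. 0 < ?a Q \<and> 0 < ?b Q \<and> A.stop ?b Q \<subseteq> A.stop ?a Q}"
  define Z2 where "Z2 = {Q\<in>S. 0 < ?b Q \<and> 0 < ?a Q \<and> A.stop ?a Q \<subseteq> A.stop ?b Q}"
  have fin: "finite Z1" "finite Z2"
    using A.finite_family by (auto simp: Z1_def Z2_def)
  have Z1: "(\<Sum>Q\<in>Z1. ?t Q) \<le> ennreal (4 * T) * (?I + ?J)"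
    unfolding Z1_def by (rule bilinear_half_bound[OF M N f g sq lam T test])
  have "(\<Sum>Q\<in>Z2. ?t Q)
      = (\<Sum>Q\<in>Z2. ennreal (lam Q * measure N Q / measure M Q * ?b Q * ?a Q) * emeasure M Q)"
  proof (rule sum.cong[OF refl])
    fix Q assume "Q \<in> Z2"
    then have Q: "Q \<in> S"
      by (simp add: Z2_def)
    show "?t Q = ennreal (lam Q * measure N Q / measure M Q * ?b Q * ?a Q) * emeasure M Q"
      using A.measure_pos[OF Q] lam[of Q]
      by (simp add: A.emeasure_eq[OF Q] B.emeasure_eq[OF Q] ac_simps flip: ennreal_mult)
  qed
  also have "\<dots> \<le> ennreal (4 * T) * (?J + ?I)"
    unfolding Z2_def
    by (rule bilinear_half_bound[OF N M g f sq(2,1) _ _ T dual_test]) (use sq(3) lam in auto)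
  finally have Z2: "(\<Sum>Q\<in>Z2. ?t Q) \<le> ennreal (4 * T) * (?I + ?J)"
    by (simp add: add.commute)
  have zero: "?t Q = 0" if "Q \<in> S - (Z1 \<union> Z2)" for Q
  proof -
    have QS: "Q \<in> S"
      using that by simp
    have "\<not> (0 < ?a Q \<and> 0 < ?b Q)"
    proof
      assume pos: "0 < ?a Q \<and> 0 < ?b Q"
      have "A.stop ?a Q \<in> S" "A.stop ?b Q \<in> S"
        using A.stop_props(1)[OF QS] pos A.records_subset by blast+
      then have "A.stop ?a Q \<subseteq> A.stop ?b Q \<or> A.stop ?b Q \<subseteq> A.stop ?a Q"
        using A.nested_above[OF _ _ QS] A.stop_props(2)[OF QS] pos by blast
      then show False
        using that pos by (auto simp: Z1_def Z2_def)
    qed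
    then have "?a Q = 0 \<or> ?b Q = 0"
      by (auto simp: less_le)
    then show ?thesis
      by auto
  qed
  have "(\<Sum>Q\<in>S. ?t Q) = (\<Sum>Q\<in>Z1 \<union> Z2. ?t Q)"
  proof (rule sum.mono_neutral_right)
    show "Z1 \<union> Z2 \<subseteq> S"
      unfolding Z1_def Z2_def by blast
    show "\<forall>Q\<in>S - (Z1 \<union> Z2). ?t Q = 0"
      using zero by blast
  qed (rule A.finite_family)
  also have "\<dots> \<le> (\<Sum>Q\<in>Z1 \<union> Z2. ?t Q) + (\<Sum>Q\<in>Z1 \<inter> Z2. ?t Q)"
    by simp
  also have "\<dots> = (\<Sum>Q\<in>Z1. ?t Q) + (\<Sum>Q\<in>Z2. ?t Q)"
    by (rule sum.union_inter[OF fin])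
  also have "\<dots> \<le> ennreal (4 * T) * (?I + ?J) + ennreal (4 * T) * (?I + ?J)"
    by (intro add_mono Z1 Z2)
  also have "\<dots> = ennreal (4 * T + 4 * T) * (?I + ?J)"
    using T by (simp only: ennreal_plus distrib_right)
  finally show ?thesis
    by simp
qed

lemma nn_integral_mult_positive_operator:
  fixes S :: "'a set set"
  assumes N: "laminar_measure S N" and C: "C \<subseteq> S"
    and g: "g \<in> borel_measurable N" "\<And>x. 0 \<le> g x"
    and fin: "\<And>Q. Q \<in> C \<Longrightarrow> (\<integral>\<^sup>+x\<in>Q. ennreal (g x) \<partial>N) < \<infinity>"
    and c: "\<And>Q. 0 \<le> c Q"
  shows "(\<integral>\<^sup>+x. ennreal ((\<Sum>Q\<in>C. c Q * indicator Q x) * g x) \<partial>N)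
    = (\<Sum>Q\<in>C. ennreal (c Q * mean N g Q) * emeasure N Q)"
proof -
  interpret B: laminar_measure S N by fact
  have [measurable]: "g \<in> borel_measurable N" by (rule g)
  have CN: "Q \<in> sets N" if "Q \<in> C" for Q
    using C that by auto
  have "(\<integral>\<^sup>+x. ennreal ((\<Sum>Q\<in>C. c Q * indicator Q x) * g x) \<partial>N)
      = (\<integral>\<^sup>+x. (\<Sum>Q\<in>C. ennreal (c Q) * (ennreal (g x) * indicator Q x)) \<partial>N)"
  proof (rule nn_integral_cong)
    fix x
    have "ennreal ((\<Sum>Q\<in>C. c Q * indicator Q x) * g x) = ennreal (\<Sum>Q\<in>C. c Q * (g x * indicator Q x))"
      by (simp add: sum_distrib_left sum_distrib_right ac_simps)
    also have "\<dots> = (\<Sum>Q\<in>C. ennreal (c Q * (g x * indicator Q x)))"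
      using c g by (intro sum_ennreal[symmetric]) simp
    also have "\<dots> = (\<Sum>Q\<in>C. ennreal (c Q) * (ennreal (g x) * indicator Q x))"
      using c g by (simp add: ennreal_mult ennreal_indicator)
    finally show "ennreal ((\<Sum>Q\<in>C. c Q * indicator Q x) * g x)
        = (\<Sum>Q\<in>C. ennreal (c Q) * (ennreal (g x) * indicator Q x))" .
  qed
  also have "\<dots> = (\<Sum>Q\<in>C. \<integral>\<^sup>+x. ennreal (c Q) * (ennreal (g x) * indicator Q x) \<partial>N)"
    using CN by (intro nn_integral_sum) simp
  also have "\<dots> = (\<Sum>Q\<in>C. ennreal (c Q) * (\<integral>\<^sup>+x\<in>Q. ennreal (g x) \<partial>N))"
    using CN by (intro sum.cong refl nn_integral_cmult) simp
  also have "\<dots> = (\<Sum>Q\<in>C. ennreal (c Q * mean N g Q) * emeasure N Q)"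
  proof (intro sum.cong refl)
    fix Q assume Q: "Q \<in> C"
    have "(\<integral>\<^sup>+x\<in>Q. ennreal (g x) \<partial>N) = ennreal (mean N g Q) * emeasure N Q"
      using C Q fin[OF Q] by (intro B.mean_eq[symmetric]) auto
    then show "ennreal (c Q) * (\<integral>\<^sup>+x\<in>Q. ennreal (g x) \<partial>N) = ennreal (c Q * mean N g Q) * emeasure N Q"
      using c by (simp add: ennreal_mult mult.assoc)
  qed
  finally show ?thesis .
qed

context laminar_measure
begin

lemma sum_indicator_bounded:
  fixes c :: "'a set \<Rightarrow> real"
  assumes "\<And>Q. 0 \<le> c Q" "C \<subseteq> S"
  shows "(\<Sum>Q\<in>C. c Q * indicator Q x) \<le> (\<Sum>Q\<in>S. c Q) * indicator (\<Union>S) x"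
proof -
  have "(\<Sum>Q\<in>C. c Q * indicator Q x) \<le> (\<Sum>Q\<in>S. c Q * indicator Q x)"
    using assms finite_family by (intro sum_mono2) auto
  also have "\<dots> \<le> (\<Sum>Q\<in>S. c Q * indicator (\<Union>S) x)"
    using assms by (intro sum_mono mult_left_mono) (auto simp: indicator_def)
  finally show ?thesis
    by (simp add: sum_distrib_right)
qed

lemma finite_union: "emeasure M (\<Union>S) < \<infinity>"
proof -
  have "emeasure M (\<Union>S) \<le> (\<Sum>Q\<in>S. emeasure M Q)"
    using emeasure_subadditive_finite[of S "\<lambda>Q. Q" M] finite_family by auto
  also have "\<dots> < \<infinity>"
    using emeasure_finite finite_family by (auto simp: ennreal_sum_less_top)
  finally show ?thesis .
qed

text \<open>The a priori finiteness that permits absorbing a term into the left-hand side.\<close>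

lemma sum_indicator_powr_finite:
  fixes c :: "'a set \<Rightarrow> real"
  assumes "\<And>Q. 0 \<le> c Q" "C \<subseteq> S" "0 < s"
  shows "(\<integral>\<^sup>+x. ennreal ((\<Sum>Q\<in>C. c Q * indicator Q x) powr s) \<partial>M) < \<infinity>"
proof -
  let ?b = "(\<Sum>Q\<in>S. c Q) powr s"
  have "(\<integral>\<^sup>+x. ennreal ((\<Sum>Q\<in>C. c Q * indicator Q x) powr s) \<partial>M)
      \<le> (\<integral>\<^sup>+x. ennreal ?b * indicator (\<Union>S) x \<partial>M)"
  proof (rule nn_integral_mono)
    fix x
    have "0 \<le> (\<Sum>Q\<in>C. c Q * indicator Q x)"
      using assms(1) by (intro sum_nonneg) simp
    then have "(\<Sum>Q\<in>C. c Q * indicator Q x) powr s \<le> ((\<Sum>Q\<in>S. c Q) * indicator (\<Union>S) x) powr s"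
      using assms by (intro powr_mono2 sum_indicator_bounded) auto
    then show "ennreal ((\<Sum>Q\<in>C. c Q * indicator Q x) powr s) \<le> ennreal ?b * indicator (\<Union>S) x"
      using assms(3) by (cases "x \<in> \<Union>S") (auto intro: ennreal_leI)
  qed
  also have "\<dots> = ennreal ?b * emeasure M (\<Union>S)"
    using finite_family by (intro nn_integral_cmult_indicator) auto
  also have "\<dots> < \<infinity>"
    using finite_union by (simp add: ennreal_mult_less_top)
  finally show ?thesis .
qed

end

text \<open>With \<open>u\<close> the image of \<open>f\<close> and \<open>g = \<epsilon> u\<^sup>s\<^sup>-\<^sup>1\<close>, the bilinear form equals \<open>\<epsilon> \<integral> u\<^sup>s\<close>, while \<open>g\<^sup>q\<close> equals \<open>\<epsilon>\<^sup>q u\<^sup>s\<close>.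
  As \<open>q > 1\<close>, a small \<open>\<epsilon>\<close> makes the second term of the bilinear bound at most half of the left-hand
  side.\<close>

lemma positive_operator_strong_bound:
  fixes S :: "'a set set"
  assumes M: "laminar_measure S M" and N: "laminar_measure S N"
    and f: "f \<in> borel_measurable M" "\<And>x. 0 \<le> f x"
    and sq: "1 < s" "1 < q" "1 / s + 1 / q = 1"
    and lam: "\<And>Q. 0 \<le> lam Q" and T: "0 < T"
    and test: "\<And>R. R \<in> S \<Longrightarrow> testing_at S M N lam s T R"
    and dual_test: "\<And>R. R \<in> S \<Longrightarrow> testing_at S N M (adjoint_coeff M N lam) q T R"
  shows "(\<integral>\<^sup>+x. ennreal ((\<Sum>Q\<in>S. lam Q * mean M f Q * indicator Q x) powr s) \<partial>N)
    \<le> ennreal (16 * carleson_const s * (16 * carleson_const q) powr (s - 1) * T powr s)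
        * power_integral M s f"
proof -
  interpret A: laminar_measure S M by fact
  interpret B: laminar_measure S N by fact
  define u where "u x = (\<Sum>Q\<in>S. lam Q * mean M f Q * indicator Q x)" for x
  define X where "X = enn2real (\<integral>\<^sup>+x. ennreal (u x powr s) \<partial>N)"
  let ?I = "power_integral M s f"
  have Cs: "0 < carleson_const s" and Cq: "0 < carleson_const q"
    using sq by (simp_all add: carleson_const_pos)
  have u_nonneg: "0 \<le> u x" for x
    unfolding u_def using lam by (intro sum_nonneg) simp
  have [measurable]: "u \<in> borel_measurable N"
    unfolding u_def by (rule B.sum_indicator_measurable) simp
  have "(\<integral>\<^sup>+x. ennreal (u x powr s) \<partial>N) < \<infinity>"
    unfolding u_def using lam sq by (intro B.sum_indicator_powr_finite) auto
  then have X: "(\<integral>\<^sup>+x. ennreal (u x powr s) \<partial>N) = ennreal X"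
    by (simp add: X_def)
  have X_nonneg: "0 \<le> X"
    by (simp add: X_def)
  \<comment> \<open>The solution of \<open>16 T C\<^sub>q \<epsilon>\<^sup>q = \<epsilon>\<close>, so that \<open>8 T C\<^sub>q \<epsilon>\<^sup>q X\<close> is half of \<open>\<epsilon> X\<close>.\<close>
  define \<epsilon> where "\<epsilon> = (16 * T * carleson_const q) powr (1 - s)"
  have eps: "0 < \<epsilon>"
    using T Cq by (simp add: \<epsilon>_def)
  have eps_q: "16 * T * carleson_const q * \<epsilon> powr q = \<epsilon>"
  proof -
    have "(1 - s) * q = - s"
      using conjugate_exponents(2)[OF sq] by (simp add: algebra_simps)
    then have "\<epsilon> powr q = (16 * T * carleson_const q) powr (- s)"
      by (simp add: \<epsilon>_def powr_powr)
    then show ?thesis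
      using powr_mult_base[of "16 * T * carleson_const q" "- s"] T Cq by (simp add: \<epsilon>_def)
  qed
  define g where "g x = \<epsilon> * u x powr (s - 1)" for x
  have g_nonneg: "0 \<le> g x" for x
    using eps by (simp add: g_def)
  have [measurable]: "g \<in> borel_measurable N"
    unfolding g_def by measurable
  have g_q: "g x powr q = \<epsilon> powr q * u x powr s" for x
    using eps conjugate_exponents(2)[OF sq] by (simp add: g_def powr_mult powr_powr)
  have g_int: "power_integral N q g = ennreal (\<epsilon> powr q * X)"
    using X_nonneg by (simp add: g_q ennreal_mult nn_integral_cmult X)
  have ug: "u x * g x = \<epsilon> * u x powr s" for x
    using powr_diff_one_mult[OF u_nonneg[of x], of s] by (simp add: g_def ac_simps)
  have main: "ennreal (\<epsilon> * X) \<le> ennreal (8 * T) * (ennreal (carleson_const s) * ?I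
      + ennreal (carleson_const q) * ennreal (\<epsilon> powr q * X))"
  proof -
    have "ennreal (\<epsilon> * X) = (\<integral>\<^sup>+x. ennreal (u x * g x) \<partial>N)"
      using eps X_nonneg by (simp add: ug ennreal_mult nn_integral_cmult X)
    also have "\<dots> = (\<Sum>Q\<in>S. ennreal (lam Q * mean M f Q * mean N g Q) * emeasure N Q)"
      unfolding u_def
    proof (rule nn_integral_mult_positive_operator[OF N])
      show "(\<integral>\<^sup>+x\<in>Q. ennreal (g x) \<partial>N) < \<infinity>" if "Q \<in> S" for Q
        using that g_nonneg g_int sq by (intro B.finite_integral_on_cube[where s=q]) auto
    qed (use g_nonneg lam in auto)
    also have "\<dots> \<le> ennreal (8 * T) * (ennreal (carleson_const s) * ?I
        + ennreal (carleson_const q) * power_integral N q g)"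
      by (rule bilinear_bound[OF M N f _ _ sq lam T test dual_test]) (use g_nonneg in auto)
    finally show ?thesis
      by (simp only: g_int)
  qed
  let ?K = "16 * carleson_const s * (16 * carleson_const q) powr (s - 1) * T powr s"
  have "ennreal X \<le> ennreal ?K * ?I"
  proof (cases ?I)
    case (real i)
    have "\<epsilon> * X \<le> 8 * T * (carleson_const s * i + carleson_const q * (\<epsilon> powr q * X))"
      using main real T Cs Cq X_nonneg by (simp flip: ennreal_mult ennreal_plus)
    also have "\<dots> = 8 * T * carleson_const s * i + (16 * T * carleson_const q * \<epsilon> powr q) * X / 2"
      by (simp add: algebra_simps)
    also have "\<dots> = 8 * T * carleson_const s * i + \<epsilon> * X / 2"
      by (simp only: eps_q)
    finally have "X * \<epsilon> \<le> 16 * T * carleson_const s * i"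
      by (simp add: mult.commute)
    then have "X \<le> 16 * T * carleson_const s * i * inverse \<epsilon>"
      using eps by (simp add: pos_le_divide_eq flip: divide_inverse)
    also have "inverse \<epsilon> = (16 * T * carleson_const q) powr (s - 1)"
      unfolding \<epsilon>_def powr_minus[symmetric] by simp
    also have "16 * T * carleson_const s * i * (16 * T * carleson_const q) powr (s - 1)
        = 16 * carleson_const s * (16 * carleson_const q) powr (s - 1) * (T powr (s - 1) * T) * i"
      using T Cq by (simp add: powr_mult)
    finally have "X \<le> ?K * i"
      using T by (simp add: powr_diff_one_mult)
    then show ?thesis
      using real T Cs Cq by (simp add: ennreal_leI flip: ennreal_mult)
  next
    case top
    then show ?thesis
      using T Cs Cq by (simp add: ennreal_mult_top)
  qed
  then show ?thesis
    unfolding X[symmetric] by (simp add: u_def)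
qed

section \<open>The weak-type bound\<close>

text \<open>Let \<open>R\<close> run through the maximal cubes on which \<open>u > t\<close>. The strictly larger cubes contribute at
  most \<open>t\<close> to \<open>u\<close> on \<open>R\<close>, so on \<open>R \<inter> {u > 2 t}\<close> the sum over the cubes inside \<open>R\<close> exceeds \<open>t\<close>. If this set
  is less than the fraction \<open>\<eta>\<close> of \<open>R\<close>, it goes into the first term. Otherwise \<open>t \<eta> N(R)\<close> is at most the
  integral of that local sum over all of \<open>R\<close>, which by duality is \<open>\<integral>\<^sub>R G f\<close> with \<open>G\<close> the dual testing
  sum of \<open>R\<close>; Young's inequality and dual testing finish.\<close>

lemma good_lambda_inequality:
  fixes S :: "'a set set"
  assumes M: "laminar_measure S M" and N: "laminar_measure S N"
    and f: "f \<in> borel_measurable M" "\<And>x. 0 \<le> f x"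
    and fin: "power_integral M s f < \<infinity>"
    and sq: "1 < s" "1 < q" "1 / s + 1 / q = 1"
    and lam: "\<And>Q. 0 \<le> lam Q" and D: "0 < D"
    and dual_test: "\<And>R. R \<in> S \<Longrightarrow> testing_at S N M (adjoint_coeff M N lam) q D R"
    and t: "0 < t" and \<eta>: "0 < \<eta>"
  defines "u \<equiv> \<lambda>x. \<Sum>Q\<in>S. lam Q * mean M f Q * indicator Q x"
  shows "emeasure N {x. 2 * t < u x} \<le> ennreal \<eta> * emeasure N {x. t < u x}
    + ennreal (D powr s * (t * \<eta> / 2) powr (- s)) * power_integral M s f"
proof -
  interpret A: laminar_measure S M by fact
  interpret B: laminar_measure S N by fact
  let ?a = "mean M f"
  have [measurable]: "f \<in> borel_measurable M" by (rule f)
  \<comment> \<open>The value of \<open>u\<close> at points for which \<open>R\<close> is the least cube of the family; on all of \<open>R\<close> it is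
    a lower bound of \<open>u\<close>.\<close>
  define c where "c R = (\<Sum>Q\<in>{Q\<in>S. R \<subseteq> Q}. lam Q * ?a Q)" for R
  define W where "W t = {R\<in>S. t < c R}" for t
  have WS: "W t \<subseteq> S" for t
    by (auto simp: W_def)
  have nonneg: "0 \<le> lam Q * ?a Q" for Q
    using lam by simp
  have u_alt: "u x = (\<Sum>Q\<in>{Q\<in>S. x \<in> Q}. lam Q * ?a Q)" for x
    unfolding u_def using A.finite_family
    by (simp add: indicator_def of_bool_def if_distrib sum.inter_filter cong: if_cong)
  have level: "{x. t < u x} = \<Union>(W t)" if "0 < t" for t
  proof (intro set_eqI iffI)
    fix x assume "x \<in> {x. t < u x}"
    then have ux: "t < u x" by simp
    have "{Q\<in>S. x \<in> Q} \<noteq> {}"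
    proof
      assume none: "{Q\<in>S. x \<in> Q} = {}"
      show False
        using ux that unfolding u_alt none by simp
    qed
    then obtain P where P: "P \<in> {Q\<in>S. x \<in> Q}" "\<And>Q. Q \<in> {Q\<in>S. x \<in> Q} \<Longrightarrow> P \<subseteq> Q"
      using A.exists_least[of "{Q\<in>S. x \<in> Q}" x] by blast
    have "{Q\<in>S. x \<in> Q} = {Q\<in>S. P \<subseteq> Q}"
      using P by blast
    then have "u x = c P"
      by (simp add: u_alt c_def)
    then show "x \<in> \<Union>(W t)"
      using P(1) ux by (auto simp: W_def)
  next
    fix x assume "x \<in> \<Union>(W t)"
    then obtain R where R: "R \<in> S" "t < c R" "x \<in> R"
      by (auto simp: W_def)
    have "c R \<le> u x"
      unfolding c_def u_alt using R A.finite_family nonneg by (intro sum_mono2) auto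
    then show "x \<in> {x. t < u x}"
      using R by simp
  qed
  have W_sets: "\<Union>(W t) \<in> sets N" for t
    using WS A.finite_family finite_subset by (intro sets.finite_Union) blast+
  define E where "E = {x. 2 * t < u x}"
  have E_sets [measurable]: "E \<in> sets N"
    using level[of "2 * t"] t W_sets unfolding E_def by simp
  define m where "m = {R\<in>W t. \<forall>R'\<in>W t. R \<subseteq> R' \<longrightarrow> R = R'}"
  have mS: "R \<in> S" if "R \<in> m" for R
    using that WS by (auto simp: m_def)
  have fin_m: "finite m"
    using A.finite_family mS by (intro finite_subset[of m S]) auto
  have m_disj: "disjoint_family_on (\<lambda>R. R) m"
    unfolding disjoint_family_on_def
  proof (intro ballI impI)
    fix Q R assume QR: "Q \<in> m" "R \<in> m" "Q \<noteq> R"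
    then show "Q \<inter> R = {}"
      using A.laminar[OF mS mS, of Q R] by (auto simp: m_def)
  qed
  have m_union: "\<Union>m = \<Union>(W t)"
  proof
    show "\<Union>(W t) \<subseteq> \<Union>m"
    proof
      fix x assume "x \<in> \<Union>(W t)"
      then obtain R where R: "R \<in> W t" "x \<in> R" by blast
      have "finite (W t)"
        using WS A.finite_family finite_subset by blast
      then obtain R' where R': "R' \<in> W t" "R \<subseteq> R'" "\<And>P. P \<in> W t \<Longrightarrow> R' \<subseteq> P \<Longrightarrow> R' = P"
        using finite_has_maximal2[of "W t" R] R(1) by metis
      have "R' \<in> m"
        unfolding m_def using R' by blast
      then show "x \<in> \<Union>m"
        using R R' by blast
    qed
  qed (auto simp: m_def)
  have above: "(\<Sum>Q\<in>{Q\<in>S. R \<subset> Q}. lam Q * ?a Q) \<le> t" if R: "R \<in> m" for R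
  proof (cases "{Q\<in>S. R \<subset> Q} = {}")
    case False
    obtain x where x: "x \<in> R"
      using A.nonempty[OF mS[OF R]] by blast
    obtain P where P: "P \<in> {Q\<in>S. R \<subset> Q}" "\<And>Q. Q \<in> {Q\<in>S. R \<subset> Q} \<Longrightarrow> P \<subseteq> Q"
      using A.exists_least[of "{Q\<in>S. R \<subset> Q}" x] False x by blast
    have "{Q\<in>S. R \<subset> Q} = {Q\<in>S. P \<subseteq> Q}"
      using P by blast
    then have "(\<Sum>Q\<in>{Q\<in>S. R \<subset> Q}. lam Q * ?a Q) = c P"
      by (simp only: c_def)
    moreover have "P \<notin> W t"
      using R P(1) unfolding m_def by blast
    ultimately show ?thesis
      using P(1) by (simp add: W_def)
  next
    case True
    show ?thesis
      unfolding True using t by simp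
  qed
  define uR where "uR R x = (\<Sum>Q\<in>{Q\<in>S. Q \<subseteq> R}. lam Q * ?a Q * indicator Q x)" for R and x :: 'a
  have u_le: "u x \<le> t + uR R x" if R: "R \<in> m" "x \<in> R" for R x
  proof -
    have "u x = (\<Sum>Q\<in>{Q\<in>S. Q \<subseteq> R}. lam Q * ?a Q * indicator Q x)
        + (\<Sum>Q\<in>{Q\<in>S. \<not> Q \<subseteq> R}. lam Q * ?a Q * indicator Q x)"
      unfolding u_def using A.finite_family by (subst sum.union_disjoint[symmetric]) (auto intro: sum.cong)
    also have "(\<Sum>Q\<in>{Q\<in>S. \<not> Q \<subseteq> R}. lam Q * ?a Q * indicator Q x)
        = (\<Sum>Q\<in>{Q\<in>S. \<not> Q \<subseteq> R} \<inter> {Q\<in>S. R \<subset> Q}. lam Q * ?a Q * indicator Q x)"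
    proof (rule sum.mono_neutral_right)
      show "\<forall>Q\<in>{Q\<in>S. \<not> Q \<subseteq> R} - {Q\<in>S. \<not> Q \<subseteq> R} \<inter> {Q\<in>S. R \<subset> Q}. lam Q * ?a Q * indicator Q x = 0"
      proof
        fix Q assume Q: "Q \<in> {Q\<in>S. \<not> Q \<subseteq> R} - {Q\<in>S. \<not> Q \<subseteq> R} \<inter> {Q\<in>S. R \<subset> Q}"
        have "x \<notin> Q"
          using A.nested[of Q R x] Q mS[OF R(1)] R(2) by blast
        then show "lam Q * ?a Q * indicator Q x = 0"
          by simp
      qed
    qed (use A.finite_family in auto)
    also have "\<dots> \<le> (\<Sum>Q\<in>{Q\<in>S. R \<subset> Q}. lam Q * ?a Q * indicator Q x)"
      using A.finite_family lam by (intro sum_mono2) auto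
    also have "\<dots> \<le> (\<Sum>Q\<in>{Q\<in>S. R \<subset> Q}. lam Q * ?a Q)"
      using lam by (intro sum_mono) (simp add: indicator_def)
    also have "\<dots> \<le> t"
      by (rule above[OF R(1)])
    finally show ?thesis
      by (simp add: uR_def)
  qed
  define \<kappa> where "\<kappa> = D powr s * (t * \<eta> / 2) powr (- s)"
  have \<kappa>_pos: "0 < \<kappa>"
    using D t \<eta> by (simp add: \<kappa>_def)
  have perR: "emeasure N (E \<inter> R) \<le> ennreal \<eta> * emeasure N R
      + ennreal \<kappa> * (\<integral>\<^sup>+x\<in>R. ennreal (f x powr s) \<partial>M)" if R: "R \<in> m" for R
  proof (cases "emeasure N (E \<inter> R) \<le> ennreal \<eta> * emeasure N R")
    case True
    then show ?thesis
      by (simp add: add_increasing2)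
  next
    case False
    have RS: "R \<in> S"
      by (rule mS[OF R])
    have [measurable]: "R \<in> sets M" "R \<in> sets N"
      using RS by auto
    define G where "G x = (\<Sum>Q\<in>{Q\<in>S. Q \<subseteq> R}. lam Q * measure N Q / measure M Q * indicator Q x)" for x
    have G_nonneg: "0 \<le> G x" for x
      unfolding G_def using lam by (intro sum_nonneg) simp
    have [measurable]: "G \<in> borel_measurable M"
      unfolding G_def by (rule A.sum_indicator_measurable) auto
    have G_supp: "G x = 0" if "x \<notin> R" for x
      unfolding G_def using that by (intro sum.neutral) (auto simp: indicator_def)
    \<comment> \<open>The parameter in Young's inequality for which the dual testing term is half of \<open>t \<eta> N(R)\<close>.\<close>
    define z where "z = D powr s * (t * \<eta> / 2) powr (1 - s)"
    have z_pos: "0 < z"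
      using D t \<eta> by (simp add: z_def)
    have z_pow: "z * (D / z) powr q = t * \<eta> / 2"
    proof -
      have e: "s * (1 - q) = - q" "(1 - s) * (1 - q) = 1"
        using conjugate_exponents[OF sq] by (simp_all add: algebra_simps)
      have "z * (D / z) powr q = D powr q * z powr (1 - q)"
        using z_pos D by (simp add: powr_divide powr_diff)
      also have "z powr (1 - q) = D powr (- q) * (t * \<eta> / 2)"
        using D t \<eta> e by (simp add: z_def powr_mult powr_powr)
      also have "D powr q * (D powr (- q) * (t * \<eta> / 2)) = t * \<eta> / 2"
        using D by (simp add: powr_minus)
      finally show ?thesis .
    qed
    have "ennreal (t * \<eta>) * emeasure N R = ennreal t * (ennreal \<eta> * emeasure N R)"
      using t \<eta> by (simp add: ennreal_mult mult.assoc)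
    also have "\<dots> \<le> ennreal t * emeasure N (E \<inter> R)"
      using False by (intro mult_left_mono) auto
    also have "\<dots> = (\<integral>\<^sup>+x. ennreal t * indicator (E \<inter> R) x \<partial>N)"
      by (rule nn_integral_cmult_indicator[symmetric]) measurable
    also have "\<dots> \<le> (\<integral>\<^sup>+x. ennreal (uR R x) \<partial>N)"
    proof (rule nn_integral_mono)
      fix x
      show "ennreal t * indicator (E \<inter> R) x \<le> ennreal (uR R x)"
        using u_le[OF R, of x] by (auto simp: indicator_def E_def intro!: ennreal_leI)
    qed
    also have "\<dots> = (\<Sum>Q\<in>{Q\<in>S. Q \<subseteq> R}. ennreal (lam Q * ?a Q) * emeasure N Q)"
      unfolding uR_def using nonneg by (intro B.nn_integral_sum_indicator) auto
    also have "\<dots> = (\<Sum>Q\<in>{Q\<in>S. Q \<subseteq> R}. ennreal (lam Q * measure N Q / measure M Q * ?a Q) * emeasure M Q)"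
    proof (rule sum.cong[OF refl])
      fix Q assume "Q \<in> {Q\<in>S. Q \<subseteq> R}"
      then have Q: "Q \<in> S" by simp
      show "ennreal (lam Q * ?a Q) * emeasure N Q
          = ennreal (lam Q * measure N Q / measure M Q * ?a Q) * emeasure M Q"
        using A.measure_pos[OF Q] lam[of Q]
        by (simp add: A.emeasure_eq[OF Q] B.emeasure_eq[OF Q] ac_simps flip: ennreal_mult)
    qed
    also have "\<dots> = (\<integral>\<^sup>+x. ennreal (G x * f x) \<partial>M)"
      unfolding G_def
    proof (rule nn_integral_mult_positive_operator[OF M _ f, symmetric])
      show "(\<integral>\<^sup>+x\<in>Q. ennreal (f x) \<partial>M) < \<infinity>" if "Q \<in> {Q\<in>S. Q \<subseteq> R}" for Q
        using that A.finite_integral_on_cube[OF _ f _ fin, of Q] sq by auto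
    qed (use lam in auto)
    also have "\<dots> \<le> (\<integral>\<^sup>+x. ennreal (z * z powr (- q)) * ennreal (G x powr q)
        + ennreal z * (ennreal (f x powr s) * indicator R x) \<partial>M)"
    proof (rule nn_integral_mono)
      fix x
      show "ennreal (G x * f x) \<le> ennreal (z * z powr (- q)) * ennreal (G x powr q)
        + ennreal z * (ennreal (f x powr s) * indicator R x)"
      proof (cases "x \<in> R")
        case True
        have "G x * f x \<le> z * ((G x / z) powr q + f x powr s)"
          using sq G_nonneg f(2) z_pos by (intro young_scaled) auto
        also have "(G x / z) powr q = z powr (- q) * G x powr q"
          using G_nonneg[of x] z_pos by (simp add: powr_divide powr_minus_divide)
        also have "z * (z powr (- q) * G x powr q + f x powr s)
            = z * z powr (- q) * G x powr q + z * f x powr s"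
          by (simp add: distrib_left mult.assoc)
        finally show ?thesis
          using True z_pos by (simp add: ennreal_leI flip: ennreal_mult ennreal_plus)
      qed (simp add: G_supp)
    qed
    also have "\<dots> = ennreal (z * z powr (- q)) * (\<integral>\<^sup>+x. ennreal (G x powr q) \<partial>M)
        + ennreal z * (\<integral>\<^sup>+x\<in>R. ennreal (f x powr s) \<partial>M)"
      by (simp add: nn_integral_add nn_integral_cmult)
    also have "\<dots> \<le> ennreal (z * z powr (- q)) * (ennreal (D powr q) * emeasure N R)
        + ennreal z * (\<integral>\<^sup>+x\<in>R. ennreal (f x powr s) \<partial>M)"
      using dual_test[OF RS] by (intro add_mono mult_left_mono) (auto simp: G_def)
    also have "ennreal (z * z powr (- q)) * (ennreal (D powr q) * emeasure N R)
        = ennreal (t * \<eta> / 2) * emeasure N R"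
    proof -
      have e1: "z * z powr (- q) * D powr q = t * \<eta> / 2"
        unfolding z_pow[symmetric] using z_pos D by (simp add: powr_divide powr_minus_divide)
      have e2: "ennreal (z * z powr (- q)) * ennreal (D powr q) = ennreal (z * z powr (- q) * D powr q)"
        using z_pos by (intro ennreal_mult[symmetric]) auto
      show ?thesis
        by (simp only: mult.assoc[symmetric] e2 e1)
    qed
    finally have *: "ennreal (t * \<eta>) * emeasure N R \<le> ennreal (t * \<eta> / 2) * emeasure N R
        + ennreal z * (\<integral>\<^sup>+x\<in>R. ennreal (f x powr s) \<partial>M)" .
    have fin_R: "(\<integral>\<^sup>+x\<in>R. ennreal (f x powr s) \<partial>M) < \<infinity>"
    proof (rule le_less_trans[OF _ fin])
      show "(\<integral>\<^sup>+x\<in>R. ennreal (f x powr s) \<partial>M) \<le> power_integral M s f"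
        by (intro nn_integral_mono) (auto simp: indicator_def)
    qed
    then obtain i where i: "0 \<le> i" "(\<integral>\<^sup>+x\<in>R. ennreal (f x powr s) \<partial>M) = ennreal i"
      by (cases "\<integral>\<^sup>+x\<in>R. ennreal (f x powr s) \<partial>M") auto
    have "t * \<eta> * measure N R \<le> t * \<eta> / 2 * measure N R + z * i"
      using * t \<eta> z_pos i by (simp add: B.emeasure_eq[OF RS] flip: ennreal_mult ennreal_plus)
    then have "(t * \<eta> / 2) * measure N R \<le> z * i"
      by simp
    moreover have "z = (t * \<eta> / 2) * \<kappa>"
      using powr_mult_base[of "t * \<eta> / 2" "- s"] t \<eta> by (simp add: z_def \<kappa>_def)
    ultimately have "(t * \<eta> / 2) * measure N R \<le> (t * \<eta> / 2) * (\<kappa> * i)"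
      by (simp only: mult.assoc)
    then have "measure N R \<le> \<kappa> * i"
      using t \<eta> by (simp add: mult_le_cancel_left_pos)
    then have "emeasure N R \<le> ennreal \<kappa> * (\<integral>\<^sup>+x\<in>R. ennreal (f x powr s) \<partial>M)"
      using \<kappa>_pos i by (simp add: B.emeasure_eq[OF RS] ennreal_leI flip: ennreal_mult)
    moreover have "emeasure N (E \<inter> R) \<le> emeasure N R"
      by (intro emeasure_mono) auto
    ultimately show ?thesis
      by (meson add_increasing order_trans zero_le)
  qed
  have mN: "R \<in> sets N" "R \<in> sets M" if "R \<in> m" for R
    using mS[OF that] by auto
  have "E \<subseteq> \<Union>m"
    using level[OF t] t unfolding m_union E_def by fastforce
  then have "E = (\<Union>R\<in>m. E \<inter> R)"
    by blast
  then have "emeasure N E = emeasure N (\<Union>R\<in>m. E \<inter> R)"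
    by simp
  also have "\<dots> \<le> (\<Sum>R\<in>m. emeasure N (E \<inter> R))"
    using fin_m mN E_sets by (intro emeasure_subadditive_finite) auto
  also have "\<dots> \<le> (\<Sum>R\<in>m. ennreal \<eta> * emeasure N R + ennreal \<kappa> * (\<integral>\<^sup>+x\<in>R. ennreal (f x powr s) \<partial>M))"
    by (rule sum_mono) (rule perR)
  also have "\<dots> = ennreal \<eta> * (\<Sum>R\<in>m. emeasure N R)
      + ennreal \<kappa> * (\<Sum>R\<in>m. \<integral>\<^sup>+x\<in>R. ennreal (f x powr s) \<partial>M)"
    by (simp only: sum.distrib flip: sum_distrib_left)
  also have "(\<Sum>R\<in>m. emeasure N R) = emeasure N {x. t < u x}"
    unfolding level[OF t] m_union[symmetric]
    using sum_emeasure[of "\<lambda>R. R" m N] fin_m m_disj mN by auto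
  also have "(\<Sum>R\<in>m. \<integral>\<^sup>+x\<in>R. ennreal (f x powr s) \<partial>M) = (\<integral>\<^sup>+x. (\<Sum>R\<in>m. ennreal (f x powr s) * indicator R x) \<partial>M)"
    using mN by (intro nn_integral_sum[symmetric]) simp
  also have "\<dots> \<le> power_integral M s f"
  proof (rule nn_integral_mono)
    fix x
    have "(\<Sum>R\<in>m. ennreal (f x powr s) * indicator R x) = ennreal (f x powr s) * (\<Sum>R\<in>m. indicator R x)"
      by (rule sum_distrib_left[symmetric])
    also have "(\<Sum>R\<in>m. indicator R x :: ennreal) = indicator (\<Union>R\<in>m. R) x"
      by (rule indicator_UN_disjoint[symmetric, OF fin_m m_disj])
    also have "ennreal (f x powr s) * indicator (\<Union>R\<in>m. R) x \<le> ennreal (f x powr s)"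
      by (auto simp: indicator_def)
    finally show "(\<Sum>R\<in>m. ennreal (f x powr s) * indicator R x) \<le> ennreal (f x powr s)" .
  qed
  finally show ?thesis
    unfolding E_def \<kappa>_def by (simp add: add_left_mono mult_left_mono)
qed

definition weak_const :: "real \<Rightarrow> real" where
  "weak_const s = 2 * (4 / 2 powr (- s - 1)) powr s"

text \<open>Multiplied by \<open>t\<^sup>s\<close>, the good-lambda inequality bounds \<open>\<psi>(t) = t\<^sup>s N{u > t}\<close> by \<open>\<psi>(t / 2) / 2\<close> plus a
  constant. On a finite family \<open>u\<close> is bounded, so \<open>\<psi>\<close> has a finite supremum, and the supremum is at most
  twice the constant.\<close>

lemma positive_operator_weak_bound:
  fixes S :: "'a set set"
  assumes M: "laminar_measure S M" and N: "laminar_measure S N"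
    and f: "f \<in> borel_measurable M" "\<And>x. 0 \<le> f x"
    and fin: "power_integral M s f < \<infinity>"
    and sq: "1 < s" "1 < q" "1 / s + 1 / q = 1"
    and lam: "\<And>Q. 0 \<le> lam Q" and D: "0 < D"
    and dual_test: "\<And>R. R \<in> S \<Longrightarrow> testing_at S N M (adjoint_coeff M N lam) q D R"
    and t: "0 < t"
  shows "emeasure N {x. t < (\<Sum>Q\<in>S. lam Q * mean M f Q * indicator Q x)}
    \<le> ennreal (weak_const s * D powr s * t powr (- s)) * power_integral M s f"
proof -
  interpret A: laminar_measure S M by fact
  interpret B: laminar_measure S N by fact
  define u where "u x = (\<Sum>Q\<in>S. lam Q * mean M f Q * indicator Q x)" for x
  obtain i where i: "0 \<le> i" "power_integral M s f = ennreal i"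
    using fin by (cases "power_integral M s f") auto
  define \<phi> where "\<phi> t = measure N {x. t < u x}" for t
  define U where "U = (\<Sum>Q\<in>S. lam Q * mean M f Q)"
  have union_sets: "\<Union>S \<in> sets N"
    using A.finite_family by (intro sets.finite_Union) auto
  have u_le: "u x \<le> U * indicator (\<Union>S) x" for x
    unfolding u_def U_def using lam by (intro A.sum_indicator_bounded) auto
  have U_nonneg: "0 \<le> U"
    unfolding U_def using lam by (intro sum_nonneg) auto
  have level_subset: "{x. t < u x} \<subseteq> \<Union>S" if "0 < t" for t
  proof
    fix x assume "x \<in> {x. t < u x}"
    then show "x \<in> \<Union>S"
      using u_le[of x] that by (cases "x \<in> \<Union>S") auto
  qed
  have \<phi>: "emeasure N {x. t < u x} = ennreal (\<phi> t)" if "0 < t" for t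
  proof -
    have "emeasure N {x. t < u x} \<le> emeasure N (\<Union>S)"
      by (rule emeasure_mono[OF level_subset[OF that] union_sets])
    then show ?thesis
      unfolding \<phi>_def using B.finite_union by (intro emeasure_eq_ennreal_measure) auto
  qed
  have \<phi>_le: "\<phi> t \<le> measure N (\<Union>S)" if "0 < t" for t
  proof -
    have "ennreal (\<phi> t) \<le> emeasure N (\<Union>S)"
      unfolding \<phi>[OF that, symmetric] by (rule emeasure_mono[OF level_subset[OF that] union_sets])
    also have "\<dots> = ennreal (measure N (\<Union>S))"
      using B.finite_union by (intro emeasure_eq_ennreal_measure) auto
    finally show ?thesis
      by simp
  qed
  have \<phi>_zero: "\<phi> t = 0" if "U \<le> t" for t
  proof -
    have "u x \<le> t" for x
      using u_le[of x] that U_nonneg by (cases "x \<in> \<Union>S") auto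
    then have "{x. t < u x} = {}"
      by (auto simp: not_less)
    then show ?thesis
      unfolding \<phi>_def by (simp only: measure_empty)
  qed
  define \<psi> where "\<psi> t = t powr s * \<phi> t" for t
  have \<phi>_nonneg: "0 \<le> \<phi> t" for t
    by (simp add: \<phi>_def)
  have bdd: "bdd_above (\<psi> ` {0<..})"
  proof (rule bdd_aboveI2)
    fix t :: real assume t: "t \<in> {0<..}"
    show "\<psi> t \<le> U powr s * measure N (\<Union>S)"
    proof (cases "U \<le> t")
      case False
      then show ?thesis
        unfolding \<psi>_def using t sq \<phi>_nonneg by (intro mult_mono powr_mono2 \<phi>_le) auto
    qed (simp add: \<psi>_def \<phi>_zero)
  qed
  \<comment> \<open>\<open>2\<^sup>s \<eta> = 1 / 2\<close> makes the step \<open>t / 2 \<mapsto> t\<close> a contraction by 1/2.\<close>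
  define \<eta> :: real where "\<eta> = 2 powr (- s - 1)"
  have \<eta>: "0 < \<eta>"
    by (simp add: \<eta>_def)
  let ?L = "(4 / \<eta>) powr s * D powr s * i"
  have step: "\<psi> t \<le> \<psi> (t / 2) / 2 + ?L" if t: "0 < t" for t
  proof -
    have "ennreal (\<phi> t) \<le> ennreal \<eta> * ennreal (\<phi> (t / 2))
        + ennreal (D powr s * (t / 2 * \<eta> / 2) powr (- s)) * ennreal i"
    proof -
      have "0 < t / 2" and tt: "2 * (t / 2) = t"
        using t by auto
      then have "emeasure N {x. 2 * (t / 2) < u x} \<le> ennreal \<eta> * emeasure N {x. t / 2 < u x}
          + ennreal (D powr s * (t / 2 * \<eta> / 2) powr (- s)) * power_integral M s f"
        unfolding u_def by (intro good_lambda_inequality[OF M N f fin sq lam D dual_test _ \<eta>])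
      then show ?thesis
        unfolding tt \<phi>[OF t] \<phi>[OF \<open>0 < t / 2\<close>] i(2) .
    qed
    then have "\<phi> t \<le> \<eta> * \<phi> (t / 2) + D powr s * (t / 2 * \<eta> / 2) powr (- s) * i"
      using \<eta> \<phi>_nonneg i(1) by (simp flip: ennreal_mult ennreal_plus)
    then have "\<psi> t \<le> t powr s * (\<eta> * \<phi> (t / 2) + D powr s * (t / 2 * \<eta> / 2) powr (- s) * i)"
      unfolding \<psi>_def by (rule mult_left_mono) simp
    also have "\<dots> = (t powr s * \<eta>) * \<phi> (t / 2) + (t powr s * (t / 2 * \<eta> / 2) powr (- s)) * D powr s * i"
      by (simp add: algebra_simps)
    also have "t powr s * \<eta> = (t / 2) powr s / 2"
      using t by (simp add: \<eta>_def powr_divide powr_diff powr_minus field_simps)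
    also have "t powr s * (t / 2 * \<eta> / 2) powr (- s) = (4 / \<eta>) powr s"
      using t \<eta> by (simp add: powr_divide powr_mult powr_minus field_simps flip: powr_mult)
    finally show ?thesis
      by (simp add: \<psi>_def)
  qed
  let ?P = "SUP t\<in>{0<..}. \<psi> t"
  have le_P: "\<psi> t \<le> ?P" if "0 < t" for t
    using that by (intro cSUP_upper bdd) auto
  have "?P \<le> ?P / 2 + ?L"
  proof (rule cSUP_least)
    fix t :: real assume "t \<in> {0<..}"
    then show "\<psi> t \<le> ?P / 2 + ?L"
      using step[of t] le_P[of "t / 2"] by simp
  qed auto
  then have "\<psi> t \<le> 2 * ?L"
    using le_P[OF t] by linarith
  then have "t powr (- s) * \<psi> t \<le> t powr (- s) * (2 * ?L)"
    by (rule mult_left_mono) simp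
  moreover have "t powr (- s) * \<psi> t = \<phi> t"
    using t by (simp add: \<psi>_def powr_minus)
  ultimately have "\<phi> t \<le> weak_const s * D powr s * t powr (- s) * i"
    by (simp add: weak_const_def \<eta>_def ac_simps)
  then have "ennreal (\<phi> t) \<le> ennreal (weak_const s * D powr s * t powr (- s)) * ennreal i"
    using i(1) by (simp add: ennreal_leI weak_const_def flip: ennreal_mult)
  then show ?thesis
    using t by (simp add: \<phi> i flip: u_def)
qed

section \<open>Necessity of the dual testing condition\<close>

abbreviation power_sum ::
    "'a measure \<Rightarrow> ('a set \<Rightarrow> real) \<Rightarrow> real \<Rightarrow> ('a \<Rightarrow> real) \<Rightarrow> 'a set set \<Rightarrow> 'a \<Rightarrow> real" where
  "power_sum M lam r f F x \<equiv> \<Sum>Q\<in>F. lam Q * mean M f Q powr r * indicator Q x"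

context laminar_measure
begin

text \<open>A weak \<open>L\<^sup>s\<close> function with \<open>s > 1\<close> is integrable over sets of finite measure: pointwise \<open>V\<close> is at most
  \<open>t\<close> plus the sum of \<open>2\<^sup>k\<^sup>+\<^sup>1 t\<close> over the \<open>k\<close> with \<open>V > 2\<^sup>k t\<close>, and the integrals of these terms
  form a geometric series of ratio \<open>2\<^sup>1\<^sup>-\<^sup>s\<close>.\<close>

lemma layer_cake_bound:
  assumes V: "V \<in> borel_measurable M" "\<And>x. 0 \<le> V x"
    and weak: "\<And>t. 0 < t \<Longrightarrow> emeasure M {x\<in>space M. t < V x} \<le> ennreal (K * t powr (- s))"
    and "1 < s" "0 \<le> K" "0 < t" and R: "R \<in> S"
  shows "(\<integral>\<^sup>+x\<in>R. ennreal (V x) \<partial>M)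
    \<le> ennreal t * emeasure M R + ennreal (2 / (1 - 2 powr (1 - s)) * K * t powr (1 - s))"
proof -
  have [measurable]: "V \<in> borel_measurable M" "R \<in> sets M"
    using V R by auto
  define L where "L k = {x\<in>space M. 2 ^ k * t < V x}" for k
  have [measurable]: "L k \<in> sets M" for k
    unfolding L_def by measurable
  have point: "ennreal (V x) * indicator R x
      \<le> ennreal t * indicator R x + (\<Sum>k. ennreal (2 * (2 ^ k * t)) * indicator (L k) x)"
    if x: "x \<in> space M" for x
  proof (cases "V x \<le> t")
    case True
    then have "ennreal (V x) * indicator R x \<le> ennreal t * indicator R x"
      by (intro mult_right_mono ennreal_leI) auto
    then show ?thesis
      by (rule order_trans) simp
  next
    case False
    \<comment> \<open>The \<open>k\<close> with \<open>2\<^sup>k t < V x \<le> 2\<^sup>k\<^sup>+\<^sup>1 t\<close>.\<close>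
    define k where "k = nat (lev (V x / t) - 1)"
    have gt: "1 < V x / t"
      using False \<open>0 < t\<close> by simp
    have "0 < lev (V x / t)"
      using gt \<open>0 < t\<close> unfolding lev_def by simp
    then have "real_of_int (lev (V x / t)) = real k + 1"
      unfolding k_def by simp
    then have lev: "2 powr real_of_int (lev (V x / t)) = 2 * 2 ^ k"
      by (simp add: powr_add powr_realpow)
    have pos: "0 < V x / t"
      using gt by linarith
    have "2 ^ k < V x / t" "V x / t \<le> 2 * 2 ^ k"
      using le_powr_lev[OF pos] powr_lev_less[OF pos] unfolding lev by auto
    then have k: "2 ^ k * t < V x" "V x \<le> 2 * (2 ^ k * t)"
      using \<open>0 < t\<close> by (simp_all add: field_simps)
    have "ennreal (V x) * indicator R x \<le> ennreal (V x)"
      by (auto simp: indicator_def)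
    also have "\<dots> \<le> ennreal (2 * (2 ^ k * t)) * indicator (L k) x"
      using k x by (simp add: L_def ennreal_leI)
    also have "\<dots> \<le> (\<Sum>k. ennreal (2 * (2 ^ k * t)) * indicator (L k) x)"
    proof -
      define z where "z = (\<lambda>k. ennreal (2 * (2 ^ k * t)) * indicator (L k) x)"
      have "z k \<le> suminf z"
        using sum_le_suminf[OF summableI, of "{k}" z] by simp
      then show ?thesis
        by (simp only: z_def)
    qed
    also have "\<dots> \<le> ennreal t * indicator R x + (\<Sum>k. ennreal (2 * (2 ^ k * t)) * indicator (L k) x)"
      by simp
    finally show ?thesis .
  qed
  have x: "0 < (2::real) powr (1 - s)" "(2::real) powr (1 - s) < 1"
    using \<open>1 < s\<close> by (auto simp: powr_less_one)
  have summand: "ennreal (2 * (2 ^ k * t)) * emeasure M (L k)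
      \<le> ennreal (2 * K * t powr (1 - s) * (2 powr (1 - s)) ^ k)" for k
  proof -
    have "ennreal (2 * (2 ^ k * t)) * emeasure M (L k)
        \<le> ennreal (2 * (2 ^ k * t)) * ennreal (K * (2 ^ k * t) powr (- s))"
      unfolding L_def using \<open>0 < t\<close> by (intro mult_left_mono weak) auto
    also have "\<dots> = ennreal (2 * K * ((2 ^ k * t) * (2 ^ k * t) powr (- s)))"
      using \<open>0 < t\<close> \<open>0 \<le> K\<close> by (simp add: ac_simps flip: ennreal_mult)
    also have "(2 ^ k * t) * (2 ^ k * t) powr (- s) = (2 ^ k * t) powr (1 - s)"
      using powr_mult_base[of "2 ^ k * t" "- s"] \<open>0 < t\<close> by simp
    also have "\<dots> = (2 ^ k) powr (1 - s) * t powr (1 - s)"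
      using \<open>0 < t\<close> by (simp add: powr_mult)
    also have "((2::real) ^ k) powr (1 - s) = (2 powr (1 - s)) ^ k"
      by (simp add: powr_powr ac_simps flip: powr_realpow)
    finally show ?thesis
      by (simp add: ac_simps)
  qed
  have "(\<integral>\<^sup>+x\<in>R. ennreal (V x) \<partial>M)
      \<le> (\<integral>\<^sup>+x. ennreal t * indicator R x + (\<Sum>k. ennreal (2 * (2 ^ k * t)) * indicator (L k) x) \<partial>M)"
    by (rule nn_integral_mono) (rule point)
  also have "\<dots> = ennreal t * emeasure M R + (\<Sum>k. ennreal (2 * (2 ^ k * t)) * emeasure M (L k))"
    by (simp add: nn_integral_add nn_integral_suminf nn_integral_cmult_indicator)
  also have "(\<Sum>k. ennreal (2 * (2 ^ k * t)) * emeasure M (L k))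
      \<le> (\<Sum>k. ennreal (2 * K * t powr (1 - s) * (2 powr (1 - s)) ^ k))"
    by (intro suminf_le summand summableI)
  also have "(\<Sum>k. ennreal (2 * K * t powr (1 - s) * (2 powr (1 - s)) ^ k))
      = ennreal (2 * K * t powr (1 - s) * (1 / (1 - 2 powr (1 - s))))"
    using x \<open>0 \<le> K\<close> by (intro suminf_ennreal_eq sums_mult geometric_sums) auto
  finally show ?thesis
    by (simp add: ac_simps add_left_mono)
qed

end

definition dual_const :: "real \<Rightarrow> real \<Rightarrow> real" where
  "dual_const s q
    = 2 * (4 / (1 - 2 powr (1 - s)) * (2 powr s * carleson_const s)) powr (q - 1)"

text \<open>Let \<open>G\<close> be the dual testing sum for \<open>R\<close>, let \<open>h = G\<^sup>q\<^sup>-\<^sup>1\<close>, and \<open>Y = \<integral> G\<^sup>q = \<integral> G h\<close>. By duality \<open>Y\<close> is the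
  integral over \<open>R\<close> of the linear operator applied to \<open>h\<close>. The maximal theorem supplies an \<open>f\<close> with
  \<open>mean h \<le> (mean f)\<^sup>r\<close> on all cubes and \<open>\<integral> f\<^sup>p \<le> C Y\<close>, so the weak-type hypothesis applies to \<open>f\<close>, and
  integrating it over \<open>R\<close> yields \<open>Y \<le> t N(R) + C K\<^sup>s Y t\<^sup>1\<^sup>-\<^sup>s\<close> for every \<open>t\<close>. A suitable \<open>t\<close>, of size \<open>K\<^sup>q\<close>,
  makes the last term \<open>Y / 2\<close>.\<close>

lemma dual_testing_of_weak_bound:
  fixes S :: "'a set set"
  assumes M: "laminar_measure S M" and N: "laminar_measure S N"
    and pr: "1 < p" "0 < r" "s = p / r"
    and sq: "1 < s" "1 < q" "1 / s + 1 / q = 1"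
    and lam: "\<And>Q. 0 \<le> lam Q" and K: "0 < K"
    and weak: "\<And>f t. f \<in> borel_measurable M \<Longrightarrow> (\<And>x. 0 \<le> f x) \<Longrightarrow>
      power_integral M p f < \<infinity> \<Longrightarrow> 0 < t \<Longrightarrow>
      emeasure N {x. t < power_sum M lam r f S x}
        \<le> ennreal (K powr s * t powr (- s)) * power_integral M p f"
    and R: "R \<in> S"
  shows "(\<integral>\<^sup>+x. ennreal ((\<Sum>Q\<in>{Q\<in>S. Q \<subseteq> R}. lam Q * measure N Q / measure M Q * indicator Q x) powr q) \<partial>M)
        \<le> ennreal (dual_const s q * K powr q) * emeasure N R"
proof -
  interpret A: laminar_measure S M by fact
  interpret B: laminar_measure S N by fact
  let ?SR = "{Q\<in>S. Q \<subseteq> R}"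
  define G where "G x = (\<Sum>Q\<in>?SR. lam Q * measure N Q / measure M Q * indicator Q x)" for x
  have G_nonneg: "0 \<le> G x" for x
    unfolding G_def using lam by (intro sum_nonneg) simp
  have [measurable]: "G \<in> borel_measurable M"
    unfolding G_def by (rule A.sum_indicator_measurable) auto
  have "(\<integral>\<^sup>+x. ennreal (G x powr q) \<partial>M) < \<infinity>"
    unfolding G_def using lam sq by (intro A.sum_indicator_powr_finite) auto
  then obtain Y where Y: "0 \<le> Y" "(\<integral>\<^sup>+x. ennreal (G x powr q) \<partial>M) = ennreal Y"
    by (cases "\<integral>\<^sup>+x. ennreal (G x powr q) \<partial>M") auto
  define h where "h x = G x powr (q - 1)" for x
  have h_nonneg: "0 \<le> h x" for x
    by (simp add: h_def)
  have h_meas [measurable]: "h \<in> borel_measurable M"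
    unfolding h_def by measurable
  have h_s: "h x powr s = G x powr q" for x
    using conjugate_exponents(3)[OF sq] by (simp add: h_def powr_powr)
  obtain m where m: "m \<in> borel_measurable M" "\<And>x. 0 \<le> m x"
    "\<And>Q x. Q \<in> S \<Longrightarrow> x \<in> Q \<Longrightarrow> mean M h Q \<le> m x"
    "power_integral M s m
      \<le> ennreal (2 powr s * carleson_const s) * power_integral M s h"
    using A.exists_majorant[OF h_meas h_nonneg sq(1)] by blast
  have [measurable]: "m \<in> borel_measurable M" by (rule m)
  let ?C = "2 powr s * carleson_const s"
  have C_pos: "0 < ?C"
    using carleson_const_pos[OF sq(1)] by simp
  define f where "f x = m x powr (1 / r)" for x
  have f_meas [measurable]: "f \<in> borel_measurable M"
    unfolding f_def by measurable
  have f_nonneg: "0 \<le> f x" for x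
    by (simp add: f_def)
  have f_p: "f x powr p = m x powr s" for x
    by (simp add: f_def powr_powr pr)
  have f_int: "power_integral M p f \<le> ennreal (?C * Y)"
    using m(4) C_pos Y by (simp add: f_p h_s ennreal_mult)
  then have f_fin: "power_integral M p f < \<infinity>"
    by (rule le_less_trans) simp
  have h_le_f: "mean M h Q \<le> mean M f Q powr r" if Q: "Q \<in> S" for Q
  proof -
    have "mean M h Q powr (1 / r) \<le> mean M f Q"
    proof (rule A.le_mean[OF Q])
      show "(\<integral>\<^sup>+x\<in>Q. ennreal (f x) \<partial>M) < \<infinity>"
        using A.finite_integral_on_cube[OF Q f_meas f_nonneg _ f_fin] pr by simp
      show "mean M h Q powr (1 / r) \<le> f x" if "x \<in> Q" for x
        unfolding f_def using m(3)[OF Q that] pr by (intro powr_mono2) auto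
    qed
    then have "(mean M h Q powr (1 / r)) powr r \<le> mean M f Q powr r"
      using pr by (intro powr_mono2) auto
    then show ?thesis
      using pr by (simp add: powr_powr)
  qed
  define V where "V x = (power_sum M lam r f S x)" for x
  have V_nonneg: "0 \<le> V x" for x
    unfolding V_def using lam by (intro sum_nonneg) simp
  have V_meas: "V \<in> borel_measurable N"
    unfolding V_def by (rule B.sum_indicator_measurable) simp
  let ?A = "K powr s * (?C * Y)"
  have A_nonneg: "0 \<le> ?A"
    using C_pos Y by simp
  have V_weak: "emeasure N {x\<in>space N. t < V x} \<le> ennreal (?A * t powr (- s))" if t: "0 < t" for t
  proof -
    have supp: "{x. t < V x} \<subseteq> space N"
    proof
      fix x assume "x \<in> {x. t < V x}"
      then have Vx: "t < V x" by simp
      have "\<exists>Q\<in>S. x \<in> Q"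
      proof (rule ccontr)
        assume "\<not> (\<exists>Q\<in>S. x \<in> Q)"
        then have "V x = 0"
          unfolding V_def by (intro sum.neutral) (auto simp: indicator_def)
        then show False
          using Vx t by simp
      qed
      then show "x \<in> space N"
        using B.sets_family sets.sets_into_space by blast
    qed
    have "emeasure N {x\<in>space N. t < V x} = emeasure N {x. t < V x}"
      using supp by (intro arg_cong2[where f = emeasure]) auto
    also have "\<dots> \<le> ennreal (K powr s * t powr (- s)) * power_integral M p f"
      unfolding V_def by (rule weak[OF f_meas f_nonneg f_fin t])
    also have "\<dots> \<le> ennreal (K powr s * t powr (- s)) * ennreal (?C * Y)"
      by (intro mult_left_mono f_int) simp
    also have "\<dots> = ennreal (?A * t powr (- s))"
      using C_pos Y by (simp add: ac_simps flip: ennreal_mult)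
    finally show ?thesis .
  qed
  let ?c = "2 / (1 - 2 powr (1 - s))"
  have c_pos: "0 < ?c"
    using sq by (simp add: powr_less_one)
  \<comment> \<open>With this \<open>t\<close> the second term of the layer cake bound is \<open>Y / 2\<close>, because
    \<open>(q - 1) (1 - s) = - 1\<close>.\<close>
  define B where "B = 2 * ?c * ?C * K powr s"
  have B_pos: "0 < B"
    unfolding B_def using c_pos carleson_const_pos[OF sq(1)] K by (intro mult_pos_pos) auto
  define t where "t = B powr (q - 1)"
  have t: "0 < t"
    using B_pos by (simp add: t_def)
  have t_pow: "?c * ?A * t powr (1 - s) = Y / 2"
  proof -
    have "(q - 1) * (1 - s) = - 1"
      using conjugate_exponents(1)[OF sq] by (simp add: algebra_simps)
    then have t_inv: "t powr (1 - s) = inverse B"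
      using B_pos by (simp add: t_def powr_powr powr_minus divide_inverse)
    have "c * (a * (b * y)) = (2 * c * b * a) * (y / 2)" for a b c y :: real
      by simp
    then have "?c * ?A = B * (Y / 2)"
      unfolding B_def .
    then have "?c * ?A * t powr (1 - s) = B * (Y / 2) * inverse B"
      by (simp only: t_inv)
    then show ?thesis
      using B_pos by simp
  qed
  have t_eq: "2 * t = dual_const s q * K powr q"
  proof -
    have "s * (q - 1) = q"
      using conjugate_exponents(3)[OF sq] by (simp add: mult.commute)
    then show ?thesis
      using c_pos carleson_const_pos[OF sq(1)] K
      by (simp add: t_def B_def dual_const_def powr_mult powr_divide powr_powr)
  qed
  have "ennreal Y = (\<integral>\<^sup>+x. ennreal (G x * h x) \<partial>M)"
    using powr_diff_one_mult[OF G_nonneg, of _ q] by (simp add: Y(2)[symmetric] h_def mult.commute)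
  also have "\<dots> = (\<Sum>Q\<in>?SR. ennreal (lam Q * measure N Q / measure M Q * mean M h Q) * emeasure M Q)"
    unfolding G_def
  proof (rule nn_integral_mult_positive_operator[OF M _ h_meas h_nonneg])
    show "(\<integral>\<^sup>+x\<in>Q. ennreal (h x) \<partial>M) < \<infinity>" if "Q \<in> ?SR" for Q
      using that A.finite_integral_on_cube[of Q h s] h_meas h_nonneg sq Y by (simp add: h_s)
  qed (use lam in auto)
  also have "\<dots> = (\<Sum>Q\<in>?SR. ennreal (lam Q * mean M h Q) * emeasure N Q)"
  proof (rule sum.cong[OF refl])
    fix Q assume "Q \<in> ?SR"
    then have Q: "Q \<in> S" by simp
    show "ennreal (lam Q * measure N Q / measure M Q * mean M h Q) * emeasure M Q
        = ennreal (lam Q * mean M h Q) * emeasure N Q"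
      using A.measure_pos[OF Q] lam[of Q]
      by (simp add: A.emeasure_eq[OF Q] B.emeasure_eq[OF Q] ac_simps flip: ennreal_mult)
  qed
  also have "\<dots> = (\<integral>\<^sup>+x. ennreal (\<Sum>Q\<in>?SR. lam Q * mean M h Q * indicator Q x) \<partial>N)"
    using lam by (intro B.nn_integral_sum_indicator[symmetric]) auto
  also have "\<dots> \<le> (\<integral>\<^sup>+x\<in>R. ennreal (V x) \<partial>N)"
  proof (rule nn_integral_mono)
    fix x
    show "ennreal (\<Sum>Q\<in>?SR. lam Q * mean M h Q * indicator Q x) \<le> ennreal (V x) * indicator R x"
    proof (cases "x \<in> R")
      case True
      have "(\<Sum>Q\<in>?SR. lam Q * mean M h Q * indicator Q x)
          \<le> (\<Sum>Q\<in>?SR. lam Q * mean M f Q powr r * indicator Q x)"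
        using lam h_le_f by (intro sum_mono mult_right_mono mult_left_mono) auto
      also have "\<dots> \<le> V x"
        unfolding V_def using lam A.finite_family by (intro sum_mono2) auto
      finally show ?thesis
        using True by (simp add: ennreal_leI)
    next
      case False
      then have "(\<Sum>Q\<in>?SR. lam Q * mean M h Q * indicator Q x) = 0"
        by (intro sum.neutral) (auto simp: indicator_def)
      then show ?thesis
        by (simp only: ennreal_0 zero_le)
    qed
  qed
  also have "\<dots> \<le> ennreal t * emeasure N R + ennreal (?c * ?A * t powr (1 - s))"
    by (rule B.layer_cake_bound[OF V_meas V_nonneg V_weak sq(1) A_nonneg t R])
  finally have "ennreal Y \<le> ennreal t * emeasure N R + ennreal (Y / 2)"
    by (simp only: t_pow)
  then have "Y \<le> t * measure N R + Y / 2"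
    using Y t by (simp add: B.emeasure_eq[OF R] flip: ennreal_mult ennreal_plus)
  then have "Y \<le> dual_const s q * K powr q * measure N R"
    unfolding t_eq[symmetric] by simp
  moreover have "0 \<le> dual_const s q"
    by (simp add: dual_const_def)
  ultimately have "ennreal Y \<le> ennreal (dual_const s q * K powr q) * emeasure N R"
    by (simp add: B.emeasure_eq[OF R] ennreal_leI flip: ennreal_mult)
  then show ?thesis
    by (simp only: Y(2)[symmetric] G_def)
qed

section \<open>Two-weight bounds for sums of powers of means\<close>

text \<open>Linearization: \<open>h\<close> is the \<open>r\<close>-th power of a majorant of the means of \<open>f\<close>.\<close>

lemma power_mean_le_mean_power:
  fixes S :: "'a set set"
  assumes M: "laminar_measure S M"
    and f: "f \<in> borel_measurable M" "\<And>x. 0 \<le> f x"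
    and pr: "1 < p" "0 < r" "r \<le> p"
    and fin: "power_integral M p f < \<infinity>"
  obtains h where "h \<in> borel_measurable M" "\<And>x. 0 \<le> h x"
    "\<And>Q. Q \<in> S \<Longrightarrow> mean M f Q powr r \<le> mean M h Q"
    "(\<integral>\<^sup>+x. ennreal (h x powr (p / r)) \<partial>M)
      \<le> ennreal (2 powr p * carleson_const p) * power_integral M p f"
proof -
  interpret A: laminar_measure S M by fact
  obtain m where m: "m \<in> borel_measurable M" "\<And>x. 0 \<le> m x"
    "\<And>Q x. Q \<in> S \<Longrightarrow> x \<in> Q \<Longrightarrow> mean M f Q \<le> m x"
    "power_integral M p m
      \<le> ennreal (2 powr p * carleson_const p) * power_integral M p f"
    using A.exists_majorant[OF f pr(1)] by blast
  have [measurable]: "m \<in> borel_measurable M" by (rule m)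
  define h where "h x = m x powr r" for x
  have h_meas: "h \<in> borel_measurable M"
    unfolding h_def by measurable
  have h_nonneg: "0 \<le> h x" for x
    by (simp add: h_def)
  have h_pow: "h x powr (p / r) = m x powr p" for x
    using pr by (simp add: h_def powr_powr)
  have "ennreal (2 powr p * carleson_const p) * power_integral M p f < \<infinity>"
    using fin by (simp add: ennreal_mult_less_top)
  then have h_fin: "(\<integral>\<^sup>+x. ennreal (h x powr (p / r)) \<partial>M) < \<infinity>"
    unfolding h_pow by (rule le_less_trans[OF m(4)])
  show thesis
  proof
    show "mean M f Q powr r \<le> mean M h Q" if Q: "Q \<in> S" for Q
    proof (rule A.le_mean[OF Q])
      show "(\<integral>\<^sup>+x\<in>Q. ennreal (h x) \<partial>M) < \<infinity>"
        using A.finite_integral_on_cube[OF Q h_meas h_nonneg _ h_fin] pr by simp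
      show "mean M f Q powr r \<le> h x" if "x \<in> Q" for x
        unfolding h_def using m(3)[OF Q that] pr by (intro powr_mono2) auto
    qed
  qed (use h_meas h_nonneg m(4) in \<open>auto simp: h_pow\<close>)
qed

definition strong_const :: "real \<Rightarrow> real \<Rightarrow> real \<Rightarrow> real" where
  "strong_const p s q
    = 16 * carleson_const s * (16 * carleson_const q) powr (s - 1) * (2 powr p * carleson_const p)"

lemma power_operator_strong_bound:
  fixes S :: "'a set set"
  assumes M: "laminar_measure S M" and N: "laminar_measure S N"
    and f: "f \<in> borel_measurable M" "\<And>x. 0 \<le> f x"
    and fin: "power_integral M p f < \<infinity>"
    and pr: "1 < p" "0 < r" "r < p" "s = p / r"
    and sq: "1 < s" "1 < q" "1 / s + 1 / q = 1"
    and lam: "\<And>Q. 0 \<le> lam Q" and T: "0 < T"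
    and test: "\<And>R. R \<in> S \<Longrightarrow> testing_at S M N lam s T R"
    and dual_test: "\<And>R. R \<in> S \<Longrightarrow> testing_at S N M (adjoint_coeff M N lam) q T R"
  shows "(\<integral>\<^sup>+x. ennreal (power_sum M lam r f S x powr s) \<partial>N)
    \<le> ennreal (strong_const p s q * T powr s) * power_integral M p f"
proof -
  have "r \<le> p" using pr by simp
  then obtain h where h: "h \<in> borel_measurable M" "\<And>x. 0 \<le> h x"
    "\<And>Q. Q \<in> S \<Longrightarrow> mean M f Q powr r \<le> mean M h Q"
    "power_integral M s h
      \<le> ennreal (2 powr p * carleson_const p) * power_integral M p f"
    using power_mean_le_mean_power[OF M f pr(1,2) _ fin] unfolding pr(4) by blast
  let ?K = "16 * carleson_const s * (16 * carleson_const q) powr (s - 1) * T powr s"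
  have K: "0 \<le> ?K"
    using carleson_const_pos[OF sq(1)] by simp
  have "(\<integral>\<^sup>+x. ennreal (power_sum M lam r f S x powr s) \<partial>N)
      \<le> (\<integral>\<^sup>+x. ennreal ((\<Sum>Q\<in>S. lam Q * mean M h Q * indicator Q x) powr s) \<partial>N)"
    using lam h(3) sq
    by (intro nn_integral_mono ennreal_leI powr_mono2 sum_mono mult_right_mono mult_left_mono sum_nonneg) auto
  also have "\<dots> \<le> ennreal ?K * power_integral M s h"
    by (rule positive_operator_strong_bound[OF M N h(1,2) sq lam T test dual_test])
  also have "\<dots> \<le> ennreal ?K * (ennreal (2 powr p * carleson_const p) * power_integral M p f)"
    by (intro mult_left_mono h) simp
  also have "\<dots> = ennreal (strong_const p s q * T powr s) * power_integral M p f"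
  proof -
    have "strong_const p s q * T powr s = ?K * (2 powr p * carleson_const p)"
      by (simp add: strong_const_def)
    then have "ennreal (strong_const p s q * T powr s)
        = ennreal ?K * ennreal (2 powr p * carleson_const p)"
      using K carleson_const_pos[OF pr(1)] by (simp only: ennreal_mult) (simp add: ennreal_mult)
    then show ?thesis
      by (simp only: mult.assoc)
  qed
  finally show ?thesis .
qed

lemma power_operator_weak_bound:
  fixes S :: "'a set set"
  assumes M: "laminar_measure S M" and N: "laminar_measure S N"
    and f: "f \<in> borel_measurable M" "\<And>x. 0 \<le> f x"
    and fin: "power_integral M p f < \<infinity>"
    and pr: "1 < p" "0 < r" "r < p" "s = p / r"
    and sq: "1 < s" "1 < q" "1 / s + 1 / q = 1"
    and lam: "\<And>Q. 0 \<le> lam Q" and T: "0 < T"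
    and dual_test: "\<And>R. R \<in> S \<Longrightarrow> testing_at S N M (adjoint_coeff M N lam) q T R"
    and t: "0 < t"
  shows "ennreal (t powr s) * emeasure N {x. t < power_sum M lam r f S x}
    \<le> ennreal (weak_const s * (2 powr p * carleson_const p) * T powr s)
        * power_integral M p f"
proof -
  interpret B: laminar_measure S N by fact
  let ?C = "2 powr p * carleson_const p"
  have "r \<le> p" using pr by simp
  then obtain h where h: "h \<in> borel_measurable M" "\<And>x. 0 \<le> h x"
    "\<And>Q. Q \<in> S \<Longrightarrow> mean M f Q powr r \<le> mean M h Q"
    "power_integral M s h \<le> ennreal ?C * power_integral M p f"
    using power_mean_le_mean_power[OF M f pr(1,2) _ fin] unfolding pr(4) by blast
  have h_fin: "power_integral M s h < \<infinity>"
    by (rule le_less_trans[OF h(4)]) (use fin in \<open>simp add: ennreal_mult_less_top\<close>)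
  let ?u = "\<lambda>x. \<Sum>Q\<in>S. lam Q * mean M h Q * indicator Q x"
  have u_meas: "?u \<in> borel_measurable N"
    by (rule B.sum_indicator_measurable) simp
  have u_supp: "{x. t < ?u x} = {x\<in>space N. t < ?u x}"
  proof -
    have "x \<in> space N" if "t < ?u x" for x
    proof (rule ccontr)
      assume "x \<notin> space N"
      then have "x \<notin> Q" if "Q \<in> S" for Q
        using B.sets_family[OF that] sets.sets_into_space by blast
      then have "?u x = 0"
        by (intro sum.neutral) (auto simp: indicator_def)
      then show False
        using that t by simp
    qed
    then show ?thesis
      by auto
  qed
  have u_sets: "{x. t < ?u x} \<in> sets N"
    unfolding u_supp using u_meas by measurable
  have "(power_sum M lam r f S x) \<le> ?u x" for x
    using lam h(3) by (intro sum_mono mult_right_mono mult_left_mono) auto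
  then have "{x. t < power_sum M lam r f S x} \<subseteq> {x. t < ?u x}"
    by (auto intro: less_le_trans)
  then have "emeasure N {x. t < power_sum M lam r f S x}
      \<le> emeasure N {x. t < ?u x}"
    by (rule emeasure_mono) (rule u_sets)
  also have "\<dots> \<le> ennreal (weak_const s * T powr s * t powr (- s)) * power_integral M s h"
    by (rule positive_operator_weak_bound[OF M N h(1,2) h_fin sq lam T dual_test t])
  also have "\<dots> \<le> ennreal (weak_const s * T powr s * t powr (- s))
      * (ennreal ?C * power_integral M p f)"
    by (intro mult_left_mono h) simp
  finally have "ennreal (t powr s) * emeasure N {x. t < power_sum M lam r f S x}
      \<le> ennreal (t powr s) * (ennreal (weak_const s * T powr s * t powr (- s))
      * (ennreal ?C * power_integral M p f))"
    by (rule mult_left_mono) simp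
  also have "\<dots> = ennreal (weak_const s * ?C * T powr s) * power_integral M p f"
  proof -
    have "t powr s * (weak_const s * T powr s * t powr (- s)) * ?C = weak_const s * ?C * T powr s"
      using t by (simp add: powr_minus)
    moreover have "0 \<le> weak_const s * T powr s * t powr (- s)" "0 \<le> ?C"
      using carleson_const_pos[OF pr(1)] by (auto simp: weak_const_def)
    ultimately have "ennreal (t powr s) * ennreal (weak_const s * T powr s * t powr (- s)) * ennreal ?C
        = ennreal (weak_const s * ?C * T powr s)"
      by (metis ennreal_mult mult_nonneg_nonneg powr_ge_zero)
    then show ?thesis
      by (simp only: mult.assoc[symmetric])
  qed
  finally show ?thesis .
qed

lemma powr_add_le:
  fixes x y :: real
  assumes "0 \<le> x" "0 \<le> y" "0 < s" "s \<le> 1"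
  shows "(x + y) powr s \<le> x powr s + y powr s"
proof (cases "x + y = 0")
  case False
  then have pos: "0 < x + y"
    using assms by linarith
  have part: "z / (x + y) \<le> (z / (x + y)) powr s" if "0 \<le> z" "z \<le> x + y" for z
  proof (cases "z = 0")
    case False
    then show ?thesis
      using powr_mono'[of s 1 "z / (x + y)"] assms that pos by simp
  qed simp
  have "1 = x / (x + y) + y / (x + y)"
    using pos by (simp flip: add_divide_distrib)
  also have "\<dots> \<le> (x / (x + y)) powr s + (y / (x + y)) powr s"
    using assms by (intro add_mono part) auto
  also have "\<dots> = (x powr s + y powr s) / (x + y) powr s"
    using assms by (simp add: powr_divide add_divide_distrib)
  finally show ?thesis
    using pos by (simp add: pos_le_divide_eq)
qed (use assms in simp)

lemma powr_sum_le_sum_powr: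
  fixes x :: "'b \<Rightarrow> real"
  assumes "finite I" "\<And>i. i \<in> I \<Longrightarrow> 0 \<le> x i" "0 < s" "s \<le> 1"
  shows "(\<Sum>i\<in>I. x i) powr s \<le> (\<Sum>i\<in>I. x i powr s)"
  using assms(1,2)
proof (induction I rule: finite_induct)
  case (insert i I)
  have "(x i + sum x I) powr s \<le> x i powr s + sum x I powr s"
    using insert assms by (intro powr_add_le sum_nonneg) auto
  also have "\<dots> \<le> x i powr s + (\<Sum>i\<in>I. x i powr s)"
    using insert by simp
  finally show ?case
    using insert by simp
qed simp

text \<open>Here \<open>s \<le> 1\<close>. Group the cubes by their stopping cube \<open>F\<close>, replace the means in each group by
  \<open>2 a\<^sub>F\<close>, and use \<open>(\<Sum>\<^sub>F x\<^sub>F)\<^sup>s \<le> \<Sum>\<^sub>F x\<^sub>F\<^sup>s\<close>: each group is then bounded by testing on \<open>F\<close>, and the Carleson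
  embedding sums over \<open>F\<close>.\<close>

lemma power_operator_strong_bound_subadditive:
  fixes S :: "'a set set"
  assumes M: "laminar_measure S M" and N: "laminar_measure S N"
    and f: "f \<in> borel_measurable M" "\<And>x. 0 \<le> f x"
    and pr: "1 < p" "p \<le> r" "s = p / r"
    and lam: "\<And>Q. 0 \<le> lam Q"
    and test: "\<And>R. R \<in> S \<Longrightarrow> testing_at S M N lam s T R"
  shows "(\<integral>\<^sup>+x. ennreal (power_sum M lam r f S x powr s) \<partial>N)
    \<le> ennreal (2 powr p * carleson_const p * T powr s) * power_integral M p f"
proof -
  interpret A: laminar_measure S M by fact
  interpret B: laminar_measure S N by fact
  let ?a = "mean M f"
  let ?R = "A.records ?a"
  have "0 < r"
    using pr by linarith
  then have s: "0 < s" "s \<le> 1" "r * s = p"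
    using pr(1,2) by (simp_all add: pr(3))
  define H where "H F x = (\<Sum>Q\<in>{Q\<in>S. Q \<subseteq> F}. lam Q * indicator Q x)" for F and x :: 'a
  have H_nonneg: "0 \<le> H F x" for F x
    unfolding H_def using lam by (intro sum_nonneg) simp
  have [measurable]: "H F \<in> borel_measurable N" for F
    unfolding H_def by (rule B.sum_indicator_measurable) auto
  define Z where "Z = {Q\<in>S. 0 < ?a Q}"
  have finZ: "finite Z"
    using A.finite_family by (simp add: Z_def)
  have st: "A.stop ?a Q \<in> ?R" "Q \<subseteq> A.stop ?a Q" "?a Q \<le> 2 * ?a (A.stop ?a Q)" if "Q \<in> Z" for Q
    using that A.stop_props[of Q ?a] by (auto simp: Z_def)
  have point: "(\<Sum>Q\<in>S. lam Q * ?a Q powr r * indicator Q x) \<le> (\<Sum>F\<in>?R. (2 * ?a F) powr r * H F x)" for x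
  proof -
    have "(\<Sum>Q\<in>S. lam Q * ?a Q powr r * indicator Q x) = (\<Sum>Q\<in>Z. lam Q * ?a Q powr r * indicator Q x)"
    proof (rule sum.mono_neutral_right)
      show "\<forall>Q\<in>S - Z. lam Q * ?a Q powr r * indicator Q x = 0"
        by (auto simp: Z_def less_le)
    qed (auto simp: Z_def A.finite_family)
    also have "\<dots> = (\<Sum>F\<in>?R. \<Sum>Q\<in>{Q\<in>Z. A.stop ?a Q = F}. lam Q * ?a Q powr r * indicator Q x)"
      using st(1) by (intro sum.group[symmetric] finZ A.finite_records) blast
    also have "\<dots> \<le> (\<Sum>F\<in>?R. (2 * ?a F) powr r * H F x)"
    proof (rule sum_mono)
      fix F assume F: "F \<in> ?R"
      have "(\<Sum>Q\<in>{Q\<in>Z. A.stop ?a Q = F}. lam Q * ?a Q powr r * indicator Q x)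
          \<le> (\<Sum>Q\<in>{Q\<in>Z. A.stop ?a Q = F}. (2 * ?a F) powr r * (lam Q * indicator Q x))"
      proof (rule sum_mono)
        fix Q assume "Q \<in> {Q\<in>Z. A.stop ?a Q = F}"
        then have "?a Q \<le> 2 * ?a F"
          using st(3)[of Q] by auto
        then have "?a Q powr r \<le> (2 * ?a F) powr r"
          using pr by (intro powr_mono2) auto
        then have "?a Q powr r * (lam Q * indicator Q x) \<le> (2 * ?a F) powr r * (lam Q * indicator Q x)"
          using lam by (intro mult_right_mono) auto
        then show "lam Q * ?a Q powr r * indicator Q x \<le> (2 * ?a F) powr r * (lam Q * indicator Q x)"
          by (simp add: ac_simps)
      qed
      also have "\<dots> = (2 * ?a F) powr r * (\<Sum>Q\<in>{Q\<in>Z. A.stop ?a Q = F}. lam Q * indicator Q x)"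
        by (rule sum_distrib_left[symmetric])
      also have "\<dots> \<le> (2 * ?a F) powr r * H F x"
      proof (rule mult_left_mono)
        have "{Q\<in>Z. A.stop ?a Q = F} \<subseteq> {Q\<in>S. Q \<subseteq> F}"
          using st(2) by (auto simp: Z_def)
        then show "(\<Sum>Q\<in>{Q\<in>Z. A.stop ?a Q = F}. lam Q * indicator Q x) \<le> H F x"
          unfolding H_def using lam A.finite_family by (intro sum_mono2) auto
      qed simp
      finally show "(\<Sum>Q\<in>{Q\<in>Z. A.stop ?a Q = F}. lam Q * ?a Q powr r * indicator Q x)
          \<le> (2 * ?a F) powr r * H F x" .
    qed
    finally show ?thesis .
  qed
  have point_s: "(\<Sum>Q\<in>S. lam Q * ?a Q powr r * indicator Q x) powr s
      \<le> (\<Sum>F\<in>?R. (2 powr p * ?a F powr p) * H F x powr s)" for x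
  proof -
    have "(\<Sum>Q\<in>S. lam Q * ?a Q powr r * indicator Q x) powr s
        \<le> (\<Sum>F\<in>?R. (2 * ?a F) powr r * H F x) powr s"
      using point lam s by (intro powr_mono2 sum_nonneg) auto
    also have "\<dots> \<le> (\<Sum>F\<in>?R. ((2 * ?a F) powr r * H F x) powr s)"
      using H_nonneg s by (intro powr_sum_le_sum_powr A.finite_records) auto
    also have "\<dots> = (\<Sum>F\<in>?R. (2 powr p * ?a F powr p) * H F x powr s)"
      using s(3) by (intro sum.cong refl) (simp add: powr_mult powr_powr H_nonneg)
    finally show ?thesis .
  qed
  have "(\<integral>\<^sup>+x. ennreal ((\<Sum>Q\<in>S. lam Q * ?a Q powr r * indicator Q x) powr s) \<partial>N)
      \<le> (\<integral>\<^sup>+x. (\<Sum>F\<in>?R. ennreal (2 powr p * ?a F powr p) * ennreal (H F x powr s)) \<partial>N)"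
  proof (rule nn_integral_mono)
    fix x
    show "ennreal ((\<Sum>Q\<in>S. lam Q * ?a Q powr r * indicator Q x) powr s)
        \<le> (\<Sum>F\<in>?R. ennreal (2 powr p * ?a F powr p) * ennreal (H F x powr s))"
      using ennreal_leI[OF point_s[of x]] by (simp add: ennreal_mult flip: sum_ennreal)
  qed
  also have "\<dots> = (\<Sum>F\<in>?R. \<integral>\<^sup>+x. ennreal (2 powr p * ?a F powr p) * ennreal (H F x powr s) \<partial>N)"
    by (rule nn_integral_sum) measurable
  also have "\<dots> = (\<Sum>F\<in>?R. ennreal (2 powr p * ?a F powr p) * (\<integral>\<^sup>+x. ennreal (H F x powr s) \<partial>N))"
    by (intro sum.cong refl nn_integral_cmult) measurable
  also have "\<dots> \<le> (\<Sum>F\<in>?R. ennreal (2 powr p * ?a F powr p) * (ennreal (T powr s) * emeasure M F))"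
    unfolding H_def using A.records_subset by (intro sum_mono mult_left_mono test) auto
  also have "\<dots> = ennreal (2 powr p * T powr s) * (\<Sum>F\<in>?R. ennreal (?a F powr p) * emeasure M F)"
    unfolding sum_distrib_left by (intro sum.cong refl) (simp add: ennreal_mult ac_simps)
  also have "\<dots> \<le> ennreal (2 powr p * T powr s)
      * (ennreal (carleson_const p) * power_integral M p f)"
    by (intro mult_left_mono A.carleson_embedding f pr) simp
  also have "\<dots> = ennreal (2 powr p * carleson_const p * T powr s) * power_integral M p f"
    using carleson_const_nonneg[OF pr(1)] by (simp add: ennreal_mult ac_simps)
  finally show ?thesis .
qed

section \<open>Powers of extended nonnegative reals\<close>

lemma epowr_ennreal: "0 \<le> x \<Longrightarrow> 0 < a \<Longrightarrow> epowr (ennreal x) a = ennreal (x powr a)"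
  by (auto simp: epowr_def)

lemma epowr_ennreal_pos: "0 < x \<Longrightarrow> epowr (ennreal x) a = ennreal (x powr a)"
  by (auto simp: epowr_def)

lemma epowr_top: "0 < a \<Longrightarrow> epowr top a = top"
  by (simp add: epowr_def)

lemma epowr_one [simp]: "epowr x 1 = x"
  by (cases x) (simp_all add: epowr_ennreal epowr_top)

lemma epowr_epowr: "0 < a \<Longrightarrow> 0 < b \<Longrightarrow> epowr (epowr x a) b = epowr x (a * b)"
  by (cases x) (simp_all add: epowr_ennreal epowr_top powr_powr)

lemma epowr_mono: "x \<le> y \<Longrightarrow> 0 < a \<Longrightarrow> epowr x a \<le> epowr y a"
  by (cases x; cases y) (auto simp: epowr_ennreal epowr_top top_unique intro!: ennreal_leI powr_mono2)

lemma epowr_inverse: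
  assumes "0 < a"
  shows "epowr (epowr x a) (1 / a) = x" "epowr (epowr x (1 / a)) a = x"
  using assms by (simp_all add: epowr_epowr)

lemma epowr_le_iff:
  assumes "0 < a"
  shows "epowr x a \<le> epowr y a \<longleftrightarrow> x \<le> y"
proof
  assume "epowr x a \<le> epowr y a"
  then have "epowr (epowr x a) (1 / a) \<le> epowr (epowr y a) (1 / a)"
    by (rule epowr_mono) (use assms in simp)
  then show "x \<le> y"
    by (simp only: epowr_inverse[OF assms])
qed (use assms epowr_mono in blast)

lemma epowr_less_iff: "0 < a \<Longrightarrow> epowr x a < epowr y a \<longleftrightarrow> x < y"
  using epowr_le_iff[of a y x] by (simp add: less_le_not_le epowr_le_iff)

lemma epowr_mult: "0 < a \<Longrightarrow> epowr (x * y) a = epowr x a * epowr y a"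
proof (cases x; cases y)
  fix u v assume a: "0 < a" and *: "0 \<le> u" "x = ennreal u" "0 \<le> v" "y = ennreal v"
  then have "epowr (x * y) a = epowr (ennreal (u * v)) a"
    by (simp add: ennreal_mult)
  also have "\<dots> = ennreal ((u * v) powr a)"
    using a * by (intro epowr_ennreal) auto
  also have "\<dots> = ennreal (u powr a) * ennreal (v powr a)"
    using * by (simp add: powr_mult ennreal_mult)
  finally show ?thesis
    using a * by (simp add: epowr_ennreal)
qed (auto simp: epowr_def ennreal_mult_top ennreal_top_mult)

text \<open>For positive exponents \<open>epowr\<close> is an order isomorphism of \<open>[0,\<infinity>]\<close>.\<close>

lemma epowr_SUP:
  assumes "0 < a"
  shows "epowr (SUP i\<in>I. f i) a = (SUP i\<in>I. epowr (f i) a)"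
proof (rule antisym)
  have "(SUP i\<in>I. f i) \<le> epowr (SUP i\<in>I. epowr (f i) a) (1 / a)"
  proof (rule SUP_least)
    fix i assume "i \<in> I"
    then have "epowr (epowr (f i) a) (1 / a) \<le> epowr (SUP i\<in>I. epowr (f i) a) (1 / a)"
      using assms by (intro epowr_mono SUP_upper) auto
    then show "f i \<le> epowr (SUP i\<in>I. epowr (f i) a) (1 / a)"
      using assms by (simp add: epowr_inverse)
  qed
  then have "epowr (SUP i\<in>I. f i) a \<le> epowr (epowr (SUP i\<in>I. epowr (f i) a) (1 / a)) a"
    using assms by (intro epowr_mono)
  then show "epowr (SUP i\<in>I. f i) a \<le> (SUP i\<in>I. epowr (f i) a)"
    using assms by (simp add: epowr_inverse)
  show "(SUP i\<in>I. epowr (f i) a) \<le> epowr (SUP i\<in>I. f i) a"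
    using assms by (intro SUP_least epowr_mono SUP_upper) auto
qed

lemma epowr_measurable [measurable]: "(\<lambda>x. epowr x a) \<in> borel_measurable borel"
  unfolding epowr_def by measurable

lemma epowr_root_le_iff:
  assumes "0 < a" "0 \<le> K"
  shows "epowr x (1 / a) \<le> ennreal K * epowr y (1 / a) \<longleftrightarrow> x \<le> ennreal (K powr a) * y"
proof -
  have "ennreal K = epowr (ennreal (K powr a)) (1 / a)"
    using assms by (simp add: epowr_ennreal powr_powr)
  then have "ennreal K * epowr y (1 / a) = epowr (ennreal (K powr a) * y) (1 / a)"
    using assms by (simp add: epowr_mult)
  then show ?thesis
    using assms by (simp add: epowr_le_iff)
qed

lemma ennreal_mult_le_iff:
  assumes "0 < c"
  shows "ennreal c * x \<le> ennreal c * y \<longleftrightarrow> x \<le> y"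
  using assms by (simp add: ennreal_mult_le_mult_iff)

text \<open>The form in which testing conditions arise, solved for the integral \<open>x\<close>.\<close>

lemma epowr_quotient_le_iff:
  assumes "0 < a" "0 \<le> K" "0 < m" "m < \<infinity>"
  shows "epowr m (- 1 / a) * epowr x (1 / a) \<le> ennreal K \<longleftrightarrow> x \<le> ennreal (K powr a) * m"
proof -
  obtain v where v: "0 < v" "m = ennreal v"
    using assms(3,4) by (cases m) auto
  have "epowr m (- 1 / a) = ennreal (v powr (- 1 / a))" "epowr m (1 / a) = ennreal (v powr (1 / a))"
    using v assms(1) by (simp_all add: epowr_ennreal_pos)
  moreover have "ennreal (v powr (1 / a)) * ennreal (v powr (- 1 / a)) = 1"
    using v assms by (simp flip: ennreal_mult powr_add)
  ultimately have inv: "epowr m (1 / a) * epowr m (- 1 / a) = 1" and pos: "epowr m (1 / a) = ennreal (v powr (1 / a))"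
    by auto
  have "epowr m (- 1 / a) * epowr x (1 / a) \<le> ennreal K
      \<longleftrightarrow> epowr m (1 / a) * (epowr m (- 1 / a) * epowr x (1 / a)) \<le> epowr m (1 / a) * ennreal K"
    unfolding pos using v by (intro ennreal_mult_le_iff[symmetric]) simp
  also have "\<dots> \<longleftrightarrow> epowr x (1 / a) \<le> ennreal K * epowr m (1 / a)"
    by (simp only: mult.assoc[symmetric] inv mult_1) (simp only: mult.commute)
  also have "\<dots> \<longleftrightarrow> x \<le> ennreal (K powr a) * m"
    using assms by (intro epowr_root_le_iff)
  finally show ?thesis .
qed

section \<open>Monotone limits over finite subfamilies\<close>

lemma finite_sum_le_infsum_ennreal:
  fixes g :: "'b \<Rightarrow> ennreal"
  assumes "finite F" "F \<subseteq> S"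
  shows "sum g F \<le> infsum g S"
proof -
  have "infsum g S = (SUP F\<in>{F. finite F \<and> F \<subseteq> S}. sum g F)"
    by (rule nonneg_infsum_complete) simp
  then show ?thesis
    using assms by (simp add: SUP_upper)
qed

lemma infsum_ennreal_SUP:
  fixes g :: "'b \<Rightarrow> ennreal"
  assumes "incseq A" "\<And>n::nat. finite (A n)" "(\<Union>n. A n) = S"
  shows "infsum g S = (SUP n. sum g (A n))"
proof -
  have "infsum g S = (SUP F\<in>{F. finite F \<and> F \<subseteq> S}. sum g F)"
    by (rule nonneg_infsum_complete) simp
  also have "\<dots> = (SUP n. sum g (A n))"
  proof (rule antisym)
    show "(SUP F\<in>{F. finite F \<and> F \<subseteq> S}. sum g F) \<le> (SUP n. sum g (A n))"
    proof (rule SUP_least)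
      fix F assume "F \<in> {F. finite F \<and> F \<subseteq> S}"
      then have "finite F" "F \<subseteq> (\<Union>n. A n)"
        using assms by auto
      then have "\<exists>n. F \<subseteq> A n"
      proof (induction F rule: finite_induct)
        case (insert x F)
        then obtain m n where "F \<subseteq> A m" "x \<in> A n"
          by auto
        moreover have "A m \<subseteq> A (max m n)" "A n \<subseteq> A (max m n)"
          by (rule incseqD[OF assms(1)], simp)+
        ultimately show ?case
          by (intro exI[of _ "max m n"]) auto
      qed simp
      then obtain n where "F \<subseteq> A n" ..
      then have "sum g F \<le> sum g (A n)"
        using assms(2) by (intro sum_mono2) auto
      then show "sum g F \<le> (SUP n. sum g (A n))"
        by (rule SUP_upper2[rotated]) simp
    qed
    show "(SUP n. sum g (A n)) \<le> (SUP F\<in>{F. finite F \<and> F \<subseteq> S}. sum g F)"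
      using assms by (intro SUP_least SUP_upper) auto
  qed
  finally show ?thesis .
qed

lemma countable_exhaustion:
  assumes "countable S"
  obtains A :: "nat \<Rightarrow> 'b set" where "incseq A" "\<And>n. finite (A n)" "(\<Union>n. A n) = S"
proof
  let ?A = "\<lambda>n. {x \<in> S. to_nat_on S x < n}"
  show "incseq ?A"
    by (auto simp: incseq_def)
  show "finite (?A n)" for n
  proof -
    have "inj_on (to_nat_on S) (?A n)"
      by (rule inj_on_subset[OF inj_on_to_nat_on[OF assms]]) auto
    moreover have "to_nat_on S ` ?A n \<subseteq> {..<n}"
      by auto
    ultimately show ?thesis
      using inj_on_finite by blast
  qed
  show "(\<Union>n. ?A n) = S"
    by auto
qed

lemma nn_integral_infsum_powr_le:
  fixes g :: "'b \<Rightarrow> 'a \<Rightarrow> ennreal"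
  assumes "countable S" "0 < q" "\<And>Q. Q \<in> S \<Longrightarrow> g Q \<in> borel_measurable M"
    and bound: "\<And>F. finite F \<Longrightarrow> F \<subseteq> S \<Longrightarrow> (\<integral>\<^sup>+x. epowr (\<Sum>Q\<in>F. g Q x) q \<partial>M) \<le> B"
  shows "(\<integral>\<^sup>+x. epowr (\<Sum>\<^sub>\<infinity>Q\<in>S. g Q x) q \<partial>M) \<le> B"
proof -
  obtain A where A: "incseq A" "\<And>n::nat. finite (A n)" "(\<Union>n. A n) = S"
    using countable_exhaustion[OF assms(1)] by blast
  have "epowr (\<Sum>\<^sub>\<infinity>Q\<in>S. g Q x) q = (SUP n. epowr (\<Sum>Q\<in>A n. g Q x) q)" for x
    unfolding infsum_ennreal_SUP[OF A] by (rule epowr_SUP[OF assms(2)])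
  then have "(\<integral>\<^sup>+x. epowr (\<Sum>\<^sub>\<infinity>Q\<in>S. g Q x) q \<partial>M) = (\<integral>\<^sup>+x. (SUP n. epowr (\<Sum>Q\<in>A n. g Q x) q) \<partial>M)"
    by simp
  also have "\<dots> = (SUP n. \<integral>\<^sup>+x. epowr (\<Sum>Q\<in>A n. g Q x) q \<partial>M)"
  proof (rule nn_integral_monotone_convergence_SUP)
    show "incseq (\<lambda>n x. epowr (\<Sum>Q\<in>A n. g Q x) q)"
    proof (intro incseq_SucI le_funI epowr_mono assms(2))
      fix n x
      show "(\<Sum>Q\<in>A n. g Q x) \<le> (\<Sum>Q\<in>A (Suc n). g Q x)"
        using A(2) incseq_SucD[OF A(1), of n] by (intro sum_mono2) auto
    qed
    show "(\<lambda>x. epowr (\<Sum>Q\<in>A n. g Q x) q) \<in> borel_measurable M" for n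
    proof -
      have [measurable]: "(\<lambda>x. \<Sum>Q\<in>A n. g Q x) \<in> borel_measurable M"
        using A(3) by (intro borel_measurable_sum assms(3)) auto
      show ?thesis by measurable
    qed
  qed
  also have "\<dots> \<le> B"
    using A by (intro SUP_least bound) auto
  finally show ?thesis .
qed

lemma emeasure_infsum_level_le:
  fixes g :: "'b \<Rightarrow> 'a \<Rightarrow> ennreal"
  assumes "countable S" "\<And>Q. Q \<in> S \<Longrightarrow> g Q \<in> borel_measurable M" "space M = UNIV"
    and bound: "\<And>F. finite F \<Longrightarrow> F \<subseteq> S \<Longrightarrow> emeasure M {x. t < (\<Sum>Q\<in>F. g Q x)} \<le> B"
  shows "emeasure M {x. t < (\<Sum>\<^sub>\<infinity>Q\<in>S. g Q x)} \<le> B"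
proof -
  obtain A where A: "incseq A" "\<And>n::nat. finite (A n)" "(\<Union>n. A n) = S"
    using countable_exhaustion[OF assms(1)] by blast
  let ?L = "\<lambda>n. {x. t < (\<Sum>Q\<in>A n. g Q x)}"
  have "{x. t < (\<Sum>\<^sub>\<infinity>Q\<in>S. g Q x)} = (\<Union>n. ?L n)"
    unfolding infsum_ennreal_SUP[OF A] by (auto simp: less_SUP_iff)
  moreover have "emeasure M (\<Union>n. ?L n) = (SUP n. emeasure M (?L n))"
  proof (rule SUP_emeasure_incseq[symmetric])
    have "?L n \<in> sets M" for n
    proof -
      have [measurable]: "(\<lambda>x. \<Sum>Q\<in>A n. g Q x) \<in> borel_measurable M"
        using A(3) by (intro borel_measurable_sum assms(2)) auto
      have "{x \<in> space M. t < (\<Sum>Q\<in>A n. g Q x)} \<in> sets M"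
        by measurable
      then show ?thesis
        by (simp add: assms(3))
    qed
    then show "range ?L \<subseteq> sets M"
      by auto
    show "incseq ?L"
    proof (intro incseq_SucI subsetI CollectI)
      fix n x assume "x \<in> ?L n"
      moreover have "(\<Sum>Q\<in>A n. g Q x) \<le> (\<Sum>Q\<in>A (Suc n). g Q x)"
        using A(2) incseq_SucD[OF A(1), of n] by (intro sum_mono2) auto
      ultimately show "t < (\<Sum>Q\<in>A (Suc n). g Q x)"
        by (auto intro: less_le_trans)
    qed
  qed
  moreover have "(SUP n. emeasure M (?L n)) \<le> B"
    using A by (intro SUP_least bound) auto
  ultimately show ?thesis
    by simp
qed

section \<open>Dyadic cubes and weighted measures\<close>

lemma sets_wmeasure [simp, measurable_cong]: "sets (wmeasure w) = sets lebesgue"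
  by (simp add: wmeasure_def)

lemma space_wmeasure [simp]: "space (wmeasure w) = UNIV"
  by (simp add: wmeasure_def)

lemma cube_borel: "cube a l \<in> sets borel"
  unfolding cube_def by measurable

lemma cube_lebesgue [measurable, simp]: "cube a l \<in> sets lebesgue"
  using cube_borel by (metis sets_completionI_sets sets_lborel)

lemma cube_subset_cbox: "cube a l \<subseteq> cbox a (\<chi> i. a $ i + l)"
  by (auto simp: cube_def mem_box_cart less_imp_le)

lemma box_subset_cube: "box a (\<chi> i. a $ i + l) \<subseteq> cube a l"
  by (auto simp: cube_def mem_box_cart less_imp_le)

lemma emeasure_cube_pos:
  fixes a :: "real ^ 'n"
  assumes "0 < l"
  shows "0 < emeasure lebesgue (cube a l)"
proof -
  have "0 < emeasure lborel (box a (\<chi> i. a $ i + l))"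
    using assms by (subst emeasure_lborel_box)
      (auto simp: Basis_vec_def inner_axis intro!: prod_pos)
  also have "\<dots> = emeasure lebesgue (box a (\<chi> i. a $ i + l))"
    by simp
  also have "\<dots> \<le> emeasure lebesgue (cube a l)"
    by (intro emeasure_mono box_subset_cube) simp
  finally show ?thesis .
qed

lemma emeasure_cube_finite: "emeasure lebesgue (cube a l) < \<infinity>"
proof -
  have "emeasure lebesgue (cube a l) \<le> emeasure lebesgue (cbox a (\<chi> i. a $ i + l))"
    by (intro emeasure_mono cube_subset_cbox) simp
  also have "\<dots> < \<infinity>"
    using emeasure_bounded_finite[OF bounded_cbox] by simp
  finally show ?thesis .
qed

lemma weight_measurable: "weight w \<Longrightarrow> w \<in> borel_measurable lebesgue"
  by (simp add: weight_def)

lemma emeasure_wmeasure: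
  assumes "weight w" "Q \<in> sets lebesgue"
  shows "emeasure (wmeasure w) Q = (\<integral>\<^sup>+x\<in>Q. ennreal (w x) \<partial>lebesgue)"
  unfolding wmeasure_def using assms weight_measurable[OF assms(1)]
  by (intro emeasure_density) auto

lemma wmeasure_cube_finite:
  assumes "weight w"
  shows "emeasure (wmeasure w) (cube a l) < \<infinity>"
proof -
  let ?K = "cbox a (\<chi> i. a $ i + l)"
  have "set_integrable lebesgue ?K w"
    using assms by (simp add: weight_def)
  then have "(\<integral>\<^sup>+x. ennreal (norm (indicator ?K x *\<^sub>R w x)) \<partial>lebesgue) < \<infinity>"
    unfolding set_integrable_def by (simp add: integrable_iff_bounded)
  moreover have "emeasure (wmeasure w) (cube a l) \<le> (\<integral>\<^sup>+x. ennreal (norm (indicator ?K x *\<^sub>R w x)) \<partial>lebesgue)"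
    unfolding emeasure_wmeasure[OF assms cube_lebesgue]
  proof (rule nn_integral_mono)
    fix x
    show "ennreal (w x) * indicator (cube a l) x \<le> ennreal (norm (indicator ?K x *\<^sub>R w x))"
      using cube_subset_cbox[of a l] by (auto simp: indicator_def intro!: ennreal_leI)
  qed
  ultimately show ?thesis
    by (rule le_less_trans[rotated])
qed

text \<open>A weight is positive almost everywhere, so it cannot vanish almost everywhere on a cube.\<close>

lemma wmeasure_cube_pos:
  assumes "weight w" "0 < l"
  shows "0 < emeasure (wmeasure w) (cube a l)"
proof (rule ccontr)
  assume "\<not> 0 < emeasure (wmeasure w) (cube a l)"
  then have zero: "(\<integral>\<^sup>+x\<in>cube a l. ennreal (w x) \<partial>lebesgue) = 0"
    by (simp add: emeasure_wmeasure[OF assms(1)])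
  have [measurable]: "w \<in> borel_measurable lebesgue"
    by (rule weight_measurable[OF assms(1)])
  have "AE x in lebesgue. ennreal (w x) * indicator (cube a l) x = 0"
    using zero by (subst (asm) nn_integral_0_iff_AE) auto
  moreover have "AE x in lebesgue. 0 < w x"
    using assms(1) by (simp add: weight_def)
  ultimately have "AE x in lebesgue. x \<notin> cube a l"
    by eventually_elim (auto simp: indicator_def split: if_splits)
  then have "emeasure lebesgue (cube a l) = 0"
    by (subst (asm) AE_iff_measurable[OF cube_lebesgue]) auto
  then show False
    using emeasure_cube_pos[OF assms(2), of a] by simp
qed

lemma dyadic_systemD:
  assumes "dyadic_system D"
  shows "Q \<in> D \<Longrightarrow> \<exists>a. \<exists>k::int. Q = cube a (2 powi k)"
    and "\<exists>!Q. Q \<in> D \<and> (\<exists>a. Q = cube a (2 powi k)) \<and> x \<in> Q"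
    and "Q \<in> D \<Longrightarrow> R \<in> D \<Longrightarrow> Q \<inter> R = {} \<or> Q \<subseteq> R \<or> R \<subseteq> Q"
  using assms by (simp_all add: dyadic_system_def)

lemma dyadic_cubeE:
  assumes "dyadic_system D" "Q \<in> D"
  obtains a l where "Q = cube a l" "0 < l"
proof -
  obtain a and k :: int where "Q = cube a (2 powi k)"
    using dyadic_systemD(1)[OF assms] by blast
  then show thesis
    by (intro that[of a "2 powi k"]) auto
qed

lemma laminar_measure_wmeasure:
  assumes "dyadic_system D" "weight w" "finite S" "S \<subseteq> D"
  shows "laminar_measure S (wmeasure w)"
proof
  show "finite S" by fact
next
  fix Q assume "Q \<in> S"
  then obtain a l where Q: "Q = cube a l" "0 < l"
    using dyadic_cubeE assms by (metis subsetD)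
  show "Q \<in> sets (wmeasure w)" "0 < emeasure (wmeasure w) Q" "emeasure (wmeasure w) Q < \<infinity>"
    using Q wmeasure_cube_pos[OF assms(2)] wmeasure_cube_finite[OF assms(2)] by auto
  show "Q \<noteq> {}"
    using emeasure_cube_pos[OF Q(2), of a] Q(1) by auto
next
  fix Q R assume "Q \<in> S" "R \<in> S"
  then show "Q \<inter> R = {} \<or> Q \<subseteq> R \<or> R \<subseteq> Q"
    using dyadic_systemD(3)[OF assms(1)] assms(4) by (simp add: subset_iff)
qed

text \<open>A cube is determined by its generation and any point of a countable dense set that it contains.\<close>

lemma countable_dyadic_system:
  fixes D :: "(real ^ 'n) set set"
  assumes "dyadic_system D"
  shows "countable D"
proof -
  obtain B :: "(real ^ 'n) set" where B: "countable B" "\<And>U. open U \<Longrightarrow> U \<noteq> {} \<Longrightarrow> \<exists>x\<in>B. x \<in> U"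
    using countable_dense_exists by blast
  define c where "c k x = (THE Q. Q \<in> D \<and> (\<exists>a. Q = cube a (2 powi k)) \<and> x \<in> Q)" for k :: int and x
  have "D \<subseteq> (\<lambda>(k, x). c k x) ` (UNIV \<times> B)"
  proof
    fix Q assume Q: "Q \<in> D"
    then obtain a and k :: int where ak: "Q = cube a (2 powi k)"
      using dyadic_systemD(1)[OF assms Q] by blast
    let ?b = "box a (\<chi> i. a $ i + 2 powi k)"
    have "(\<chi> i. a $ i + 2 powi k / 2) \<in> ?b"
      by (simp add: mem_box_cart)
    then obtain x where x: "x \<in> B" "x \<in> ?b"
      using B(2)[of ?b] by (auto simp: open_box)
    then have "x \<in> Q"
      using box_subset_cube ak by blast
    then have "c k x = Q"
      unfolding c_def using Q ak by (intro the1_equality dyadic_systemD(2)[OF assms]) blast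
    then show "Q \<in> (\<lambda>(k, x). c k x) ` (UNIV \<times> B)"
      using x(1) by force
  qed
  then show ?thesis
    using B(1) countable_subset by (meson countableI_type countable_SIGMA countable_image)
qed

section \<open>Testing constants and operator norms in terms of finite subfamilies\<close>

locale dyadic_two_weight =
  fixes D :: "(real ^ 'n) set set" and p r :: real
    and w \<sigma> :: "real ^ 'n \<Rightarrow> real" and S :: "(real ^ 'n) set set"
  assumes dyadic: "dyadic_system D" and p: "1 < p" and r: "0 < r"
    and weight_w: "weight w" and weight_\<sigma>: "weight \<sigma>" and S_subset: "S \<subseteq> D"
begin

abbreviation \<mu> where
  "\<mu> \<equiv> wmeasure \<sigma>"

abbreviation \<nu> where
  "\<nu> \<equiv> wmeasure w"

abbreviation s where
  "s \<equiv> p / r"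

text \<open>The coefficient \<open>\<lambda>\<^sub>Q\<close>: the \<open>r\<close>-th power of the Lebesgue average of \<open>\<sigma>\<close>, as a real number.\<close>

definition lam :: "(real ^ 'n) set \<Rightarrow> real" where
  "lam Q = (measure \<mu> Q / measure lebesgue Q) powr r"

definition energy :: "(real ^ 'n \<Rightarrow> real) \<Rightarrow> ennreal" where
  "energy f = power_integral \<mu> p f"

definition admissible :: "(real ^ 'n \<Rightarrow> real) \<Rightarrow> bool" where
  "admissible f \<longleftrightarrow> f \<in> borel_measurable lebesgue \<and> (\<forall>x. 0 \<le> f x) \<and> energy f < \<infinity>"

text \<open>The \<open>r\<close>-th power of the sparse operator applied to \<open>f \<sigma>\<close>.\<close>

definition sparse_power :: "(real ^ 'n \<Rightarrow> real) \<Rightarrow> real ^ 'n \<Rightarrow> ennreal" where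
  "sparse_power f x = (\<Sum>\<^sub>\<infinity>Q\<in>S. epowr (avg Q (\<lambda>x. f x * \<sigma> x)) r * indicator Q x)"

lemma s_pos: "0 < s"
  using p r by simp

lemma lam_nonneg: "0 \<le> lam Q"
  by (simp add: lam_def)

lemma laminar_\<mu>: "finite F \<Longrightarrow> F \<subseteq> S \<Longrightarrow> laminar_measure F \<mu>"
  using laminar_measure_wmeasure[OF dyadic weight_\<sigma>] S_subset by blast

lemma laminar_\<nu>: "finite F \<Longrightarrow> F \<subseteq> S \<Longrightarrow> laminar_measure F \<nu>"
  using laminar_measure_wmeasure[OF dyadic weight_w] S_subset by blast

lemma countable_S: "countable S"
  using countable_subset[OF S_subset countable_dyadic_system[OF dyadic]] .

lemma wmeasure_cube:
  assumes "weight v" "Q \<in> S"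
  shows "Q \<in> sets lebesgue" "0 < emeasure (wmeasure v) Q" "emeasure (wmeasure v) Q < \<infinity>"
    "emeasure (wmeasure v) Q = ennreal (measure (wmeasure v) Q)" "0 < measure (wmeasure v) Q"
proof -
  interpret laminar_measure "{Q}" "wmeasure v"
    using assms S_subset by (intro laminar_measure_wmeasure[OF dyadic]) auto
  show "Q \<in> sets lebesgue" "0 < emeasure (wmeasure v) Q" "emeasure (wmeasure v) Q < \<infinity>"
    "emeasure (wmeasure v) Q = ennreal (measure (wmeasure v) Q)" "0 < measure (wmeasure v) Q"
    using sets_family[of Q] emeasure_pos[of Q] emeasure_finite[of Q] emeasure_eq[of Q] measure_pos[of Q]
    by auto
qed

lemma lebesgue_cube:
  assumes "Q \<in> S"
  shows "emeasure lebesgue Q = ennreal (measure lebesgue Q)" "0 < measure lebesgue Q"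
proof -
  obtain a l where Q: "Q = cube a l" "0 < l"
    using dyadic_cubeE[OF dyadic] assms S_subset by blast
  have fin: "emeasure lebesgue Q < \<infinity>" and pos: "0 < emeasure lebesgue Q"
    unfolding Q(1) by (rule emeasure_cube_finite, rule emeasure_cube_pos[OF Q(2)])
  show eq: "emeasure lebesgue Q = ennreal (measure lebesgue Q)"
    using fin by (intro emeasure_eq_ennreal_measure) auto
  show "0 < measure lebesgue Q"
    using pos unfolding eq by simp
qed

lemma avg_weight:
  assumes "weight v" "Q \<in> S"
  shows "avg Q v = ennreal (measure (wmeasure v) Q / measure lebesgue Q)"
proof -
  have "avg Q v = emeasure (wmeasure v) Q / emeasure lebesgue Q"
    unfolding avg_def using wmeasure_cube(1)[OF assms] by (simp add: emeasure_wmeasure[OF assms(1)])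
  then show ?thesis
    using lebesgue_cube[OF assms(2)] wmeasure_cube(4)[OF assms] by (simp add: divide_ennreal)
qed

lemma admissible_integral_finite:
  assumes "admissible f" "Q \<in> S"
  shows "(\<integral>\<^sup>+x\<in>Q. ennreal (f x) \<partial>\<mu>) < \<infinity>"
proof -
  interpret laminar_measure "{Q}" \<mu>
    using assms(2) by (intro laminar_\<mu>) auto
  have "f \<in> borel_measurable \<mu>"
    using assms(1) by (simp add: admissible_def measurable_def)
  then show ?thesis
    using assms(1) p by (intro finite_integral_on_cube[of Q f p]) (auto simp: admissible_def energy_def)
qed

lemma avg_product:
  assumes "admissible f" "Q \<in> S"
  shows "avg Q (\<lambda>x. f x * \<sigma> x) = ennreal (mean \<mu> f Q * (measure \<mu> Q / measure lebesgue Q))"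
proof -
  interpret laminar_measure "{Q}" \<mu>
    using assms(2) by (intro laminar_\<mu>) auto
  have [measurable]: "f \<in> borel_measurable lebesgue" "\<sigma> \<in> borel_measurable lebesgue" "Q \<in> sets lebesgue"
    using assms weight_measurable[OF weight_\<sigma>] wmeasure_cube(1)[OF weight_\<sigma>]
    by (auto simp: admissible_def)
  have f: "0 \<le> f x" for x
    using assms(1) by (simp add: admissible_def)
  have "(\<integral>\<^sup>+x\<in>Q. ennreal (f x * \<sigma> x) \<partial>lebesgue)
      = (\<integral>\<^sup>+x. ennreal (\<sigma> x) * (ennreal (f x) * indicator Q x) \<partial>lebesgue)"
  proof (rule nn_integral_cong)
    fix x
    have "ennreal (f x * \<sigma> x) = ennreal (f x) * ennreal (\<sigma> x)"
      by (rule ennreal_mult'[OF f])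
    then show "ennreal (f x * \<sigma> x) * indicator Q x = ennreal (\<sigma> x) * (ennreal (f x) * indicator Q x)"
      by (simp only: ac_simps)
  qed
  also have "\<dots> = (\<integral>\<^sup>+x\<in>Q. ennreal (f x) \<partial>\<mu>)"
    unfolding wmeasure_def by (intro nn_integral_density[symmetric]) auto
  also have "\<dots> = ennreal (mean \<mu> f Q) * emeasure \<mu> Q"
    using admissible_integral_finite[OF assms] by (intro mean_eq[symmetric]) auto
  finally show ?thesis
    using lebesgue_cube[OF assms(2)] wmeasure_cube(4)[OF weight_\<sigma> assms(2)]
    by (simp add: avg_def divide_ennreal flip: ennreal_mult)
qed

lemma operator_term:
  assumes "admissible f" "Q \<in> S"
  shows "epowr (avg Q (\<lambda>x. f x * \<sigma> x)) r = ennreal (lam Q * mean \<mu> f Q powr r)"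
  unfolding avg_product[OF assms] lam_def using r
  by (simp add: epowr_ennreal powr_mult powr_divide mult.commute)

lemma testing_term:
  assumes "Q \<in> S"
  shows "epowr (avg Q \<sigma>) r = ennreal (lam Q)"
  unfolding avg_weight[OF weight_\<sigma> assms] lam_def using r
  by (simp add: epowr_ennreal)

text \<open>The weights of the dual testing sum are the coefficients of the adjoint of the linear operator
  with coefficients \<open>\<lambda>\<^sub>Q\<close>, because \<open>\<langle>w\<rangle>\<^sub>Q / \<langle>\<sigma>\<rangle>\<^sub>Q = \<nu>(Q) / \<mu>(Q)\<close>.\<close>

lemma dual_testing_term:
  assumes "Q \<in> S"
  shows "epowr (avg Q \<sigma>) (r - 1) * avg Q w = ennreal (lam Q * measure \<nu> Q / measure \<mu> Q)"
proof -
  let ?a = "measure \<mu> Q / measure lebesgue Q"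
  have a: "0 < ?a"
    using lebesgue_cube(2)[OF assms] wmeasure_cube(5)[OF weight_\<sigma> assms] by simp
  have "lam Q * measure \<nu> Q / measure \<mu> Q = ?a powr (r - 1) * (measure \<nu> Q / measure lebesgue Q)"
    using powr_diff_one_mult[of ?a r] a lebesgue_cube(2)[OF assms] wmeasure_cube(5)[OF weight_\<sigma> assms]
    by (simp add: lam_def field_simps)
  then show ?thesis
    unfolding avg_weight[OF weight_\<sigma> assms] avg_weight[OF weight_w assms]
    using a by (simp add: epowr_ennreal_pos flip: ennreal_mult)
qed

lemma sum_ennreal_indicator:
  assumes "F \<subseteq> S" "\<And>Q. Q \<in> S \<Longrightarrow> g Q = ennreal (c Q)" "\<And>Q. 0 \<le> c Q"
  shows "(\<Sum>Q\<in>F. g Q * indicator Q x) = ennreal (\<Sum>Q\<in>F. c Q * indicator Q x)"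
proof -
  have "(\<Sum>Q\<in>F. g Q * indicator Q x) = (\<Sum>Q\<in>F. ennreal (c Q * indicator Q x))"
    using assms by (intro sum.cong refl) (auto simp: indicator_def)
  also have "\<dots> = ennreal (\<Sum>Q\<in>F. c Q * indicator Q x)"
    using assms(3) by (intro sum_ennreal) auto
  finally show ?thesis .
qed

lemma epowr_sum_indicator:
  assumes "F \<subseteq> S" "\<And>Q. Q \<in> S \<Longrightarrow> g Q = ennreal (c Q)" "\<And>Q. 0 \<le> c Q" "0 < a"
  shows "epowr (\<Sum>Q\<in>F. g Q * indicator Q x) a = ennreal ((\<Sum>Q\<in>F. c Q * indicator Q x) powr a)"
proof -
  have "(\<Sum>Q\<in>F. g Q * indicator Q x) = ennreal (\<Sum>Q\<in>F. c Q * indicator Q x)"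
    by (rule sum_ennreal_indicator) (use assms in auto)
  then show ?thesis
    using assms(3,4) by (simp only:) (intro epowr_ennreal sum_nonneg, auto)
qed

lemma indicator_term_measurable:
  "weight v \<Longrightarrow> Q \<in> S \<Longrightarrow> (\<lambda>x. c * indicator Q x :: ennreal) \<in> borel_measurable (wmeasure v)"
  using wmeasure_cube(1)[of v Q] by simp

text \<open>The passage between the family and its finite subfamilies, by monotone convergence along an
  exhaustion.\<close>

lemma infinite_norm_iff:
  assumes "weight v" "C \<subseteq> S" "\<And>Q. Q \<in> S \<Longrightarrow> g Q = ennreal (c Q)" "\<And>Q. 0 \<le> c Q" "0 < a"
  shows "(\<integral>\<^sup>+x. epowr (\<Sum>\<^sub>\<infinity>Q\<in>C. g Q * indicator Q x) a \<partial>wmeasure v) \<le> B \<longleftrightarrow>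
    (\<forall>F. finite F \<and> F \<subseteq> C \<longrightarrow>
      (\<integral>\<^sup>+x. ennreal ((\<Sum>Q\<in>F. c Q * indicator Q x) powr a) \<partial>wmeasure v) \<le> B)"
proof (intro iffI allI impI)
  assume B: "(\<integral>\<^sup>+x. epowr (\<Sum>\<^sub>\<infinity>Q\<in>C. g Q * indicator Q x) a \<partial>wmeasure v) \<le> B"
  fix F assume F: "finite F \<and> F \<subseteq> C"
  have "(\<integral>\<^sup>+x. ennreal ((\<Sum>Q\<in>F. c Q * indicator Q x) powr a) \<partial>wmeasure v)
      = (\<integral>\<^sup>+x. epowr (\<Sum>Q\<in>F. g Q * indicator Q x) a \<partial>wmeasure v)"
    using F assms by (subst epowr_sum_indicator[where c = c]) auto
  also have "\<dots> \<le> (\<integral>\<^sup>+x. epowr (\<Sum>\<^sub>\<infinity>Q\<in>C. g Q * indicator Q x) a \<partial>wmeasure v)"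
    using F assms(5) by (intro nn_integral_mono epowr_mono finite_sum_le_infsum_ennreal) auto
  also note B
  finally show "(\<integral>\<^sup>+x. ennreal ((\<Sum>Q\<in>F. c Q * indicator Q x) powr a) \<partial>wmeasure v) \<le> B" .
next
  assume B: "\<forall>F. finite F \<and> F \<subseteq> C \<longrightarrow>
      (\<integral>\<^sup>+x. ennreal ((\<Sum>Q\<in>F. c Q * indicator Q x) powr a) \<partial>wmeasure v) \<le> B"
  show "(\<integral>\<^sup>+x. epowr (\<Sum>\<^sub>\<infinity>Q\<in>C. g Q * indicator Q x) a \<partial>wmeasure v) \<le> B"
  proof (rule nn_integral_infsum_powr_le)
    show "countable C"
      using countable_S assms(2) countable_subset by blast
    show "(\<lambda>x. g Q * indicator Q x) \<in> borel_measurable (wmeasure v)" if "Q \<in> C" for Q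
      using that assms(1,2) by (intro indicator_term_measurable) auto
    show "(\<integral>\<^sup>+x. epowr (\<Sum>Q\<in>F. g Q * indicator Q x) a \<partial>wmeasure v) \<le> B"
      if F: "finite F" "F \<subseteq> C" for F
    proof -
      have "F \<subseteq> S"
        using F assms(2) by blast
      then have "(\<integral>\<^sup>+x. epowr (\<Sum>Q\<in>F. g Q * indicator Q x) a \<partial>wmeasure v)
          = (\<integral>\<^sup>+x. ennreal ((\<Sum>Q\<in>F. c Q * indicator Q x) powr a) \<partial>wmeasure v)"
        using assms by (subst epowr_sum_indicator[where c = c]) auto
      then show ?thesis
        using B F by simp
    qed
  qed fact
qed

lemma testing_le_iff:
  assumes "0 \<le> T"
  shows "testing p r w \<sigma> S \<le> ennreal T \<longleftrightarrow>
    (\<forall>R\<in>S. \<forall>F. finite F \<and> F \<subseteq> {Q\<in>S. Q \<subseteq> R} \<longrightarrow>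
      (\<integral>\<^sup>+x. ennreal ((\<Sum>Q\<in>F. lam Q * indicator Q x) powr s) \<partial>\<nu>) \<le> ennreal (T powr s) * emeasure \<mu> R)"
proof -
  have "epowr (emeasure \<mu> R) (- r / p) *
        Lq_norm s w (\<lambda>x. \<Sum>\<^sub>\<infinity>Q\<in>{Q\<in>S. Q \<subseteq> R}. epowr (avg Q \<sigma>) r * indicator Q x) \<le> ennreal T \<longleftrightarrow>
      (\<forall>F. finite F \<and> F \<subseteq> {Q\<in>S. Q \<subseteq> R} \<longrightarrow>
      (\<integral>\<^sup>+x. ennreal ((\<Sum>Q\<in>F. lam Q * indicator Q x) powr s) \<partial>\<nu>) \<le> ennreal (T powr s) * emeasure \<mu> R)"
    if R: "R \<in> S" for R
  proof -
    have "- r / p = - 1 / s"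
      by simp
    then have "epowr (emeasure \<mu> R) (- r / p) *
        Lq_norm s w (\<lambda>x. \<Sum>\<^sub>\<infinity>Q\<in>{Q\<in>S. Q \<subseteq> R}. epowr (avg Q \<sigma>) r * indicator Q x) \<le> ennreal T \<longleftrightarrow>
      (\<integral>\<^sup>+x. epowr (\<Sum>\<^sub>\<infinity>Q\<in>{Q\<in>S. Q \<subseteq> R}. epowr (avg Q \<sigma>) r * indicator Q x) s \<partial>\<nu>)
        \<le> ennreal (T powr s) * emeasure \<mu> R"
      unfolding Lq_norm_def using wmeasure_cube[OF weight_\<sigma> R] s_pos assms
      by (simp only: epowr_quotient_le_iff)
    also have "\<dots> \<longleftrightarrow> (\<forall>F. finite F \<and> F \<subseteq> {Q\<in>S. Q \<subseteq> R} \<longrightarrow>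
      (\<integral>\<^sup>+x. ennreal ((\<Sum>Q\<in>F. lam Q * indicator Q x) powr s) \<partial>\<nu>) \<le> ennreal (T powr s) * emeasure \<mu> R)"
      by (rule infinite_norm_iff[OF weight_w _ testing_term lam_nonneg s_pos]) auto
    finally show ?thesis .
  qed
  then show ?thesis
    unfolding testing_def by (simp add: SUP_le_iff)
qed

lemma dual_testing_le_iff:
  assumes "0 \<le> T" "r < p"
  defines "q \<equiv> p / (p - r)"
  shows "dual_testing p r w \<sigma> S \<le> ennreal T \<longleftrightarrow>
    (\<forall>R\<in>S. \<forall>F. finite F \<and> F \<subseteq> {Q\<in>S. Q \<subseteq> R} \<longrightarrow>
      (\<integral>\<^sup>+x. ennreal ((\<Sum>Q\<in>F. lam Q * measure \<nu> Q / measure \<mu> Q * indicator Q x) powr q) \<partial>\<mu>)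
        \<le> ennreal (T powr q) * emeasure \<nu> R)"
proof -
  have q: "0 < q"
    using p assms(2) by (simp add: q_def)
  have nonneg: "0 \<le> lam Q * measure \<nu> Q / measure \<mu> Q" for Q
    by (simp add: lam_nonneg)
  have "epowr (emeasure \<nu> R) (- 1 / q) *
        Lq_norm q \<sigma> (\<lambda>x. \<Sum>\<^sub>\<infinity>Q\<in>{Q\<in>S. Q \<subseteq> R}. epowr (avg Q \<sigma>) (r - 1) * avg Q w * indicator Q x) \<le> ennreal T \<longleftrightarrow>
      (\<forall>F. finite F \<and> F \<subseteq> {Q\<in>S. Q \<subseteq> R} \<longrightarrow>
      (\<integral>\<^sup>+x. ennreal ((\<Sum>Q\<in>F. lam Q * measure \<nu> Q / measure \<mu> Q * indicator Q x) powr q) \<partial>\<mu>)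
        \<le> ennreal (T powr q) * emeasure \<nu> R)"
    if R: "R \<in> S" for R
  proof -
    have "epowr (emeasure \<nu> R) (- 1 / q) *
        Lq_norm q \<sigma> (\<lambda>x. \<Sum>\<^sub>\<infinity>Q\<in>{Q\<in>S. Q \<subseteq> R}. epowr (avg Q \<sigma>) (r - 1) * avg Q w * indicator Q x) \<le> ennreal T \<longleftrightarrow>
      (\<integral>\<^sup>+x. epowr (\<Sum>\<^sub>\<infinity>Q\<in>{Q\<in>S. Q \<subseteq> R}. epowr (avg Q \<sigma>) (r - 1) * avg Q w * indicator Q x) q \<partial>\<mu>)
        \<le> ennreal (T powr q) * emeasure \<nu> R"
      unfolding Lq_norm_def using wmeasure_cube[OF weight_w R] q assms(1)
      by (simp only: epowr_quotient_le_iff)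
    also have "\<dots> \<longleftrightarrow> (\<forall>F. finite F \<and> F \<subseteq> {Q\<in>S. Q \<subseteq> R} \<longrightarrow>
      (\<integral>\<^sup>+x. ennreal ((\<Sum>Q\<in>F. lam Q * measure \<nu> Q / measure \<mu> Q * indicator Q x) powr q) \<partial>\<mu>)
        \<le> ennreal (T powr q) * emeasure \<nu> R)"
      by (rule infinite_norm_iff[OF weight_\<sigma> _ dual_testing_term nonneg q]) auto
    finally show ?thesis .
  qed
  then show ?thesis
    unfolding dual_testing_def Let_def q_def[symmetric] by (simp add: SUP_le_iff)
qed

lemma Lq_norm_eq:
  assumes "\<And>x. 0 \<le> f x"
  shows "Lq_norm p \<sigma> (\<lambda>x. ennreal (f x)) = epowr (energy f) (1 / p)"
proof -
  have "epowr (ennreal (f x)) p = ennreal (f x powr p)" for x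
    using assms p by (intro epowr_ennreal) auto
  then show ?thesis
    by (simp add: Lq_norm_def energy_def)
qed

lemma Lq_norm_finite_iff:
  assumes "\<And>x. 0 \<le> f x"
  shows "Lq_norm p \<sigma> (\<lambda>x. ennreal (f x)) < \<infinity> \<longleftrightarrow> energy f < \<infinity>"
  unfolding Lq_norm_eq[OF assms] using p epowr_less_iff[of "1 / p" "energy f" top] by (simp add: epowr_top)

lemma op_norm_alt:
  "op_norm p \<sigma> Y A = Inf {K. \<forall>f. admissible f \<longrightarrow> Y (A (\<lambda>x. f x * \<sigma> x)) \<le> K * epowr (energy f) (1 / p)}"
proof -
  have "(f \<in> borel_measurable lebesgue \<longrightarrow> (\<forall>x. 0 \<le> f x) \<longrightarrow>
            Lq_norm p \<sigma> (\<lambda>x. ennreal (f x)) < \<infinity> \<longrightarrow>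
            Y (A (\<lambda>x. f x * \<sigma> x)) \<le> K * Lq_norm p \<sigma> (\<lambda>x. ennreal (f x)))
      \<longleftrightarrow> (admissible f \<longrightarrow> Y (A (\<lambda>x. f x * \<sigma> x)) \<le> K * epowr (energy f) (1 / p))" for K f
  proof (cases "\<forall>x. 0 \<le> f x")
    case True
    then show ?thesis
      unfolding admissible_def using Lq_norm_finite_iff[of f] Lq_norm_eq[of f] by auto
  qed (auto simp: admissible_def)
  then show ?thesis
    unfolding op_norm_def by (simp only:)
qed

lemma power_op_norm_le:
  assumes "0 < A" "\<And>f. admissible f \<Longrightarrow> Y (B (\<lambda>x. f x * \<sigma> x)) \<le> ennreal (A powr (1 / r)) * epowr (energy f) (1 / p)"
  shows "epowr (op_norm p \<sigma> Y B) r \<le> ennreal A"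
proof -
  have "op_norm p \<sigma> Y B \<le> ennreal (A powr (1 / r))"
    unfolding op_norm_alt using assms(2) by (intro Inf_lower) auto
  then have "epowr (op_norm p \<sigma> Y B) r \<le> epowr (ennreal (A powr (1 / r))) r"
    using r by (intro epowr_mono)
  also have "\<dots> = ennreal A"
    using r assms(1) by (simp add: epowr_ennreal powr_powr)
  finally show ?thesis .
qed

text \<open>The infimum that defines the operator norm need not be known to be attained; any larger constant
  is admissible.\<close>

lemma power_op_norm_less:
  assumes "epowr (op_norm p \<sigma> Y B) r < ennreal A" "admissible f"
  shows "Y (B (\<lambda>x. f x * \<sigma> x)) \<le> ennreal (A powr (1 / r)) * epowr (energy f) (1 / p)"
proof -
  have A: "0 < A"
    using assms(1) by (metis ennreal_neg not_less not_less_zero)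
  have "epowr (op_norm p \<sigma> Y B) r < epowr (ennreal (A powr (1 / r))) r"
    using assms(1) A r by (simp add: epowr_ennreal powr_powr)
  then have "op_norm p \<sigma> Y B < ennreal (A powr (1 / r))"
    using r by (simp add: epowr_less_iff)
  then obtain K where K: "K < ennreal (A powr (1 / r))"
    "Y (B (\<lambda>x. f x * \<sigma> x)) \<le> K * epowr (energy f) (1 / p)"
    unfolding op_norm_alt Inf_less_iff using assms(2) by auto
  have "K * epowr (energy f) (1 / p) \<le> ennreal (A powr (1 / r)) * epowr (energy f) (1 / p)"
    using K(1) by (intro mult_right_mono) auto
  with K(2) show ?thesis
    by (rule order_trans)
qed

lemma sparse_op_power: "epowr (sparse_op S r (\<lambda>x. f x * \<sigma> x) x) p = epowr (sparse_power f x) s"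
  unfolding sparse_op_def sparse_power_def using p r by (simp add: epowr_epowr)

lemma strong_norm_le_iff:
  assumes "0 < A"
  shows "Lq_norm p w (sparse_op S r (\<lambda>x. f x * \<sigma> x)) \<le> ennreal (A powr (1 / r)) * epowr (energy f) (1 / p)
    \<longleftrightarrow> (\<integral>\<^sup>+x. epowr (sparse_power f x) s \<partial>\<nu>) \<le> ennreal (A powr s) * energy f"
proof -
  have "Lq_norm p w (sparse_op S r (\<lambda>x. f x * \<sigma> x)) = epowr (\<integral>\<^sup>+x. epowr (sparse_power f x) s \<partial>\<nu>) (1 / p)"
    unfolding Lq_norm_def sparse_op_power ..
  then show ?thesis
    using p epowr_root_le_iff[of p "A powr (1 / r)"] by (simp add: powr_powr)
qed

text \<open>The substitution \<open>t \<mapsto> t\<^sup>r\<close> makes the weak \<open>L\<^sup>p\<close> norm of the operator a weak \<open>L\<^sup>s\<close> norm of its \<open>r\<close>-th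
  power.\<close>

lemma sparse_op_level:
  assumes "0 < t"
  shows "{x. ennreal t < sparse_op S r (\<lambda>x. f x * \<sigma> x) x} = {x. ennreal (t powr r) < sparse_power f x}"
proof -
  have "ennreal t < sparse_op S r (\<lambda>x. f x * \<sigma> x) x \<longleftrightarrow> ennreal (t powr r) < sparse_power f x" for x
  proof -
    have "ennreal t = epowr (ennreal (t powr r)) (1 / r)"
      using assms r by (simp add: epowr_ennreal powr_powr)
    then show ?thesis
      unfolding sparse_op_def sparse_power_def using r by (simp add: epowr_less_iff)
  qed
  then show ?thesis
    by simp
qed

lemma weak_norm_le_iff:
  assumes "0 < A"
  shows "weak_Lq_norm p w (sparse_op S r (\<lambda>x. f x * \<sigma> x)) \<le> ennreal (A powr (1 / r)) * epowr (energy f) (1 / p)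
    \<longleftrightarrow> (\<forall>t>0. ennreal (t powr s) * emeasure \<nu> {x. ennreal t < sparse_power f x} \<le> ennreal (A powr s) * energy f)"
proof -
  let ?B = "ennreal (A powr (1 / r)) * epowr (energy f) (1 / p)"
  have each: "ennreal t * epowr (emeasure \<nu> {x. ennreal t < sparse_op S r (\<lambda>x. f x * \<sigma> x) x}) (1 / p) \<le> ?B
      \<longleftrightarrow> ennreal ((t powr r) powr s) * emeasure \<nu> {x. ennreal (t powr r) < sparse_power f x} \<le> ennreal (A powr s) * energy f"
    if t: "0 < t" for t
  proof -
    have pw: "epowr (ennreal ((t powr r) powr s)) (1 / p) = ennreal t"
      using t p r by (simp add: epowr_ennreal powr_powr)
    have "0 < 1 / p"
      using p by simp
    then have "ennreal t * epowr (emeasure \<nu> {x. ennreal t < sparse_op S r (\<lambda>x. f x * \<sigma> x) x}) (1 / p)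
        = epowr (ennreal ((t powr r) powr s) * emeasure \<nu> {x. ennreal (t powr r) < sparse_power f x}) (1 / p)"
      by (simp only: sparse_op_level[OF t] epowr_mult pw)
    then show ?thesis
      using p epowr_root_le_iff[of p "A powr (1 / r)"] by (simp add: powr_powr)
  qed
  have "weak_Lq_norm p w (sparse_op S r (\<lambda>x. f x * \<sigma> x)) \<le> ?B
    \<longleftrightarrow> (\<forall>t>0. ennreal ((t powr r) powr s) * emeasure \<nu> {x. ennreal (t powr r) < sparse_power f x} \<le> ennreal (A powr s) * energy f)"
    unfolding weak_Lq_norm_def SUP_le_iff using each by auto
  also have "\<dots> \<longleftrightarrow> (\<forall>t>0. ennreal (t powr s) * emeasure \<nu> {x. ennreal t < sparse_power f x} \<le> ennreal (A powr s) * energy f)"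
  proof (intro iffI allI impI)
    fix t :: real
    assume *: "\<forall>t>0. ennreal ((t powr r) powr s) * emeasure \<nu> {x. ennreal (t powr r) < sparse_power f x} \<le> ennreal (A powr s) * energy f"
      and t: "0 < t"
    have "(t powr (1 / r)) powr r = t"
      using t r by (simp add: powr_powr)
    then show "ennreal (t powr s) * emeasure \<nu> {x. ennreal t < sparse_power f x} \<le> ennreal (A powr s) * energy f"
      using *[rule_format, of "t powr (1 / r)"] t by simp
  next
    fix t :: real
    assume *: "\<forall>t>0. ennreal (t powr s) * emeasure \<nu> {x. ennreal t < sparse_power f x} \<le> ennreal (A powr s) * energy f"
      and t: "0 < t"
    show "ennreal ((t powr r) powr s) * emeasure \<nu> {x. ennreal (t powr r) < sparse_power f x} \<le> ennreal (A powr s) * energy f"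
      using *[rule_format, of "t powr r"] t by simp
  qed
  finally show ?thesis .
qed

end

section \<open>Comparison of the norms with the testing constants\<close>

context dyadic_two_weight
begin

abbreviation q where "q \<equiv> p / (p - r)"

lemma exponents:
  assumes "r < p"
  shows "1 < s" "1 < q" "1 / s + 1 / q = 1"
  using assms p r by (auto simp: field_simps)

lemma admissible_measurable: "admissible f \<Longrightarrow> f \<in> borel_measurable \<mu>"
  by (simp add: admissible_def measurable_def)

lemma admissible_nonneg: "admissible f \<Longrightarrow> 0 \<le> f x"
  by (simp add: admissible_def)

lemma admissible_finite: "admissible f \<Longrightarrow> power_integral \<mu> p f < \<infinity>"
  by (simp add: admissible_def energy_def)

lemma operator_coeff_nonneg: "0 \<le> lam Q * mean \<mu> f Q powr r"
  by (simp add: lam_nonneg)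

lemma sparse_power_norm_le_iff:
  assumes "admissible f"
  shows "(\<integral>\<^sup>+x. epowr (sparse_power f x) s \<partial>\<nu>) \<le> B \<longleftrightarrow> (\<forall>F. finite F \<and> F \<subseteq> S \<longrightarrow>
    (\<integral>\<^sup>+x. ennreal (power_sum \<mu> lam r f F x powr s) \<partial>\<nu>) \<le> B)"
  unfolding sparse_power_def
  by (rule infinite_norm_iff[OF weight_w order_refl operator_term[OF assms] operator_coeff_nonneg s_pos])

lemma finite_le_sparse_power:
  assumes "admissible f" "finite F" "F \<subseteq> S"
  shows "ennreal (power_sum \<mu> lam r f F x) \<le> sparse_power f x"
proof -
  have "(\<Sum>Q\<in>F. epowr (avg Q (\<lambda>x. f x * \<sigma> x)) r * indicator Q x)
      = ennreal (power_sum \<mu> lam r f F x)"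
    by (rule sum_ennreal_indicator[OF assms(3) operator_term[OF assms(1)] operator_coeff_nonneg])
  then show ?thesis
    using finite_sum_le_infsum_ennreal[OF assms(2,3), of "\<lambda>Q. epowr (avg Q (\<lambda>x. f x * \<sigma> x)) r * indicator Q x"]
    by (simp add: sparse_power_def)
qed

lemma sparse_power_measurable: "sparse_power f \<in> borel_measurable \<nu>"
proof -
  obtain A where A: "incseq A" "\<And>n::nat. finite (A n)" "(\<Union>n. A n) = S"
    using countable_exhaustion[OF countable_S] by blast
  have "sparse_power f = (\<lambda>x. SUP n. \<Sum>Q\<in>A n. epowr (avg Q (\<lambda>x. f x * \<sigma> x)) r * indicator Q x)"
    unfolding sparse_power_def infsum_ennreal_SUP[OF A] ..
  also have "\<dots> \<in> borel_measurable \<nu>"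
    using A(3) weight_w
    by (intro borel_measurable_SUP borel_measurable_sum indicator_term_measurable) auto
  finally show ?thesis .
qed

lemma sparse_power_level_sets: "{x. t < sparse_power f x} \<in> sets \<nu>"
proof -
  have [measurable]: "sparse_power f \<in> borel_measurable \<nu>"
    by (rule sparse_power_measurable)
  have "{x \<in> space \<nu>. t < sparse_power f x} \<in> sets \<nu>"
    by measurable
  then show ?thesis
    by simp
qed

lemma testing_subfamily:
  assumes "0 \<le> T" "testing p r w \<sigma> S \<le> ennreal T" "finite F" "F \<subseteq> S" "R \<in> F"
  shows "testing_at F \<mu> \<nu> lam s T R"
proof -
  have "finite {Q\<in>F. Q \<subseteq> R} \<and> {Q\<in>F. Q \<subseteq> R} \<subseteq> {Q\<in>S. Q \<subseteq> R}" "R \<in> S"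
    using assms(3-5) by auto
  then show ?thesis
    using assms(2) unfolding testing_le_iff[OF assms(1)] by blast
qed

lemma dual_testing_subfamily:
  assumes "0 \<le> T" "r < p" "dual_testing p r w \<sigma> S \<le> ennreal T" "finite F" "F \<subseteq> S" "R \<in> F"
  shows "testing_at F \<nu> \<mu> (adjoint_coeff \<mu> \<nu> lam) q T R"
proof -
  have "finite {Q\<in>F. Q \<subseteq> R} \<and> {Q\<in>F. Q \<subseteq> R} \<subseteq> {Q\<in>S. Q \<subseteq> R}" "R \<in> S"
    using assms(4-6) by auto
  then show ?thesis
    using assms(3) unfolding dual_testing_le_iff[OF assms(1,2)] by blast
qed

abbreviation strong_norm where
  "strong_norm \<equiv> epowr (op_norm p \<sigma> (Lq_norm p w) (sparse_op S r)) r"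

abbreviation weak_norm where
  "weak_norm \<equiv> epowr (op_norm p \<sigma> (weak_Lq_norm p w) (sparse_op S r)) r"

lemma strong_norm_le:
  assumes "0 < A" "\<And>f F. admissible f \<Longrightarrow> finite F \<Longrightarrow> F \<subseteq> S \<Longrightarrow>
    (\<integral>\<^sup>+x. ennreal (power_sum \<mu> lam r f F x powr s) \<partial>\<nu>)
      \<le> ennreal (A powr s) * energy f"
  shows "strong_norm \<le> ennreal A"
  using assms by (intro power_op_norm_le) (auto simp: strong_norm_le_iff sparse_power_norm_le_iff)

lemma strong_norm_less:
  assumes "strong_norm < ennreal A" "0 < A" "admissible f"
  shows "(\<integral>\<^sup>+x. epowr (sparse_power f x) s \<partial>\<nu>) \<le> ennreal (A powr s) * energy f"
  using power_op_norm_less[OF assms(1,3)] unfolding strong_norm_le_iff[OF assms(2)] .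

lemma weak_norm_less:
  assumes "weak_norm < ennreal A" "0 < A" "admissible f" "0 < t"
  shows "ennreal (t powr s) * emeasure \<nu> {x. ennreal t < sparse_power f x} \<le> ennreal (A powr s) * energy f"
  using power_op_norm_less[OF assms(1,3)] assms(4) unfolding weak_norm_le_iff[OF assms(2)] by blast

lemma powr_constant:
  fixes K T a :: real
  assumes "0 \<le> K" "0 < T" "0 < a"
  shows "(K powr (1 / a) * T) powr a = K * T powr a"
  using assms by (simp add: powr_mult powr_powr)

lemma powr_times_pos: "0 < (K::real) \<Longrightarrow> 0 < T \<Longrightarrow> 0 < K powr a * T"
  by simp

lemma strong_norm_upper_small_exponent:
  assumes "p \<le> r" "0 < T" "testing p r w \<sigma> S \<le> ennreal T"
  shows "strong_norm \<le> ennreal ((2 powr p * carleson_const p) powr (1 / s) * T)"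
proof (rule strong_norm_le)
  let ?K = "2 powr p * carleson_const p"
  have K: "0 < ?K"
    using carleson_const_pos[OF p] by simp
  then show "0 < ?K powr (1 / s) * T"
    using assms(2) by (rule powr_times_pos)
  fix f F assume f: "admissible f" and F: "finite F" "F \<subseteq> S"
  have "(\<integral>\<^sup>+x. ennreal (power_sum \<mu> lam r f F x powr s) \<partial>\<nu>)
      \<le> ennreal (?K * T powr s) * power_integral \<mu> p f"
    using assms F f
    by (intro power_operator_strong_bound_subadditive[OF laminar_\<mu>[OF F] laminar_\<nu>[OF F]]
        admissible_measurable[OF f] admissible_nonneg[OF f] p lam_nonneg testing_subfamily refl) auto
  then show "(\<integral>\<^sup>+x. ennreal (power_sum \<mu> lam r f F x powr s) \<partial>\<nu>)
      \<le> ennreal ((?K powr (1 / s) * T) powr s) * energy f"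
    unfolding powr_constant[OF less_imp_le[OF K] assms(2) s_pos] energy_def .
qed

lemma strong_norm_upper:
  assumes "r < p" "0 < T" "testing p r w \<sigma> S \<le> ennreal T" "dual_testing p r w \<sigma> S \<le> ennreal T"
  shows "strong_norm \<le> ennreal (strong_const p s q powr (1 / s) * T)"
proof (rule strong_norm_le)
  let ?K = "strong_const p s q"
  note sq = exponents[OF assms(1)]
  have K: "0 < ?K"
    unfolding strong_const_def using carleson_const_pos[OF sq(1)] carleson_const_pos[OF sq(2)] carleson_const_pos[OF p]
    by (intro mult_pos_pos) auto
  then show "0 < ?K powr (1 / s) * T"
    using assms(2) by (rule powr_times_pos)
  fix f F assume f: "admissible f" and F: "finite F" "F \<subseteq> S"
  have "(\<integral>\<^sup>+x. ennreal (power_sum \<mu> lam r f F x powr s) \<partial>\<nu>)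
      \<le> ennreal (?K * T powr s) * power_integral \<mu> p f"
    using assms F f
    by (intro power_operator_strong_bound[OF laminar_\<mu>[OF F] laminar_\<nu>[OF F]]
        admissible_measurable[OF f] admissible_nonneg[OF f] admissible_finite[OF f] p r sq lam_nonneg
        testing_subfamily dual_testing_subfamily refl) auto
  then show "(\<integral>\<^sup>+x. ennreal (power_sum \<mu> lam r f F x powr s) \<partial>\<nu>)
      \<le> ennreal ((?K powr (1 / s) * T) powr s) * energy f"
    unfolding powr_constant[OF less_imp_le[OF K] assms(2) s_pos] energy_def .
qed

lemma weak_norm_upper:
  assumes "r < p" "0 < T" "dual_testing p r w \<sigma> S \<le> ennreal T"
  shows "weak_norm \<le> ennreal ((weak_const s * (2 powr p * carleson_const p)) powr (1 / s) * T)"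
proof (rule power_op_norm_le)
  let ?K = "weak_const s * (2 powr p * carleson_const p)"
  note sq = exponents[OF assms(1)]
  have K: "0 < ?K"
    unfolding weak_const_def using carleson_const_pos[OF p] by (intro mult_pos_pos) auto
  then show A: "0 < ?K powr (1 / s) * T"
    using assms(2) by (rule powr_times_pos)
  fix f assume f: "admissible f"
  show "weak_Lq_norm p w (sparse_op S r (\<lambda>x. f x * \<sigma> x))
      \<le> ennreal ((?K powr (1 / s) * T) powr (1 / r)) * epowr (energy f) (1 / p)"
    unfolding weak_norm_le_iff[OF A]
  proof (intro allI impI)
    fix t :: real assume t: "0 < t"
    have "emeasure \<nu> {x. ennreal t < sparse_power f x}
        \<le> ennreal (t powr (- s)) * (ennreal ((?K powr (1 / s) * T) powr s) * energy f)"
      unfolding sparse_power_def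
    proof (rule emeasure_infsum_level_le[OF countable_S])
      show "(\<lambda>x. epowr (avg Q (\<lambda>x. f x * \<sigma> x)) r * indicator Q x) \<in> borel_measurable \<nu>" if "Q \<in> S" for Q
        using that by (intro indicator_term_measurable weight_w)
      fix F assume F: "finite F" "F \<subseteq> S"
      let ?u = "\<lambda>x. \<Sum>Q\<in>F. lam Q * mean \<mu> f Q powr r * indicator Q x"
      have u: "(\<Sum>Q\<in>F. epowr (avg Q (\<lambda>x. f x * \<sigma> x)) r * indicator Q x) = ennreal (?u x)" for x
        by (rule sum_ennreal_indicator[OF F(2) operator_term[OF f] operator_coeff_nonneg])
      have "ennreal (t powr s) * emeasure \<nu> {x. t < ?u x}
          \<le> ennreal (?K * T powr s) * power_integral \<mu> p f"
        using assms F f t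
        by (intro power_operator_weak_bound[OF laminar_\<mu>[OF F] laminar_\<nu>[OF F], where q = q]
            admissible_measurable[OF f] admissible_nonneg[OF f] admissible_finite[OF f] p r sq lam_nonneg
            dual_testing_subfamily refl) auto
      then have "ennreal (t powr (- s)) * (ennreal (t powr s) * emeasure \<nu> {x. t < ?u x})
          \<le> ennreal (t powr (- s)) * (ennreal (?K * T powr s) * energy f)"
        unfolding energy_def by (rule mult_left_mono) simp
      moreover have "ennreal (t powr (- s)) * ennreal (t powr s) = 1"
        using t by (simp flip: ennreal_mult powr_add)
      ultimately have "emeasure \<nu> {x. t < ?u x}
          \<le> ennreal (t powr (- s)) * (ennreal ((?K powr (1 / s) * T) powr s) * energy f)"
        unfolding powr_constant[OF less_imp_le[OF K] assms(2) s_pos] by (simp only: mult.assoc[symmetric] mult_1)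
      moreover have "{x. ennreal t < ennreal (?u x)} = {x. t < ?u x}"
        using t by (simp add: ennreal_less_iff)
      ultimately show "emeasure \<nu> {x. ennreal t < (\<Sum>Q\<in>F. epowr (avg Q (\<lambda>x. f x * \<sigma> x)) r * indicator Q x)}
          \<le> ennreal (t powr (- s)) * (ennreal ((?K powr (1 / s) * T) powr s) * energy f)"
        unfolding u by simp
    qed simp
    then have "ennreal (t powr s) * emeasure \<nu> {x. ennreal t < sparse_power f x}
        \<le> ennreal (t powr s) * (ennreal (t powr (- s)) * (ennreal ((?K powr (1 / s) * T) powr s) * energy f))"
      by (rule mult_left_mono) simp
    moreover have "ennreal (t powr s) * ennreal (t powr (- s)) = 1"
      using t by (simp flip: ennreal_mult powr_add)
    ultimately show "ennreal (t powr s) * emeasure \<nu> {x. ennreal t < sparse_power f x}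
        \<le> ennreal ((?K powr (1 / s) * T) powr s) * energy f"
      by (simp only: mult.assoc[symmetric] mult_1)
  qed
qed

text \<open>For \<open>Q \<subseteq> R\<close> the mean of the indicator of \<open>R\<close> over \<open>Q\<close> is 1, so the operator applied to it dominates
  the testing sum for \<open>R\<close>.\<close>

lemma testing_lower:
  assumes "strong_norm < ennreal A" "0 < A"
  shows "testing p r w \<sigma> S \<le> ennreal A"
proof -
  have "(\<integral>\<^sup>+x. ennreal ((\<Sum>Q\<in>F. lam Q * indicator Q x) powr s) \<partial>\<nu>) \<le> ennreal (A powr s) * emeasure \<mu> R"
    if R: "R \<in> S" and F: "finite F" "F \<subseteq> {Q\<in>S. Q \<subseteq> R}" for R F
  proof -
    define f :: "real ^ 'n \<Rightarrow> real" where "f = indicator R"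
    have Rm: "R \<in> sets lebesgue" "R \<in> sets \<mu>"
      using wmeasure_cube(1)[OF weight_\<sigma> R] by auto
    have "ennreal (f x powr p) = indicator R x" for x
      using p by (simp add: f_def indicator_def)
    then have energy_f: "energy f = emeasure \<mu> R"
      using Rm by (simp add: energy_def)
    have f: "admissible f"
      using Rm wmeasure_cube(3)[OF weight_\<sigma> R] unfolding admissible_def energy_f by (simp add: f_def)
    have FS: "F \<subseteq> S"
      using F(2) by auto
    interpret A: laminar_measure F \<mu>
      by (rule laminar_\<mu>[OF F(1) FS])
    have mean: "1 \<le> mean \<mu> f Q" if Q: "Q \<in> F" for Q
    proof (rule A.le_mean[OF Q])
      show "(\<integral>\<^sup>+x\<in>Q. ennreal (f x) \<partial>\<mu>) < \<infinity>"
        using admissible_integral_finite[OF f] FS Q by blast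
      show "1 \<le> f x" if "x \<in> Q" for x
      proof -
        have "x \<in> R"
          using that Q F(2) by blast
        then show ?thesis
          by (simp add: f_def)
      qed
    qed
    have "lam Q \<le> lam Q * mean \<mu> f Q powr r" if "Q \<in> F" for Q
      using mean[OF that] r lam_nonneg[of Q] powr_mono2[of r 1 "mean \<mu> f Q"]
      by (simp add: mult_le_cancel_left1)
    then have "(\<Sum>Q\<in>F. lam Q * indicator Q x) powr s
        \<le> (power_sum \<mu> lam r f F x) powr s" for x
      using s_pos lam_nonneg by (intro powr_mono2 sum_mono mult_right_mono sum_nonneg) auto
    then have "(\<integral>\<^sup>+x. ennreal ((\<Sum>Q\<in>F. lam Q * indicator Q x) powr s) \<partial>\<nu>)
        \<le> (\<integral>\<^sup>+x. ennreal (power_sum \<mu> lam r f F x powr s) \<partial>\<nu>)"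
      by (intro nn_integral_mono ennreal_leI)
    also have "\<dots> \<le> ennreal (A powr s) * energy f"
      using strong_norm_less[OF assms f] F(1) FS unfolding sparse_power_norm_le_iff[OF f] by blast
    finally show ?thesis
      by (simp only: energy_f)
  qed
  then show ?thesis
    using assms(2) by (subst testing_le_iff) auto
qed

text \<open>A finite set of subcubes of \<open>R\<close> is enlarged by \<open>R\<close> itself, so that it becomes a family to which
  \<open>dual_testing_of_weak_bound\<close> applies; the weak-type estimate is inherited by subfamilies.\<close>

lemma dual_testing_lower:
  assumes "r < p" "weak_norm < ennreal A" "0 < A"
  shows "dual_testing p r w \<sigma> S \<le> ennreal (dual_const s q powr (1 / q) * A)"
proof -
  note sq = exponents[OF assms(1)]
  have q_pos: "0 < q"
    using sq(2) by linarith
  have K: "0 \<le> dual_const s q"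
    by (simp add: dual_const_def)
  have "(\<integral>\<^sup>+x. ennreal ((\<Sum>Q\<in>F. lam Q * measure \<nu> Q / measure \<mu> Q * indicator Q x) powr q) \<partial>\<mu>)
      \<le> ennreal (dual_const s q * A powr q) * emeasure \<nu> R"
    if R: "R \<in> S" and F: "finite F" "F \<subseteq> {Q\<in>S. Q \<subseteq> R}" for R F
  proof -
    define G where "G = insert R F"
    have G: "finite G" "G \<subseteq> S" "R \<in> G" "{Q\<in>G. Q \<subseteq> R} = G"
      using R F by (auto simp: G_def)
    have weak: "emeasure \<nu> {x. t < power_sum \<mu> lam r f G x}
        \<le> ennreal (A powr s * t powr (- s)) * power_integral \<mu> p f"
      if f: "f \<in> borel_measurable \<mu>" "\<And>x. 0 \<le> f x" "power_integral \<mu> p f < \<infinity>"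
        and t: "0 < t" for f t
    proof -
      have adm: "admissible f"
        using f by (simp add: admissible_def energy_def measurable_def)
      have "{x. t < power_sum \<mu> lam r f G x} \<subseteq> {x. ennreal t < sparse_power f x}"
      proof
        fix x assume "x \<in> {x. t < power_sum \<mu> lam r f G x}"
        then have "ennreal t < ennreal (power_sum \<mu> lam r f G x)"
          using t by (simp add: ennreal_less_iff)
        also have "\<dots> \<le> sparse_power f x"
          by (rule finite_le_sparse_power[OF adm G(1,2)])
        finally show "x \<in> {x. ennreal t < sparse_power f x}"
          by simp
      qed
      then have "emeasure \<nu> {x. t < power_sum \<mu> lam r f G x}
          \<le> emeasure \<nu> {x. ennreal t < sparse_power f x}"
        by (rule emeasure_mono) (rule sparse_power_level_sets)
      also have "\<dots> = ennreal (t powr (- s)) * (ennreal (t powr s) * emeasure \<nu> {x. ennreal t < sparse_power f x})"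
      proof -
        have "ennreal (t powr (- s)) * ennreal (t powr s) = 1"
          using t by (simp flip: ennreal_mult powr_add)
        then show ?thesis
          by (simp only: mult.assoc[symmetric] mult_1)
      qed
      also have "\<dots> \<le> ennreal (t powr (- s)) * (ennreal (A powr s) * energy f)"
        by (intro mult_left_mono weak_norm_less[OF assms(2,3) adm t]) simp
      finally show ?thesis
        by (simp add: energy_def ennreal_mult ac_simps)
    qed
    have "(\<integral>\<^sup>+x. ennreal ((\<Sum>Q\<in>F. lam Q * measure \<nu> Q / measure \<mu> Q * indicator Q x) powr q) \<partial>\<mu>)
        \<le> (\<integral>\<^sup>+x. ennreal ((\<Sum>Q\<in>G. lam Q * measure \<nu> Q / measure \<mu> Q * indicator Q x) powr q) \<partial>\<mu>)"
      using G(1) q_pos lam_nonneg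
      by (intro nn_integral_mono ennreal_leI powr_mono2 sum_mono2 sum_nonneg) (auto simp: G_def)
    also have "\<dots> \<le> ennreal (dual_const s q * A powr q) * emeasure \<nu> R"
      using dual_testing_of_weak_bound[OF laminar_\<mu>[OF G(1,2)] laminar_\<nu>[OF G(1,2)] p r refl sq
          lam_nonneg assms(3) weak G(3)]
      unfolding G(4) by simp
    finally show ?thesis .
  qed
  then show ?thesis
    using powr_constant[OF K assms(3) q_pos] assms(3)
    by (subst dual_testing_le_iff[OF _ assms(1)]) auto
qed

text \<open>Chebyshev's inequality, for the \<open>r\<close>-th power of the operator.\<close>

lemma weak_le_strong_norm:
  assumes "strong_norm < ennreal A" "0 < A"
  shows "weak_norm \<le> ennreal A"
proof (rule power_op_norm_le[OF assms(2)])
  fix f assume f: "admissible f"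
  show "weak_Lq_norm p w (sparse_op S r (\<lambda>x. f x * \<sigma> x)) \<le> ennreal (A powr (1 / r)) * epowr (energy f) (1 / p)"
    unfolding weak_norm_le_iff[OF assms(2)]
  proof (intro allI impI)
    fix t :: real assume t: "0 < t"
    have "ennreal (t powr s) * emeasure \<nu> {x. ennreal t < sparse_power f x}
        = (\<integral>\<^sup>+x. ennreal (t powr s) * indicator {x. ennreal t < sparse_power f x} x \<partial>\<nu>)"
      using sparse_power_level_sets by (intro nn_integral_cmult_indicator[symmetric])
    also have "\<dots> \<le> (\<integral>\<^sup>+x. epowr (sparse_power f x) s \<partial>\<nu>)"
    proof (rule nn_integral_mono)
      fix x
      show "ennreal (t powr s) * indicator {x. ennreal t < sparse_power f x} x \<le> epowr (sparse_power f x) s"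
      proof (cases "ennreal t < sparse_power f x")
        case True
        then have "epowr (ennreal t) s \<le> epowr (sparse_power f x) s"
          using s_pos by (intro epowr_mono) auto
        then show ?thesis
          using True t s_pos by (simp add: epowr_ennreal)
      qed simp
    qed
    also have "\<dots> \<le> ennreal (A powr s) * energy f"
      by (rule strong_norm_less[OF assms f])
    finally show "ennreal (t powr s) * emeasure \<nu> {x. ennreal t < sparse_power f x} \<le> ennreal (A powr s) * energy f" .
  qed
qed

end

text \<open>Let \<open>A\<close> decrease to \<open>X\<close>; an infinite \<open>X\<close> makes the conclusion trivial.\<close>

lemma ennreal_le_of_real_bounds:
  assumes "0 < C" "\<And>A. 0 < A \<Longrightarrow> X < ennreal A \<Longrightarrow> Y \<le> ennreal (C * A)"
  shows "Y \<le> ennreal C * X"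
proof (cases X)
  case (real x)
  have "Y \<le> ennreal (C * x)"
  proof (rule ennreal_le_epsilon)
    fix e :: real assume "0 < e"
    then have "Y \<le> ennreal (C * (x + e / C))"
      using real assms(1) by (intro assms(2)) (auto simp: ennreal_less_iff add_nonneg_pos)
    also have "C * (x + e / C) = C * x + e"
      using assms(1) by (simp add: distrib_left)
    finally show "Y \<le> ennreal (C * x) + ennreal e"
      using real assms(1) \<open>0 < e\<close> by simp
  qed
  then show ?thesis
    using real assms(1) by (simp add: ennreal_mult)
next
  case top
  then show ?thesis
    using assms(1) by (simp add: ennreal_mult_top)
qed

lemma comparableI:
  assumes "0 < K" "0 < C"
    and "\<And>A. 0 < A \<Longrightarrow> X < ennreal A \<Longrightarrow> Y \<le> ennreal (K * A)"
    and "\<And>T. 0 < T \<Longrightarrow> Y < ennreal T \<Longrightarrow> X \<le> ennreal (C * T)"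
  shows "comparable (1 / K) C X Y"
proof -
  have "Y \<le> ennreal K * X"
    using assms(1,3) by (rule ennreal_le_of_real_bounds)
  then have "ennreal (1 / K) * Y \<le> ennreal (1 / K) * (ennreal K * X)"
    by (rule mult_left_mono) simp
  also have "\<dots> = ennreal (1 / K * K) * X"
    using assms(1) by (simp only: ennreal_mult mult.assoc less_imp_le zero_le_divide_1_iff)
  also have "\<dots> = X"
    using assms(1) by simp
  finally show ?thesis
    unfolding comparable_def using ennreal_le_of_real_bounds[OF assms(2,4)] by simp
qed

theorem theorem1p3:
  fixes D :: "(real ^ 'n) set set" and p r :: real
  assumes "dyadic_system D" and "1 < p" and "0 < r"
  shows "\<exists>c C :: real. 0 < c \<and> c \<le> C \<and>
    (\<forall>(w :: real ^ 'n \<Rightarrow> real) (\<sigma> :: real ^ 'n \<Rightarrow> real) S.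
       weight w \<longrightarrow> weight \<sigma> \<longrightarrow> S \<subseteq> D \<longrightarrow> sparse_collection S \<longrightarrow>
         comparable c C
           (epowr (op_norm p \<sigma> (Lq_norm p w) (sparse_op S r)) r)
           (if r < p then testing p r w \<sigma> S + dual_testing p r w \<sigma> S
            else testing p r w \<sigma> S) \<and>
         (r < p \<longrightarrow>
           comparable c C
             (epowr (op_norm p \<sigma> (weak_Lq_norm p w) (sparse_op S r)) r)
             (dual_testing p r w \<sigma> S)))"
proof -
  let ?s = "p / r" and ?q = "p / (p - r)"
  define K where "K = 1 + dual_const ?s ?q powr (1 / ?q)"
  define C where "C = 1 + (2 powr p * carleson_const p) powr (1 / ?s)
    + strong_const p ?s ?q powr (1 / ?s)
    + (weak_const ?s * (2 powr p * carleson_const p)) powr (1 / ?s)"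
  have K: "1 \<le> K" "dual_const ?s ?q powr (1 / ?q) \<le> K"
    by (simp_all add: K_def)
  have C: "1 \<le> C" "(2 powr p * carleson_const p) powr (1 / ?s) \<le> C"
    "strong_const p ?s ?q powr (1 / ?s) \<le> C"
    "(weak_const ?s * (2 powr p * carleson_const p)) powr (1 / ?s) \<le> C"
    unfolding C_def by (simp_all add: add_increasing add_increasing2)
  have scale: "X \<le> ennreal (b * T)" if "X \<le> ennreal (a * T)" "a \<le> b" "0 < T" for X a b T
    using that by (meson ennreal_leI less_imp_le mult_right_mono order_trans)
  show ?thesis
  proof (intro exI conjI allI impI)
    have "1 / K \<le> 1"
      using K(1) by simp
    then show "1 / K \<le> C"
      using C(1) by (rule order_trans)
    show "0 < 1 / K"
      using K(1) by simp
  next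
    fix w \<sigma> :: "real ^ 'n \<Rightarrow> real" and S :: "(real ^ 'n) set set"
    assume asm: "weight w" "weight \<sigma>" "S \<subseteq> D"
    interpret dyadic_two_weight D p r w \<sigma> S
      by unfold_locales (use assms asm in auto)
    show "comparable (1 / K) C strong_norm
        (if r < p then testing p r w \<sigma> S + dual_testing p r w \<sigma> S else testing p r w \<sigma> S)"
    proof (cases "r < p")
      case True
      have "comparable (1 / K) C strong_norm (testing p r w \<sigma> S + dual_testing p r w \<sigma> S)"
      proof (rule comparableI)
        fix A :: real assume A: "0 < A" "strong_norm < ennreal A"
        have "weak_norm \<le> strong_norm"
        proof -
          have "weak_norm \<le> ennreal 1 * strong_norm"
            by (rule ennreal_le_of_real_bounds) (use weak_le_strong_norm in auto)
          then show ?thesis by simp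
        qed
        then have "weak_norm < ennreal A"
          using A(2) by (rule le_less_trans)
        then have "testing p r w \<sigma> S + dual_testing p r w \<sigma> S
            \<le> ennreal A + ennreal (dual_const s q powr (1 / q) * A)"
          using A True by (intro add_mono testing_lower dual_testing_lower)
        also have "\<dots> = ennreal (K * A)"
          using A(1) by (simp add: K_def distrib_right)
        finally show "testing p r w \<sigma> S + dual_testing p r w \<sigma> S \<le> ennreal (K * A)" .
      next
        fix T :: real assume T: "0 < T" "testing p r w \<sigma> S + dual_testing p r w \<sigma> S < ennreal T"
        have "testing p r w \<sigma> S \<le> testing p r w \<sigma> S + dual_testing p r w \<sigma> S"
          "dual_testing p r w \<sigma> S \<le> testing p r w \<sigma> S + dual_testing p r w \<sigma> S"
          by simp_all
        then have "testing p r w \<sigma> S \<le> ennreal T" "dual_testing p r w \<sigma> S \<le> ennreal T"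
          using less_imp_le[OF T(2)] by (blast intro: order_trans)+
        then show "strong_norm \<le> ennreal (C * T)"
          using scale[OF strong_norm_upper C(3)] True T(1) by blast
      qed (use K C in auto)
      then show ?thesis
        using True by simp
    next
      case False
      have "comparable (1 / K) C strong_norm (testing p r w \<sigma> S)"
      proof (rule comparableI)
        fix A :: real assume A: "0 < A" "strong_norm < ennreal A"
        then have "testing p r w \<sigma> S \<le> ennreal (1 * A)"
          using testing_lower by simp
        then show "testing p r w \<sigma> S \<le> ennreal (K * A)"
          by (rule scale) (use K A in auto)
      next
        fix T :: real assume T: "0 < T" "testing p r w \<sigma> S < ennreal T"
        show "strong_norm \<le> ennreal (C * T)"
          by (rule scale[OF strong_norm_upper_small_exponent C(2)]) (use False T in auto)
      qed (use K C in auto)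
      then show ?thesis
        using False by simp
    qed
    show "comparable (1 / K) C weak_norm (dual_testing p r w \<sigma> S)" if rp: "r < p"
    proof (rule comparableI)
      fix A :: real assume A: "0 < A" "weak_norm < ennreal A"
      show "dual_testing p r w \<sigma> S \<le> ennreal (K * A)"
        by (rule scale[OF dual_testing_lower K(2)]) (use rp A in auto)
    next
      fix T :: real assume T: "0 < T" "dual_testing p r w \<sigma> S < ennreal T"
      show "weak_norm \<le> ennreal (C * T)"
        by (rule scale[OF weak_norm_upper C(4)]) (use rp T in auto)
    qed (use K C in auto)
  qed
qed

end
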